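(* Let $k>1$ be an integer. Then, as $n\to\infty$, $$KP_k(n) = (\zeta(k)-1)\frac{n}{\log n} + O\!\left(\frac{n}{\log^2 n}\right),$$ where $\zeta$ is the Riemann zeta function.
   Context: For an integer $k$, a KP$_k$ number is a natural number of the form $p\cdot a^k$ where $p$ is a prime and $a\geq 2$ is a natural number. $KP_k(n)$ denotes the number of KP$_k$ numbers smaller than $n$. Here $\log$ is the natural logarithm. *)

theory Defs
  imports
    Complex_Main
    "HOL-Computational_Algebra.Primes"
    "HOL-Library.Landau_Symbols"
begin

(* Restricted to real arguments s > 1, where the Dirichlet series converges;
   the analytic continuation is not covered. *)
definition zeta :: "real \<Rightarrow> real" where
  "zeta s = (\<Sum>n. 1 / real (Suc n) powr s)"

definition KP_number :: "nat \<Rightarrow> nat \<Rightarrow> bool" where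
  "KP_number k m \<longleftrightarrow> (\<exists>p a. prime p \<and> a \<ge> 2 \<and> m = p * a ^ k)"

definition KP :: "nat \<Rightarrow> nat \<Rightarrow> nat" where
  "KP k n = card {m. m < n \<and> KP_number k m}"

end

theory Submission
  imports
    Defs
    "HOL-Complex_Analysis.Complex_Analysis"
    "HOL-Number_Theory.Prime_Powers"
    "HOL-Real_Asymp.Real_Asymp"
begin

text \<open>
  A number has at most one representation $p a^k$ with $k > 1$, so $KP_k(n)$ is the sum over
  $a \ge 2$ of the number of primes below $n / a^k$, and the prime number theorem in the form
  $\pi(x) = x / \log x + O(x / \log^2 x)$ gives the claim, since $\sum_a a^{-k} \log a$ converges and
  the terms with $a^k > \sqrt n$ are negligible.

  To prove the prime number theorem with this error term, Perron's formula expresses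
  $\sum_{n \le x} \Lambda(n) (1 - n / x)$ as an integral of $-\zeta'/\zeta(s)\, x^s / (s (s + 1))$ over the
  line of real part $\sigma = 1 + 1 / \log x$. Writing $Z(s) = (s - 1) \zeta(s)$, the pole $1 / (s - 1)$ is
  integrated exactly and there remains the integral of $Z'/Z(s)\, x^s / (s (s + 1))$. The factor $Z'/Z$
  and its first two derivatives are $O(|t|^{1/2})$ uniformly for $1 < \sigma \le 2$: upper bounds come from
  a series for $Z$ converging slightly to the left of the line of real part 1, lower bounds from the
  inequality $3 + 4 \cos \theta + \cos 2 \theta \ge 0$. Integrating by parts twice therefore saves
  $\log^2 x$, without any analysis on the line of real part 1 itself. Removing the smoothing costs one
  logarithm.
\<close>

section \<open>Integrals over vertical lines and the Perron kernel\<close>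

text \<open>All estimates are tuned to one integrable majorant,
  \<open>(1 + \<bar>t\<bar>) powr (-3/2)\<close>. The kernel 1 / (s (s + 1)) supplies the exponent
  -2, so Z'/Z and its first two derivatives may grow with exponent at most 1/2. The upper bounds for
  Z and its derivatives have exponent 33/32: 1 from the factor s - 1, and 1/32 paid for convergence
  beyond the line of real part 1. The lower bound for Z has exponent 7/8. The worst term, Z'^3 /
  Z^3, then has exponent 3 (33/32 - 28/32) = 15/32, which just fits. Since the bounds are uniform as
  the real part tends to 1, the choice of the real part 1 + 1 / ln x costs only the factor x^(1 / ln
  x) = e. The two logarithms are won for the integral of \<open>psi\<close>. Comparing its values at
  distance x / ln x gives one back, so that psi(x) = x + O(x / ln x); this suffices, as the passage
  from \<open>psi\<close> to the number of primes divides by ln x again.\<close>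

lemma integrable_powr_three_halves: "integrable lborel (\<lambda>t::real. (1 + \<bar>t\<bar>) powr (-3/2))"
proof -
  define f where "f = (\<lambda>t::real. indicator {0..} t * (1 + t) powr (-3/2))"
  have [measurable]: "f \<in> borel_measurable lborel" "f \<in> borel_measurable borel"
    unfolding f_def by measurable
  have lim: "((\<lambda>t. - 2 * (1 + t) powr (-1/2)) \<longlongrightarrow> (0::real)) at_top"
    by real_asymp
  have "(\<integral>\<^sup>+t. ennreal ((1 + t) powr (-3/2)) * indicator {0..} t \<partial>lborel) 
          = ennreal (0 - (- 2 * (1 + 0) powr (-1/2)))"
    by (rule nn_integral_FTC_atLeast[OF _ _ _ lim])
       (auto intro!: derivative_eq_intros simp: field_simps)
  moreover have "(\<integral>\<^sup>+t. ennreal (f t) \<partial>lborel) = 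
        (\<integral>\<^sup>+t. ennreal ((1 + t) powr (-3/2)) * indicator {0..} t \<partial>lborel)"
    by (intro nn_integral_cong) (auto simp: f_def indicator_def)
  ultimately have int: "integrable lborel f"
    by (intro integrableI_nonneg) (auto simp: f_def)
  have int': "integrable lborel (\<lambda>t. f (0 + (-1) * t))"
    using int by (subst lborel_integrable_real_affine_iff) auto
  show ?thesis
    by (rule Bochner_Integration.integrable_bound[OF Bochner_Integration.integrable_add[OF int int']])
       (auto simp: f_def indicator_def)
qed

lemma integrable_dominated_powr:
  fixes f :: "real \<Rightarrow> complex"
  assumes "continuous_on UNIV f" "\<And>t. norm (f t) \<le> C * (1 + \<bar>t\<bar>) powr (-3/2)"
  shows "integrable lborel f"
    and "norm (\<integral>t. f t \<partial>lborel) \<le> C * (\<integral>t. (1 + \<bar>t\<bar>) powr (-3/2) \<partial>lborel)"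
proof -
  have int: "integrable lborel (\<lambda>t::real. C * (1 + \<bar>t\<bar>) powr (-3/2))"
    using integrable_powr_three_halves by simp
  have [measurable]: "f \<in> borel_measurable lborel"
    using assms(1) borel_measurable_continuous_onI by auto
  show int2: "integrable lborel f"
    by (rule Bochner_Integration.integrable_bound[OF int]) 
       (auto intro!: order.trans[OF assms(2)[simplified] abs_ge_self])
  have "norm (\<integral>t. f t \<partial>lborel) \<le> (\<integral>t. C * (1 + \<bar>t\<bar>) powr (-3/2) \<partial>lborel)"
    by (rule Bochner_Integration.integral_norm_bound_integral[OF int2 int]) (use assms(2) in auto)
  thus "norm (\<integral>t. f t \<partial>lborel) \<le> C * (\<integral>t. (1 + \<bar>t\<bar>) powr (-3/2) \<partial>lborel)"
    by simp
qed

text \<open>Links the Lebesgue integral over the line, which dominated convergence and the exchange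
  with series require, to the gauge integrals over compact intervals in which contour integrals and
  the fundamental theorem of calculus are stated.\<close>

lemma tendsto_symmetric_integral:
  fixes f :: "real \<Rightarrow> complex"
  assumes int: "integrable lborel f" and cont: "continuous_on UNIV f"
  shows "(\<lambda>n. integral {-real n..real n} f) \<longlonglongrightarrow> (\<integral>t. f t \<partial>lborel)"
proof -
  have [measurable]: "f \<in> borel_measurable lborel"
    using cont borel_measurable_continuous_onI by auto
  have "(\<lambda>n. \<integral>t. indicator {-real n..real n} t *\<^sub>R f t \<partial>lborel) \<longlonglongrightarrow> (\<integral>t. f t \<partial>lborel)"
  proof (rule integral_dominated_convergence)
    show "integrable lborel (\<lambda>t. norm (f t))" using int by auto
    show "AE t in lborel. (\<lambda>n. indicator {-real n..real n} t *\<^sub>R f t) \<longlonglongrightarrow> f t"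
    proof (intro AE_I2)
      fix t :: real
      have "eventually (\<lambda>n. \<bar>t\<bar> \<le> real n) sequentially"
        using filterlim_real_sequentially unfolding filterlim_at_top by auto
      hence "eventually (\<lambda>n. indicator {-real n..real n} t *\<^sub>R f t = f t) sequentially"
        by eventually_elim (auto simp: indicator_def)
      thus "(\<lambda>n. indicator {-real n..real n} t *\<^sub>R f t) \<longlonglongrightarrow> f t"
        by (rule tendsto_eventually)
    qed
  qed (auto simp: indicator_def)
  moreover have "(\<integral>t. indicator {-real n..real n} t *\<^sub>R f t \<partial>lborel) = integral {-real n..real n} f" for n
  proof -
    have "set_integrable lborel {-real n..real n} f"
      by (rule borel_integrable_atLeastAtMost') (rule continuous_on_subset[OF cont], simp)
    from set_borel_integral_eq_integral(2)[OF this] show ?thesis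
      by (simp add: set_lebesgue_integral_def)
  qed
  ultimately show ?thesis by simp
qed

text \<open>Applied to a product, this is integration by parts over the whole line with vanishing
  boundary terms.\<close>

lemma integral_derivative_eq_0:
  fixes g g' :: "real \<Rightarrow> complex"
  assumes "\<And>t. (g has_vector_derivative g' t) (at t)" 
    and cont: "continuous_on UNIV g'" and int: "integrable lborel g'"
    and lim: "(g \<longlongrightarrow> 0) at_top" "(g \<longlongrightarrow> 0) at_bot"
  shows "(\<integral>t. g' t \<partial>lborel) = 0"
proof -
  have "integral {-real n..real n} g' = g (real n) - g (- real n)" for n
    by (intro integral_unique fundamental_theorem_of_calculus)
       (auto intro: has_vector_derivative_at_within assms)
  hence "(\<lambda>n. g (real n) - g (- real n)) \<longlonglongrightarrow> (\<integral>t. g' t \<partial>lborel)"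
    using tendsto_symmetric_integral[OF int cont] by simp
  moreover have "(\<lambda>n. g (real n) - g (- real n)) \<longlonglongrightarrow> 0 - 0"
    by (intro tendsto_diff filterlim_compose[OF lim(1)] filterlim_compose[OF lim(2)] 
              filterlim_real_sequentially) (real_asymp)
  ultimately show ?thesis using LIMSEQ_unique by fastforce
qed

text \<open>The norm dominates both the horizontal distance and the height, hence their mean. The
  minimum with 1 lets one constant multiply the whole of
  \<open>1 + \<bar>Im s\<bar>\<close>.\<close>

lemma norm_complex_minus_real_ge:
  assumes "Re s = c" "a < c"
  shows "norm (s - of_real a) \<ge> min (c - a) 1 / 2 * (1 + \<bar>Im s\<bar>)"
proof -
  have "\<bar>Re (s - of_real a)\<bar> \<le> norm (s - of_real a)" "\<bar>Im (s - of_real a)\<bar> \<le> norm (s - of_real a)"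
    by (rule abs_Re_le_cmod abs_Im_le_cmod)+
  hence 1: "c - a \<le> norm (s - of_real a)" "\<bar>Im s\<bar> \<le> norm (s - of_real a)" 
    using assms by auto
  have "min (c - a) 1 * (1 + \<bar>Im s\<bar>) \<le> (c - a) + \<bar>Im s\<bar>"
  proof -
    have "min (c - a) 1 * \<bar>Im s\<bar> \<le> 1 * \<bar>Im s\<bar>" by (intro mult_right_mono) auto
    thus ?thesis by (simp add: ring_distribs)
  qed
  with 1 show ?thesis by simp
qed

text \<open>The two linear factors give quadratic decay; it is weakened to the exponent -3/2 so that
  a single majorant serves all integrals over vertical lines.\<close>

lemma norm_Perron_integrand_le:
  assumes "a < c" "b < c"
  shows "norm (exp (Complex c t * of_real y) / ((Complex c t - of_real a) * (Complex c t - of_real b)))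
     \<le> (4 * exp (c * y) / (min (c - a) 1 * min (c - b) 1)) * (1 + \<bar>t\<bar>) powr (-3/2)"
proof -
  have 1: "norm (Complex c t - of_real a) \<ge> min (c - a) 1 / 2 * (1 + \<bar>t\<bar>)"
    using norm_complex_minus_real_ge[of "Complex c t" c a] assms by simp
  have 2: "norm (Complex c t - of_real b) \<ge> min (c - b) 1 / 2 * (1 + \<bar>t\<bar>)"
    using norm_complex_minus_real_ge[of "Complex c t" c b] assms by simp
  have 3: "(1 + \<bar>t\<bar>) powr (3/2) \<le> (1 + \<bar>t\<bar>) powr 2" by (intro powr_mono) auto
  have "min (c - a) 1 * min (c - b) 1 / 4 * (1 + \<bar>t\<bar>) powr (3/2) 
          \<le> min (c - a) 1 * min (c - b) 1 / 4 * (1 + \<bar>t\<bar>) powr 2"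
    using assms 3 by (intro mult_left_mono) auto
  also have "\<dots> = (min (c - a) 1 / 2 * (1 + \<bar>t\<bar>)) * (min (c - b) 1 / 2 * (1 + \<bar>t\<bar>))"
    by (simp add: power2_eq_square)
  also have "\<dots> \<le> norm (Complex c t - of_real a) * norm (Complex c t - of_real b)"
    using assms by (intro mult_mono 1 2) auto
  finally have 4: "min (c - a) 1 * min (c - b) 1 / 4 * (1 + \<bar>t\<bar>) powr (3/2) 
     \<le> norm (Complex c t - of_real a) * norm (Complex c t - of_real b)" .
  have pos: "min (c - a) 1 * min (c - b) 1 / 4 * (1 + \<bar>t\<bar>) powr (3/2) > 0"
    using assms by (intro mult_pos_pos divide_pos_pos) auto
  have "norm (exp (Complex c t * of_real y) / ((Complex c t - of_real a) * (Complex c t - of_real b)))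
     = exp (c * y) / (norm (Complex c t - of_real a) * norm (Complex c t - of_real b))"
    by (simp add: norm_divide norm_mult)
  also have "\<dots> \<le> exp (c * y) / (min (c - a) 1 * min (c - b) 1 / 4 * (1 + \<bar>t\<bar>) powr (3/2))"
    by (intro divide_left_mono 4 mult_pos_pos[OF less_le_trans[OF pos 4] pos]) auto
  also have "\<dots> = (4 * exp (c * y) / (min (c - a) 1 * min (c - b) 1)) * (1 + \<bar>t\<bar>) powr (-3/2)"
    using assms by (simp add: powr_minus field_simps)
  finally show ?thesis .
qed

lemma continuous_on_Perron_integrand:
  assumes "a < c" "b < c"
  shows "continuous_on UNIV (\<lambda>t. exp (Complex c t * of_real y) / ((Complex c t - of_real a) * (Complex c t - of_real b)))"
proof -
  have 1: "Complex c t \<noteq> of_real a" "Complex c t \<noteq> of_real b" for t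
    using assms by (auto simp: complex_eq_iff)
  have [continuous_intros]: "continuous_on UNIV (Complex c)"
    unfolding Complex_eq by (intro continuous_intros)
  show ?thesis using 1
    by (intro continuous_intros) auto
qed

text \<open>The rectangle is closed on the left for $y \ge 0$ and on the right for $y < 0$, so that $e^{s y}$ stays bounded.\<close>

lemma Perron_rectangle:
  fixes a b c y R :: real
  assumes "a \<noteq> b" "a < c" "b < c"  "R > 2 * (\<bar>a\<bar> + \<bar>b\<bar> + \<bar>c\<bar> + 1)"
  defines "g \<equiv> (\<lambda>s. exp (s * of_real y) / ((s - of_real a) * (s - of_real b)))"
  shows "norm (integral {-R..R} (\<lambda>t. g (Complex c t)) - 
           of_real (if y \<ge> 0 then 2 * pi * (exp (a * y) - exp (b * y)) / (a - b) else 0)) \<le> 24 * exp (c * y) / R"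
proof -
  have R: "R > 0" "R > c" "-R < a" "-R < b" "-R < c" "a < R" "b < R" using assms(2-4) abs_ge_zero[of a] abs_ge_zero[of b] abs_ge_zero[of c]
     abs_ge_self[of a] abs_ge_minus_self[of a] abs_ge_self[of b] abs_ge_minus_self[of b] 
     abs_ge_self[of c] abs_ge_minus_self[of c] by simp_all
  define d where "d = (if y \<ge> 0 then - R else R)"
  \<comment> \<open>Partial fractions split \<open>g\<close> into two Cauchy kernels with an entire
    numerator. Leaving the closed path \<open>p\<close> arbitrary covers the rectangles on either
    side of the line.\<close>
  have cauchy: "(g has_contour_integral 
           (2 * pi * \<i> * winding_number p (of_real a) * (exp (of_real a * of_real y) / of_real (a - b))
           -2 * pi * \<i> * winding_number p (of_real b) * (exp (of_real b * of_real y) / of_real (a - b)))) p"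
    if p: "valid_path p" "pathfinish p = pathstart p" "of_real a \<notin> path_image p" "of_real b \<notin> path_image p"
    for p
  proof (rule has_contour_integral_eq)
    show "((\<lambda>w. (exp (w * of_real y) / of_real (a - b)) / (w - of_real a) - 
                (exp (w * of_real y) / of_real (a - b)) / (w - of_real b)) has_contour_integral 
           (2 * pi * \<i> * winding_number p (of_real a) * (exp (of_real a * of_real y) / of_real (a - b))
           -2 * pi * \<i> * winding_number p (of_real b) * (exp (of_real b * of_real y) / of_real (a - b)))) p"
      by (intro has_contour_integral_diff Cauchy_integral_formula_convex_simple[of UNIV])
         (use p assms(1) in \<open>auto intro!: holomorphic_intros\<close>)
    fix w assume "w \<in> path_image p"
    hence "w \<noteq> of_real a" "w \<noteq> of_real b" using p by auto
    thus "exp (w * of_real y) / of_real (a - b) / (w - of_real a) - 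
                exp (w * of_real y) / of_real (a - b) / (w - of_real b) = g w"
      using assms(1) by (simp add: g_def divide_simps) (simp add: algebra_simps)
  qed
  have g_bound: "norm (g s) \<le> exp (c * y) / (R/2)\<^sup>2" 
    if s: "Re s * y \<le> c * y" "norm s \<ge> R" for s
  proof -
    have "norm (s - of_real a) \<ge> norm s - norm (of_real a :: complex)" by (rule norm_triangle_ineq2)
    hence 1: "norm (s - of_real a) \<ge> R/2" using s assms(4) by simp
    have "norm (s - of_real b) \<ge> norm s - norm (of_real b :: complex)" by (rule norm_triangle_ineq2)
    hence 2: "norm (s - of_real b) \<ge> R/2" using s assms(4) by simp
    have "(R/2)\<^sup>2 \<le> norm (s - of_real a) * norm (s - of_real b)"
      unfolding power2_eq_square using 1 2 R by (intro mult_mono) auto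
    moreover have "(R/2)\<^sup>2 > 0" using R by simp
    ultimately show ?thesis using s
      unfolding g_def norm_divide norm_mult by (intro frac_le) auto
  qed
  have contg: "continuous_on (UNIV - {of_real a, of_real b}) g"
    unfolding g_def by (intro continuous_intros) auto
  define A where "A = Complex d (-R)" 
  define B where "B = Complex c (-R)"
  define B' where "B' = Complex c R"
  define A' where "A' = Complex d R"
  note defs = A_def B_def B'_def A'_def
  \<comment> \<open>Covers the two horizontal edges and the far vertical edge, in both directions.
    Their points have norm at least \<open>R\<close>, and the side chosen by \<open>d\<close>
    ensures \<open>Re s * y \<le> c * y\<close>.\<close>
  have edge: "g contour_integrable_on (linepath u v) \<and> 
              norm (contour_integral (linepath u v) g) \<le> exp (c * y) / (R/2)\<^sup>2 * (2 * R)"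
    if "(Im u = Im v \<and> \<bar>Im u\<bar> = R \<and> {Re u, Re v} = {c, d}) \<or> (Re u = d \<and> Re v = d \<and> {Im u, Im v} = {R, -R})" for u v
  proof -
    have *: "Re s * y \<le> c * y \<and> norm s \<ge> R" if s: "s \<in> closed_segment u v" for s
    proof -
      from s obtain \<tau> where \<tau>: "0 \<le> \<tau>" "\<tau> \<le> 1" "s = (1 - \<tau>) *\<^sub>R u + \<tau> *\<^sub>R v" 
        unfolding closed_segment_def by auto
      have re: "Re s = (1 - \<tau>) * Re u + \<tau> * Re v" "Im s = (1 - \<tau>) * Im u + \<tau> * Im v" using \<tau> by auto
      have dy: "d * y \<le> c * y" 
        unfolding d_def using R mult_right_mono[of "-R" c y] mult_right_mono_neg[of c R y] by auto
      have "Re u * y \<le> c * y" "Re v * y \<le> c * y"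
        using that(1) \<open>(Im u = Im v \<and> _) \<or> _\<close> dy by (auto simp: doubleton_eq_iff)
      hence "(1 - \<tau>) * (Re u * y) + \<tau> * (Re v * y) \<le> (1 - \<tau>) * (c * y) + \<tau> * (c * y)"
        using \<tau> by (intro add_mono mult_left_mono) auto
      hence "Re s * y \<le> c * y" unfolding re by (simp add: algebra_simps)
      moreover have "\<bar>Re s\<bar> = R \<or> \<bar>Im s\<bar> = R"
        using \<open>(Im u = Im v \<and> _) \<or> _\<close>
      proof
        assume "Im u = Im v \<and> \<bar>Im u\<bar> = R \<and> {Re u, Re v} = {c, d}"
        thus ?thesis using re by (auto simp: algebra_simps)
      next
        assume "Re u = d \<and> Re v = d \<and> {Im u, Im v} = {R, -R}"
        hence "Re s = d" using re by (auto simp: algebra_simps)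
        thus ?thesis using R by (auto simp: d_def)
      qed
      hence "norm s \<ge> R" using abs_Re_le_cmod[of s] abs_Im_le_cmod[of s] by auto
      ultimately show ?thesis by blast
    qed
    have ne: "s \<noteq> of_real a \<and> s \<noteq> of_real b" if "s \<in> closed_segment u v" for s
      using *[OF that] assms(4) R by auto
    have int: "g contour_integrable_on (linepath u v)"
      by (rule contour_integrable_continuous_linepath, rule continuous_on_subset[OF contg]) (use ne in auto)
    have "norm (v - u) \<le> 2 * R"
    proof -
      have "\<bar>c - d\<bar> \<le> 2 * R" "\<bar>d - c\<bar> \<le> 2 * R" using R by (auto simp: d_def abs_if)
      moreover have "norm (v - u) \<le> \<bar>Re (v - u)\<bar> + \<bar>Im (v - u)\<bar>" by (rule cmod_le)
      ultimately show ?thesis using that R by (auto simp: doubleton_eq_iff)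
    qed
    have "norm (contour_integral (linepath u v) g) \<le> exp (c * y) / (R/2)\<^sup>2 * norm (v - u)"
      by (rule contour_integral_bound_linepath) (use int * g_bound in auto)
    also have "\<dots> \<le> exp (c * y) / (R/2)\<^sup>2 * (2 * R)"
      using \<open>norm (v - u) \<le> 2 * R\<close> by (intro mult_left_mono) auto
    finally show ?thesis using int by blast
  qed
  have intBB: "g contour_integrable_on (linepath B B')"
  proof (rule contour_integrable_continuous_linepath, rule continuous_on_subset[OF contg])
    have "Re s = c" if "s \<in> closed_segment B B'" for s
      using that by (auto simp: closed_segment_same_Re defs)
    thus "closed_segment B B' \<subseteq> UNIV - {of_real a, of_real b}" using assms by force
  qed
  have eBB: "contour_integral (linepath B B') g = \<i> * integral {-R..R} (\<lambda>t. g (Complex c t))"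
    by (rule contour_integral_linepath_same_Re) (use R in \<open>auto simp: defs\<close>)
  have e1: "g contour_integrable_on (linepath A B)" "norm (contour_integral (linepath A B) g) \<le> exp (c * y) / (R/2)\<^sup>2 * (2 * R)"
    using edge[of A B] R by (auto simp: defs)
  have e2: "g contour_integrable_on (linepath B' A')" "norm (contour_integral (linepath B' A') g) \<le> exp (c * y) / (R/2)\<^sup>2 * (2 * R)"
    using edge[of B' A'] R by (auto simp: defs)
  have e3: "g contour_integrable_on (linepath A' A)" "norm (contour_integral (linepath A' A) g) \<le> exp (c * y) / (R/2)\<^sup>2 * (2 * R)"
    using edge[of A' A] R by (auto simp: defs)
  have rev: "g contour_integrable_on (linepath v u)" if "g contour_integrable_on (linepath u v)" for u v
    using that by (metis contour_integrable_reversepath reversepath_linepath valid_path_linepath)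
  define I where "I = contour_integral (linepath A B) g + contour_integral (linepath B B') g +
                contour_integral (linepath B' A') g + contour_integral (linepath A' A) g"
  have I: "I = \<i> * of_real (if y \<ge> 0 then 2 * pi * (exp (a * y) - exp (b * y)) / (a - b) else 0)"
  proof (cases "y \<ge> 0")
    case True
    hence d: "d = -R" by (simp add: d_def)
    have p: "rectpath A B' = linepath A B +++ linepath B B' +++ linepath B' A' +++ linepath A' A"
      by (simp add: rectpath_def defs Let_def)
    have box: "of_real a \<in> box A B'" "of_real b \<in> box A B'" 
      using R assms by (auto simp: in_box_complex_iff defs d)
    have out: "of_real a \<notin> path_image (rectpath A B')" "of_real b \<notin> path_image (rectpath A B')"
      using path_image_rectpath_inter_box[of A B'] R box by (auto simp: defs d)
    have w: "winding_number (rectpath A B') (of_real a) = 1" "winding_number (rectpath A B') (of_real b) = 1"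
      using winding_number_rectpath box by auto
    have "contour_integral (rectpath A B') g = 
       2 * pi * \<i> * (exp (of_real a * of_real y) / of_real (a - b))
           -2 * pi * \<i> * (exp (of_real b * of_real y) / of_real (a - b))"
      using contour_integral_unique[OF cauchy[of "rectpath A B'"]] out w by simp
    also have "contour_integral (rectpath A B') g = I"
      unfolding p I_def using e1 e2 e3 intBB by (simp add: contour_integrable_joinI)
    finally show ?thesis using True by (simp add: exp_of_real diff_divide_distrib algebra_simps flip: exp_of_real)
  next
    \<comment> \<open>The rectangle now lies to the right of the line and contains neither pole. Its
      positive orientation runs down the line of real part \<open>c\<close>, so the contour integral
      is \<open>- I\<close>.\<close>
    case False
    hence d: "d = R" by (simp add: d_def)
    have p: "rectpath B A' = linepath B A +++ linepath A A' +++ linepath A' B' +++ linepath B' B"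
      by (simp add: rectpath_def defs Let_def)
    have box: "of_real a \<notin> cbox B A'" "of_real b \<notin> cbox B A'" 
      using R assms by (auto simp: in_cbox_complex_iff defs d)
    have le: "Re B \<le> Re A'" "Im B \<le> Im A'" using R by (auto simp: defs d)
    have out: "of_real a \<notin> path_image (rectpath B A')" "of_real b \<notin> path_image (rectpath B A')"
      using path_image_rectpath_subset_cbox[of B A'] le box by auto
    have w: "winding_number (rectpath B A') (of_real a) = 0" "winding_number (rectpath B A') (of_real b) = 0"
      using winding_number_rectpath_outside[OF le] box by auto
    have "contour_integral (rectpath B A') g = 0"
      using contour_integral_unique[OF cauchy[of "rectpath B A'"]] out w by simp
    also have "contour_integral (rectpath B A') g = contour_integral (linepath B A) g + contour_integral (linepath A A') g +
                contour_integral (linepath A' B') g + contour_integral (linepath B' B) g"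
      using rev[OF e1(1)] rev[OF e2(1)] rev[OF e3(1)] rev[OF intBB] unfolding p
      by (simp add: contour_integrable_joinI)
    also have "\<dots> = - I"
      using contour_integral_reversepath[of "linepath A B" g] contour_integral_reversepath[of "linepath A' A" g]
            contour_integral_reversepath[of "linepath B' A'" g] contour_integral_reversepath[of "linepath B B'" g] 
      by (simp add: I_def)
    finally show ?thesis using False by simp
  qed
  have "norm (\<i> * (integral {-R..R} (\<lambda>t. g (Complex c t)) - 
           of_real (if y \<ge> 0 then 2 * pi * (exp (a * y) - exp (b * y)) / (a - b) else 0))) = 
        norm (contour_integral (linepath A B) g + contour_integral (linepath B' A') g + contour_integral (linepath A' A) g)"
  proof -
    have aux: "u * (v - w) = - (p + q + q')" if "p + u * v + q + q' = u * w" for u v w p q q' :: complex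
      using that by (simp add: algebra_simps add_eq_0_iff)
    show ?thesis
      by (subst aux[OF I[unfolded I_def eBB]]) (rule norm_minus_cancel)
  qed
  \<comment> \<open>Three edges of length at most \<open>2 * R\<close>, each contributing at most
    \<open>8 * exp (c * y) / R\<close>.\<close>
  also have "\<dots> \<le> 3 * (exp (c * y) / (R/2)\<^sup>2 * (2 * R))"
    by (rule order.trans[OF norm_triangle_mono[OF norm_triangle_mono[OF e1(2) e2(2)] e3(2)]]) (simp add: mult.commute)
  also have "\<dots> = 24 * exp (c * y) / R"
    using R by (simp add: field_simps power2_eq_square)
  finally show ?thesis by (simp add: norm_mult)
qed

text \<open>The limit of the rectangle formula for growing \<open>R\<close>. It is used with poles 0
  and -1 for the single terms of a Dirichlet series, and also with poles 1 and 0 for the pole of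
  zeta.\<close>

lemma Perron_integral:
  assumes "a \<noteq> b" "a < c" "b < c"
  shows "(\<integral>t. exp (Complex c t * of_real y) / ((Complex c t - of_real a) * (Complex c t - of_real b)) \<partial>lborel) 
       = of_real (if y \<ge> 0 then 2 * pi * (exp (a * y) - exp (b * y)) / (a - b) else 0)"
    (is "(\<integral>t. ?f t \<partial>lborel) = ?K")
proof -
  have int: "integrable lborel ?f"
    using integrable_dominated_powr(1)[OF continuous_on_Perron_integrand norm_Perron_integrand_le] assms by blast
  have "(\<lambda>n. integral {-real n..real n} ?f - ?K) \<longlonglongrightarrow> 0"
  proof (rule Lim_null_comparison)
    have "eventually (\<lambda>n. real n > 2 * (\<bar>a\<bar> + \<bar>b\<bar> + \<bar>c\<bar> + 1)) sequentially"
      using filterlim_real_sequentially unfolding filterlim_at_top_dense by auto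
    thus "eventually (\<lambda>n. norm (integral {-real n..real n} ?f - ?K) \<le> 24 * exp (c * y) / real n) sequentially"
      by eventually_elim (rule Perron_rectangle[OF assms])
    show "(\<lambda>n. 24 * exp (c * y) / real n) \<longlonglongrightarrow> 0" by real_asymp
  qed
  moreover have "(\<lambda>n. integral {-real n..real n} ?f - ?K) \<longlonglongrightarrow> (\<integral>t. ?f t \<partial>lborel) - ?K"
    by (intro tendsto_intros tendsto_symmetric_integral int continuous_on_Perron_integrand assms)
  ultimately show ?thesis using LIMSEQ_unique by fastforce
qed

section \<open>The regularised zeta function\<close>

text \<open>
  The regularised zeta function $(s - 1) \zeta(s)$, from $\zeta(s) = \sum_n n^{-s}$ and the telescoping series
  $1 = \sum_n (n^{1 - s} - (n + 1)^{1 - s})$. Each term is $s - 1$ times the difference of $n^{-s}$ and its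
  average over $[n, n + 1]$, so the series converges beyond the line of real part 1.
\<close>

definition zeta_term :: "nat \<Rightarrow> complex \<Rightarrow> complex" where
  "zeta_term n s = (s - 1) * of_nat n powr (-s) - of_nat n powr (1 - s) + of_nat (Suc n) powr (1 - s)"

definition reg_zeta :: "complex \<Rightarrow> complex" where
  "reg_zeta s = 1 + (\<Sum>n. zeta_term (Suc n) s)"

text \<open>The first bound is the triangle inequality, the second the mean value inequality for
  \<open>z powr (-s)\<close>. The first does not grow with \<open>s\<close> but is not summable over
  \<open>n\<close> for \<open>Re s \<le> 1\<close>; the second gains a power of \<open>n\<close> at
  the price of a full factor \<open>norm s\<close>.\<close>

lemma norm_powr_neg_diff_le:
  assumes "n > 0" "Re s > 0" "0 \<le> u" "u \<le> 1"
  shows "norm (of_nat n powr (-s) - of_real (real n + u) powr (-s)) \<le> 2 * real n powr (- Re s)"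
    and "norm (of_nat n powr (-s) - of_real (real n + u) powr (-s)) \<le> norm s * real n powr (- Re s - 1)"
proof -
  have 1: "norm (of_nat n powr (-s)) = real n powr (- Re s)"
    by (simp add: norm_powr_real_powr)
  have "norm (of_real (real n + u) powr (-s)) = (real n + u) powr (- Re s)"
    using assms by (simp add: norm_powr_real_powr)
  also have "\<dots> \<le> real n powr (- Re s)"
    by (rule powr_mono2') (use assms in auto)
  finally show "norm (of_nat n powr (-s) - of_real (real n + u) powr (-s)) \<le> 2 * real n powr (- Re s)"
    using norm_triangle_ineq4[of "of_nat n powr (-s)" "of_real (real n + u) powr (-s)"] 1
    by linarith
next
  define S where "S = closed_segment (complex_of_real (real n)) (of_real (real n + u))"
  have S: "\<exists>v\<ge>real n. z = of_real v" if z: "z \<in> S" for z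
  proof -
    from z obtain \<tau> where \<tau>: "0 \<le> \<tau>" "z = (1 - \<tau>) *\<^sub>R of_real (real n) + \<tau> *\<^sub>R of_real (real n + u)"
      unfolding S_def closed_segment_def by blast
    have "z = of_real (real n + \<tau> * u)"
      unfolding \<tau>(2) by (simp add: complex_eq_iff algebra_simps)
    thus ?thesis using \<tau>(1) assms by (intro exI[of _ "real n + \<tau> * u"]) auto
  qed
  have "norm ((\<lambda>z. z powr (-s)) (of_real (real n)) - (\<lambda>z. z powr (-s)) (of_real (real n + u)))
     \<le> (norm s * real n powr (- Re s - 1)) * norm (of_real (real n) - of_real (real n + u) :: complex)"
  proof (rule field_differentiable_bound[of S])
    fix z assume "z \<in> S"
    then obtain v where v: "v \<ge> real n" "z = of_real v" using S by blast
    have "z \<notin> \<real>\<^sub>\<le>\<^sub>0" using v assms(1) by (simp add: complex_nonpos_Reals_iff)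
    thus "((\<lambda>z. z powr (-s)) has_field_derivative ((-s) * z powr (-s - 1))) (at z within S)"
      by (rule has_field_derivative_at_within[OF has_field_derivative_powr])
    have "norm ((-s) * z powr (-s - 1)) = norm s * v powr (- Re s - 1)"
      unfolding norm_mult v(2) by (subst norm_powr_real_powr) (use v assms in auto)
    also have "\<dots> \<le> norm s * real n powr (- Re s - 1)"
      by (rule mult_left_mono, rule powr_mono2') (use v assms in auto)
    finally show "norm ((-s) * z powr (-s - 1)) \<le> norm s * real n powr (- Re s - 1)" .
  qed (auto simp: S_def)
  also have "norm (of_real (real n) - of_real (real n + u) :: complex) = \<bar>u\<bar>"
    unfolding of_real_diff [symmetric] norm_of_real by simp
  also have "norm s * real n powr (- Re s - 1) * \<bar>u\<bar> \<le> norm s * real n powr (- Re s - 1) * 1"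
    by (rule mult_left_mono) (use assms in auto)
  finally show "norm (of_nat n powr (-s) - of_real (real n + u) powr (-s)) \<le> norm s * real n powr (- Re s - 1)"
    unfolding of_real_of_nat_eq mult_1_right .
qed

text \<open>Interpolates with weight $1/32$ between the two bounds of the previous lemma.\<close>

lemma norm_zeta_term_le:
  assumes n: "n > 0" and s: "Re s > 63/64"
  shows "norm (zeta_term n s) \<le> 2 * norm (s - 1) * norm s powr (1/32) * real n powr (- (65/64))"
proof -
  have s0: "norm s > 0" using s by auto
  have *: "norm (of_nat n powr (-s) - of_real (real n + u) powr (-s)) \<le> 2 * (norm s powr (1/32) * real n powr (- (65/64)))" 
    (is "?l \<le> 2 * ?r")
    if u: "0 \<le> u" "u \<le> 1" for u
  proof -
    have "real n powr (- Re s) * (norm s / real n) powr (1/32) = norm s powr (1/32) * real n powr (- Re s - 1/32)"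
      using n by (simp add: powr_divide powr_diff)
    \<comment> \<open>Here \<open>Re s + 1/32 > 63/64 + 2/64 = 65/64\<close>, an exponent beyond 1,
      so the bound is summable over \<open>n\<close>.\<close>
    also have "\<dots> \<le> ?r"
      using n s by (intro mult_left_mono powr_mono) auto
    finally have r: "real n powr (- Re s) * (norm s / real n) powr (1/32) \<le> ?r" .
    show ?thesis
    \<comment> \<open>Comparing \<open>norm s\<close> with \<open>n\<close> decides which of the two
      bounds to use; the one used lies below the interpolated bound up to the factor 2.\<close>
    proof (cases "norm s / real n \<ge> 1")
      case True
      have "?l \<le> 2 * real n powr (- Re s) * 1" using norm_powr_neg_diff_le(1)[OF n _ u, of s] s by simp
      also have "\<dots> \<le> 2 * real n powr (- Re s) * (norm s / real n) powr (1/32)"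
        using True by (intro mult_left_mono ge_one_powr_ge_zero) auto
      finally show ?thesis using r by simp
    next
      case False
      hence lt: "norm s / real n < 1" by simp
      have "?l \<le> norm s * real n powr (- Re s - 1)" using norm_powr_neg_diff_le(2)[OF n _ u, of s] s by simp
      also have "\<dots> = real n powr (- Re s) * (norm s / real n) powr 1"
        using n s0 by (simp add: powr_diff)
      also have "\<dots> \<le> real n powr (- Re s) * (norm s / real n) powr (1/32)"
        using lt n s0 by (intro mult_left_mono powr_mono') (auto simp: divide_le_eq)
      also have "\<dots> \<le> ?r" by (rule r)
      also have "\<dots> \<le> 2 * ?r" by simp
      finally show ?thesis .
    qed
  qed
  \<comment> \<open>\<open>F 1 - F 0\<close> is the zeta term, and the derivative of
    \<open>F\<close> at \<open>u\<close> is \<open>s - 1\<close> times the difference just bounded.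
    The mean value inequality on the unit segment thus does the averaging over the interval from
    \<open>n\<close> to \<open>n + 1\<close>.\<close>
  define F where "F = (\<lambda>z::complex. (s - 1) * z * of_nat n powr (-s) + (of_nat n + z) powr (1 - s))"
  define S where "S = closed_segment (0::complex) 1"
  have S: "\<exists>u. 0 \<le> u \<and> u \<le> 1 \<and> z = of_real u" if z: "z \<in> S" for z
  proof -
    from z obtain \<tau> where \<tau>: "0 \<le> \<tau>" "\<tau> \<le> 1" "z = (1 - \<tau>) *\<^sub>R 0 + \<tau> *\<^sub>R 1"
      unfolding S_def closed_segment_def by blast
    thus ?thesis by (intro exI[of _ \<tau>]) (auto simp: complex_eq_iff)
  qed
  have "norm (F 1 - F 0) \<le> (norm (s - 1) * (2 * (norm s powr (1/32) * real n powr (- (65/64))))) * norm (1 - 0 :: complex)"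
  proof (rule field_differentiable_bound[of S])
    fix z assume "z \<in> S"
    then obtain u where u: "u \<ge> 0" "u \<le> 1" "z = of_real u" using S by blast
    have eq: "of_nat n + z = of_real (real n + u)" using u by simp
    have "of_nat n + z \<notin> \<real>\<^sub>\<le>\<^sub>0" unfolding eq using u n by (subst complex_nonpos_Reals_iff) auto
    hence "(F has_field_derivative ((s - 1) * of_nat n powr (-s) + (1 - s) * (of_nat n + z) powr (1 - s - 1))) (at z)"
      unfolding F_def by (auto intro!: derivative_eq_intros)
    also have "(s - 1) * of_nat n powr (-s) + (1 - s) * (of_nat n + z) powr (1 - s - 1) = 
                  (s - 1) * (of_nat n powr (-s) - of_real (real n + u) powr (-s))"
      unfolding eq by (simp add: algebra_simps)
    \<comment> \<open>The derivative must be given as a function of \<open>z\<close> alone, so the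
      point \<open>real n + u\<close> is recovered as a real part.\<close>
    finally show "(F has_field_derivative (s - 1) * (of_nat n powr (-s) - of_real (Re (of_nat n + z)) powr (-s))) (at z within S)"
      using eq by (intro has_field_derivative_at_within[where s=S]) simp
    have "of_real (Re (of_nat n + z)) = (of_real (real n + u) :: complex)" using eq by simp
    thus "norm ((s - 1) * (of_nat n powr (-s) - of_real (Re (of_nat n + z)) powr (-s))) \<le> 
        norm (s - 1) * (2 * (norm s powr (1/32) * real n powr (- (65/64))))"
      unfolding norm_mult by (intro mult_left_mono) (use * u in auto)
  qed (auto simp: S_def)
  also have "F 1 - F 0 = zeta_term n s"
    by (simp add: F_def zeta_term_def add.commute)
  finally show ?thesis by simp
qed

lemma summable_zeta_bound: "summable (\<lambda>n. real (Suc n) powr (- (65/64)))"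
  by (subst summable_Suc_iff, subst summable_real_powr_iff) auto

lemma
  assumes "Re s > 63/64"
  shows summable_norm_zeta_term: "summable (\<lambda>n. norm (zeta_term (Suc n) s))"
    and summable_zeta_term: "summable (\<lambda>n. zeta_term (Suc n) s)"
proof -
  show "summable (\<lambda>n. norm (zeta_term (Suc n) s))"
    by (rule summable_comparison_test'[where N = 0, 
               OF summable_mult[OF summable_zeta_bound, of "2 * norm (s - 1) * norm s powr (1/32)"]])
       (use norm_zeta_term_le[OF zero_less_Suc assms] in simp)
  thus "summable (\<lambda>n. zeta_term (Suc n) s)" by (rule summable_norm_cancel)
qed

text \<open>Locally uniform convergence past the line of real part 1 leaves room for discs of a
  fixed radius around all points of the closed strip, as Cauchy's inequality requires.\<close>

lemma holomorphic_reg_zeta: "reg_zeta holomorphic_on {s. Re s > 63/64}"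
proof -
  define S where "S = {s. Re s > (63/64)}"
  have opS: "open S" unfolding S_def by (rule open_halfspace_Re_gt)
  have hol: "zeta_term (Suc n) holomorphic_on S" for n
    unfolding zeta_term_def by (intro holomorphic_intros)
  have "\<exists>g g'. \<forall>x \<in> S. ((\<lambda>n. zeta_term (Suc n) x) sums g x) \<and> 
          ((\<lambda>n. deriv (zeta_term (Suc n)) x) sums g' x) \<and> (g has_field_derivative g' x) (at x)"
  proof (rule series_and_derivative_comparison_complex[OF opS])
    fix n x assume "x \<in> S"
    thus "(zeta_term (Suc n) has_field_derivative deriv (zeta_term (Suc n)) x) (at x)"
      using hol opS holomorphic_derivI by blast
  next
    fix x assume "x \<in> S"
    define B where "B = 2 * (norm x + 2) * (norm x + 1) powr (1/32)"
    have B: "B \<ge> 0" by (auto simp: B_def)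
    show "\<exists>d h. 0 < d \<and> summable h \<and> range h \<subseteq> \<real>\<^sub>\<ge>\<^sub>0 \<and> 
            (\<forall>\<^sub>F n in sequentially. \<forall>y\<in>ball x d \<inter> S. cmod (zeta_term (Suc n) y) \<le> cmod (h n))"
    proof (intro exI[of _ 1] exI[of _ "\<lambda>n. of_real (B * real (Suc n) powr (- (65/64)))"] conjI always_eventually ballI allI)
      show "summable (\<lambda>n. complex_of_real (B * real (Suc n) powr (- (65/64))))"
        by (intro summable_of_real summable_mult summable_zeta_bound)
      show "range (\<lambda>n. complex_of_real (B * real (Suc n) powr (- (65/64)))) \<subseteq> \<real>\<^sub>\<ge>\<^sub>0"
        using B by (auto simp: complex_nonneg_Reals_iff)
      fix n y assume y: "y \<in> ball x 1 \<inter> S"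
      have "norm y \<le> norm x + norm (y - x)" by (rule norm_triangle_sub)
      hence ny: "norm y \<le> norm x + 1" using y by (simp add: dist_norm norm_minus_commute)
      have "norm (y - 1) \<le> norm y + norm (1::complex)" by (rule norm_triangle_ineq4)
      hence ny1: "norm (y - 1) \<le> norm x + 2" using ny by simp
      have "norm (zeta_term (Suc n) y) \<le> 2 * norm (y - 1) * norm y powr (1/32) * real (Suc n) powr (- (65/64))"
        using y by (intro norm_zeta_term_le) (auto simp: S_def)
      also have "\<dots> \<le> B * real (Suc n) powr (- (65/64))"
        unfolding B_def using ny ny1 by (intro mult_right_mono mult_mono powr_mono2) auto
      finally show "cmod (zeta_term (Suc n) y) \<le> cmod (complex_of_real (B * real (Suc n) powr (- (65/64))))"
        unfolding norm_of_real by (rule order.trans[OF _ abs_ge_self])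
    qed auto
  qed
  then obtain g g' where g: "\<And>x. x \<in> S \<Longrightarrow> (\<lambda>n. zeta_term (Suc n) x) sums g x"
     "\<And>x. x \<in> S \<Longrightarrow> (g has_field_derivative g' x) (at x)" by blast
  have "(\<lambda>s. 1 + g s) holomorphic_on S"
    using g(2) opS by (intro holomorphic_intros) (auto simp: holomorphic_on_open)
  moreover have "1 + g s = reg_zeta s" if "s \<in> S" for s
    using g(1)[OF that] by (simp add: reg_zeta_def sums_iff)
  ultimately have "reg_zeta holomorphic_on S" by (rule holomorphic_transform)
  thus ?thesis by (simp add: S_def)
qed

lemma reg_zeta_1: "reg_zeta 1 = 1"
proof -
  have "complex_of_nat (Suc n) \<noteq> 0" for n by (rule of_nat_neq_0)
  hence "zeta_term (Suc n) 1 = 0" for n unfolding zeta_term_def by (simp del: of_nat_Suc)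
  thus ?thesis by (simp add: reg_zeta_def)
qed

lemma norm_reg_zeta_le:
  obtains C where "C > 0" "\<And>s. Re s > 63/64 \<Longrightarrow> Re s \<le> 3 \<Longrightarrow> norm (reg_zeta s) \<le> C * (1 + \<bar>Im s\<bar>) powr (33/32)"
proof -
  define S where "S = (\<Sum>n. real (Suc n) powr (- (65/64)))"
  have S: "S \<ge> 0" unfolding S_def by (intro suminf_nonneg summable_zeta_bound) auto
  have "norm (reg_zeta s) \<le> (1 + 12 * S) * (1 + \<bar>Im s\<bar>) powr (33/32)" if s: "Re s > 63/64" "Re s \<le> 3" for s
  proof -
    define \<tau> where "\<tau> = 1 + \<bar>Im s\<bar>"
    have \<tau>: "\<tau> \<ge> 1" by (simp add: \<tau>_def)
    have 1: "norm s \<le> 3 * \<tau>" using s cmod_le[of s] by (auto simp: \<tau>_def)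
    have 2: "norm (s - 1) \<le> 2 * \<tau>" using s cmod_le[of "s - 1"] by (auto simp: \<tau>_def)
    have 3: "norm s powr (1/32) \<le> 3 * \<tau> powr (1/32)"
    proof -
      have "norm s powr (1/32) \<le> (3 * \<tau>) powr (1/32)" using 1 by (intro powr_mono2) auto
      also have "\<dots> = 3 powr (1/32) * \<tau> powr (1/32)" using \<tau> by (simp add: powr_mult)
      also have "\<dots> \<le> 3 powr 1 * \<tau> powr (1/32)" by (intro mult_right_mono powr_mono) auto
      finally show ?thesis by simp
    qed
    have "norm (\<Sum>n. zeta_term (Suc n) s) \<le> (\<Sum>n. norm (zeta_term (Suc n) s))"
      by (rule summable_norm) (use summable_norm_zeta_term s in auto)
    also have "\<dots> \<le> (\<Sum>n. (2 * norm (s - 1) * norm s powr (1/32)) * real (Suc n) powr (- (65/64)))"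
      by (intro suminf_le summable_mult summable_zeta_bound summable_norm_zeta_term s norm_zeta_term_le) auto
    also have "\<dots> = (2 * norm (s - 1) * norm s powr (1/32)) * S"
      unfolding S_def by (intro suminf_mult summable_zeta_bound)
    also have "\<dots> \<le> (2 * (2 * \<tau>) * (3 * \<tau> powr (1/32))) * S"
      using 2 3 S \<tau> by (intro mult_right_mono mult_mono) auto
    also have "\<dots> = 12 * S * \<tau> powr (1 + 1/32)"
      using \<tau> by (subst powr_add) simp
    finally have "norm (\<Sum>n. zeta_term (Suc n) s) \<le> 12 * S * \<tau> powr (33/32)" by simp
    moreover have "\<tau> powr (33/32) \<ge> 1" using \<tau> by (intro ge_one_powr_ge_zero) auto
    moreover have "norm (reg_zeta s) \<le> 1 + norm (\<Sum>n. zeta_term (Suc n) s)"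
      unfolding reg_zeta_def using norm_triangle_ineq by (metis norm_one)
    ultimately show ?thesis by (simp add: \<tau>_def algebra_simps)
  qed
  thus ?thesis using S by (intro that[of "1 + 12 * S"]) auto
qed

text \<open>Cauchy's inequality on circles of radius 1/128, which stay to the right of 63/64. Three
  derivatives are bounded because \<open>deriv reg_zeta\<close> will be differentiated
  twice.\<close>

lemma norm_deriv_reg_zeta_le:
  obtains C where "C > 0" 
    "\<And>s j. 1 \<le> Re s \<Longrightarrow> Re s \<le> 2 \<Longrightarrow> j \<le> 3 \<Longrightarrow> norm ((deriv ^^ j) reg_zeta s) \<le> C * (1 + \<bar>Im s\<bar>) powr (33/32)"
proof -
  obtain C where C: "C > 0" "\<And>s. Re s > 63/64 \<Longrightarrow> Re s \<le> 3 \<Longrightarrow> norm (reg_zeta s) \<le> C * (1 + \<bar>Im s\<bar>) powr (33/32)"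
    using norm_reg_zeta_le by blast
  \<comment> \<open>The factors 6 (that is \<open>fact 3\<close>) and \<open>128 ^ 3\<close> come
    from Cauchy's inequality with \<open>j \<le> 3\<close>; the factor 4 pays for replacing the
    height of a point on the circle by that of the centre.\<close>
  have "norm ((deriv ^^ j) reg_zeta s) \<le> (6 * C * 4 * 128 ^ 3) * (1 + \<bar>Im s\<bar>) powr (33/32)"
    if s: "1 \<le> Re s" "Re s \<le> 2" "j \<le> 3" for s j
  proof -
    have sub: "cball s (1/128) \<subseteq> {s. Re s > 63/64}"
    proof
      fix z assume "z \<in> cball s (1/128)"
      hence "norm (s - z) \<le> 1/128" by (simp add: dist_norm)
      hence "\<bar>Re (s - z)\<bar> \<le> 1/128" using abs_Re_le_cmod[of "s - z"] by linarith
      hence "Re s - Re z \<le> 1/128" unfolding minus_complex.simps by linarith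
      thus "z \<in> {s. Re s > 63/64}" using s by simp
    qed
    have "norm ((deriv ^^ j) reg_zeta s) \<le> fact j * (C * (4 * (1 + \<bar>Im s\<bar>) powr (33/32))) / (1/128) ^ j"
    proof (rule Cauchy_inequality)
      show "reg_zeta holomorphic_on ball s (1/128)"
        by (rule holomorphic_on_subset[OF holomorphic_reg_zeta]) (use sub ball_subset_cball in blast)
      show "continuous_on (cball s (1/128)) reg_zeta"
        by (rule continuous_on_subset[OF holomorphic_on_imp_continuous_on[OF holomorphic_reg_zeta] sub])
      fix z assume z: "norm (s - z) = 1/128"
      have 1: "\<bar>Re (s - z)\<bar> \<le> 1/128" "\<bar>Im (s - z)\<bar> \<le> 1/128" 
        using z abs_Re_le_cmod[of "s - z"] abs_Im_le_cmod[of "s - z"] by auto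
      have 2: "Re z > 63/64" "Re z \<le> 3" "\<bar>Im z\<bar> \<le> \<bar>Im s\<bar> + 1" 
        using 1 s unfolding minus_complex.simps by linarith+
      have "norm (reg_zeta z) \<le> C * (1 + \<bar>Im z\<bar>) powr (33/32)" using 2 by (intro C(2)) auto
      also have "\<dots> \<le> C * (4 * (1 + \<bar>Im s\<bar>) powr (33/32))"
      proof -
        have "(1 + \<bar>Im z\<bar>) powr (33/32) \<le> (2 * (1 + \<bar>Im s\<bar>)) powr (33/32)"
          using 2 by (intro powr_mono2) auto
        also have "\<dots> = 2 powr (33/32) * (1 + \<bar>Im s\<bar>) powr (33/32)" by (rule powr_mult)
        also have "\<dots> \<le> 2 powr 2 * (1 + \<bar>Im s\<bar>) powr (33/32)" by (intro mult_right_mono powr_mono) auto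
        finally show ?thesis using C(1) by simp
      qed
      finally show "norm (reg_zeta z) \<le> C * (4 * (1 + \<bar>Im s\<bar>) powr (33/32))" .
    qed auto
    also have "\<dots> = fact j * 128 ^ j * (C * (4 * (1 + \<bar>Im s\<bar>) powr (33/32)))"
      by (simp add: power_divide)
    also have "\<dots> \<le> fact 3 * 128 ^ 3 * (C * (4 * (1 + \<bar>Im s\<bar>) powr (33/32)))"
      using s C(1) by (intro mult_right_mono mult_mono fact_mono power_increasing) auto
    also have "\<dots> = (6 * C * 4 * 128 ^ 3) * (1 + \<bar>Im s\<bar>) powr (33/32)"
      by (simp add: fact_numeral)
    finally show ?thesis .
  qed
  thus ?thesis using C(1) by (intro that[of "6 * C * 4 * 128 ^ 3"]) auto
qed

section \<open>Dirichlet series\<close>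

text \<open>Starting the sum at 0 is harmless because \<open>0 powr z = 0\<close>.\<close>

definition dirichlet :: "(nat \<Rightarrow> real) \<Rightarrow> complex \<Rightarrow> complex" where
  "dirichlet a s = (\<Sum>n. of_real (a n) * of_nat n powr (-s))"

text \<open>One growth condition for all four coefficient sequences in use: the constant 1, the
  logarithm, \<open>vonM\<close> and \<open>vonM_ln\<close>. It gives absolute convergence for
  \<open>Re s > 1\<close>.\<close>

definition log_bounded :: "(nat \<Rightarrow> real) \<Rightarrow> bool" where
  "log_bounded a \<longleftrightarrow> (\<forall>n. \<bar>a n\<bar> \<le> 1 + ln (real n))"

lemma norm_dirichlet_term: "norm (of_real (a n) * of_nat n powr (-s)) = \<bar>a n\<bar> * real n powr (- Re s)"
  unfolding norm_mult norm_of_real by (subst norm_powr_real_powr) auto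

lemma summable_log_bounded:
  assumes "log_bounded a" "\<sigma> > 1"
  shows "summable (\<lambda>n. \<bar>a n\<bar> * real n powr (- \<sigma>))"
proof (rule summable_comparison_test')
  \<comment> \<open>The midpoint of 1 and \<open>\<sigma>\<close> is still a summable exponent, and
    the remaining power of \<open>n\<close> absorbs the logarithm.\<close>
  have "(\<lambda>n. (1 + ln (real n)) * real n powr (- \<sigma>)) \<in> O(\<lambda>n. real n powr (- ((1 + \<sigma>) / 2)))"
    using assms(2) by real_asymp
  moreover have "summable (\<lambda>n. norm (real n powr (- ((1 + \<sigma>) / 2))))"
    using assms(2) by (simp add: summable_real_powr_iff)
  ultimately show "summable (\<lambda>n. (1 + ln (real n)) * real n powr (- \<sigma>))"
    by (rule summable_comparison_test_bigo[rotated])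
  fix n :: nat
  show "norm (\<bar>a n\<bar> * real n powr (- \<sigma>)) \<le> (1 + ln (real n)) * real n powr (- \<sigma>)"
    using assms by (auto simp: log_bounded_def abs_mult intro!: mult_right_mono)
qed

lemma summable_norm_dirichlet:
  assumes "log_bounded a" "Re s > 1"
  shows "summable (\<lambda>n. norm (of_real (a n) * of_nat n powr (-s)))"
  using summable_log_bounded[OF assms] by (simp only: norm_dirichlet_term)

lemma dirichlet_sums:
  assumes "log_bounded a" "Re s > 1"
  shows "(\<lambda>n. of_real (a n) * of_nat n powr (-s)) sums dirichlet a s"
  unfolding dirichlet_def using summable_norm_cancel[OF summable_norm_dirichlet[OF assms]]
  by (rule summable_sums)

lemma dirichlet_has_field_derivative:
  assumes a: "log_bounded a" and s: "Re s > 1"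
  shows "(dirichlet a has_field_derivative - dirichlet (\<lambda>n. a n * ln (real n)) s) (at s)"
proof -
  define S where "S = {s. Re s > 1}"
  have opS: "open S" unfolding S_def by (rule open_halfspace_Re_gt)
  define f where "f = (\<lambda>n (s::complex). complex_of_real (a n) * of_nat n powr (-s))"
  define f' where "f' = (\<lambda>n (s::complex). - (of_real (a n * ln (real n)) * of_nat n powr (-s)))"
  have "\<exists>g g'. \<forall>x \<in> S. ((\<lambda>n. f n x) sums g x) \<and> ((\<lambda>n. f' n x) sums g' x) \<and> 
          (g has_field_derivative g' x) (at x)"
  proof (rule series_and_derivative_comparison_complex[OF opS])
    fix n x assume "x \<in> S"
    show "(f n has_field_derivative f' n x) (at x)"
    proof (cases "n = 0")
      case False
      have "((\<lambda>x. of_nat n powr (-x)) has_field_derivative (Ln (of_nat n) * of_nat n powr (-x) * (-1))) (at x)"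
        by (rule DERIV_chain2[OF has_field_derivative_powr_right])
           (use False in \<open>auto intro!: derivative_eq_intros\<close>)
      from DERIV_cmult[OF this, of "of_real (a n)"] show ?thesis
        unfolding f_def f'_def using False by (simp add: Ln_of_nat algebra_simps)
    qed (simp add: f_def f'_def)
  next
    fix x assume "x \<in> S"
    \<comment> \<open>Half the distance to the line of real part 1, so that real parts on the ball
      are at least \<open>1 + d\<close>.\<close>
    define d where "d = (Re x - 1) / 2"
    have d: "d > 0" using \<open>x \<in> S\<close> by (simp add: d_def S_def)
    show "\<exists>d h. 0 < d \<and> summable h \<and> range h \<subseteq> \<real>\<^sub>\<ge>\<^sub>0 \<and> 
            (\<forall>\<^sub>F n in sequentially. \<forall>y\<in>ball x d \<inter> S. cmod (f n y) \<le> cmod (h n))"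
    proof (intro exI[of _ d] exI[of _ "\<lambda>n. of_real (\<bar>a n\<bar> * real n powr (- (1 + d)))"] conjI eventually_sequentiallyI[of 1] ballI allI)
      show "summable (\<lambda>n. complex_of_real (\<bar>a n\<bar> * real n powr (- (1 + d))))"
        using d by (intro summable_of_real summable_log_bounded a) auto
      show "range (\<lambda>n. complex_of_real (\<bar>a n\<bar> * real n powr (- (1 + d)))) \<subseteq> \<real>\<^sub>\<ge>\<^sub>0"
        by (auto simp: complex_nonneg_Reals_iff)
      fix n :: nat and y assume n: "n \<ge> 1" and y: "y \<in> ball x d \<inter> S"
      have "Re x - Re y \<le> d" using y abs_Re_le_cmod[of "x - y"] unfolding minus_complex.simps dist_norm by (simp add: abs_le_iff dist_norm)
      hence re: "Re y \<ge> 1 + d" by (simp add: d_def field_simps)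
      have "norm (f n y) = \<bar>a n\<bar> * real n powr (- Re y)"
        unfolding f_def by (rule norm_dirichlet_term)
      also have "\<dots> \<le> \<bar>a n\<bar> * real n powr (- (1 + d))"
        using n re by (intro mult_left_mono powr_mono) auto
      finally show "cmod (f n y) \<le> cmod (complex_of_real (\<bar>a n\<bar> * real n powr (- (1 + d))))"
        unfolding norm_of_real by (rule order.trans[OF _ abs_ge_self])
    qed (use d in auto)
  qed
  then obtain g g' where g: "\<And>x. x \<in> S \<Longrightarrow> (\<lambda>n. f n x) sums g x" "\<And>x. x \<in> S \<Longrightarrow> (\<lambda>n. f' n x) sums g' x"
     "\<And>x. x \<in> S \<Longrightarrow> (g has_field_derivative g' x) (at x)" by blast
  have sS: "s \<in> S" using s by (simp add: S_def)
  have eq: "g x = dirichlet a x" if "x \<in> S" for x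
    using g(1)[OF that] by (simp add: dirichlet_def f_def sums_iff)
  have "(\<lambda>n. - f' n s) sums (- g' s)" using g(2)[OF sS] by (rule sums_minus)
  hence "g' s = - dirichlet (\<lambda>n. a n * ln (real n)) s"
    unfolding f'_def minus_minus by (simp add: dirichlet_def sums_iff)
  hence "(g has_field_derivative - dirichlet (\<lambda>n. a n * ln (real n)) s) (at s)"
    using g(3)[OF sS] by simp
  thus ?thesis
    by (rule has_field_derivative_transform_within_open[OF _ opS sS]) (use eq in auto)
qed

lemma ln_of_nat_ge_0: "ln (real n) \<ge> 0"
  by (cases "n = 0") auto

lemma log_boundedI:
  assumes "\<And>n. n > 0 \<Longrightarrow> \<bar>a n\<bar> \<le> 1 + ln (real n)" "a 0 = 0"
  shows "log_bounded a"
  unfolding log_bounded_def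
proof
  fix n
  show "\<bar>a n\<bar> \<le> 1 + ln (real n)"
    by (cases "n = 0") (use assms in auto)
qed

section \<open>The von Mangoldt function, the logarithm of zeta and the 3-4-1 inequality\<close>

abbreviation vonM :: "nat \<Rightarrow> real" where "vonM \<equiv> mangoldt"

text \<open>The coefficients of the logarithm of zeta. At \<open>n = 1\<close> the quotient is
  \<open>0 / 0 = 0\<close>.\<close>

definition vonM_ln :: "nat \<Rightarrow> real" where "vonM_ln n = vonM n / ln (real n)"

lemma vonM_ln_mult_ln: "vonM_ln n * ln (real n) = vonM n"
proof (cases "n \<le> 1")
  case True
  hence "n = 0 \<or> n = 1" by auto
  thus ?thesis by (auto simp: vonM_ln_def)
qed (auto simp: vonM_ln_def)

lemma vonM_ln_nonneg: "vonM_ln n \<ge> 0"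
  unfolding vonM_ln_def by (intro divide_nonneg_nonneg mangoldt_nonneg ln_of_nat_ge_0)

lemma log_bounded_one: "log_bounded (\<lambda>_. 1)"
  unfolding log_bounded_def using ln_of_nat_ge_0 by simp

lemma log_bounded_ln: "log_bounded (\<lambda>n. ln (real n))"
  by (rule log_boundedI) (use ln_of_nat_ge_0 in auto)

lemma log_bounded_vonM: "log_bounded vonM"
proof (rule log_boundedI)
  fix n :: nat assume "n > 0"
  thus "\<bar>vonM n\<bar> \<le> 1 + ln (real n)" using mangoldt_le[of n] by simp
qed auto

lemma log_bounded_vonM_ln: "log_bounded vonM_ln"
proof (rule log_boundedI)
  fix n :: nat assume n: "n > 0"
  have "vonM_ln n \<le> 1"
  proof (cases "n = 1")
    case False
    hence "ln (real n) > 0" using n by simp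
    thus ?thesis using mangoldt_le[of n] n by (simp add: vonM_ln_def)
  qed (auto simp: vonM_ln_def)
  thus "\<bar>vonM_ln n\<bar> \<le> 1 + ln (real n)" using vonM_ln_nonneg[of n] ln_of_nat_ge_0[of n] by simp
qed (auto simp: vonM_ln_def)

abbreviation czeta :: "complex \<Rightarrow> complex" where "czeta \<equiv> dirichlet (\<lambda>_. 1)"

text \<open>Dirichlet convolution: the absolutely convergent double sum is regrouped by the product
  of the two indices, and \<open>mangoldt\<close> summed over the divisors of \<open>n\<close> is
  \<open>ln n\<close>.\<close>

lemma czeta_mult_dirichlet_vonM:
  assumes s: "Re s > 1"
  shows "dirichlet vonM s * czeta s = dirichlet (\<lambda>n. ln (real n)) s"
proof -
  define f where "f = (\<lambda>n. complex_of_real 1 * of_nat n powr (-s))"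
  define g where "g = (\<lambda>n. complex_of_real (vonM n) * of_nat n powr (-s))"
  have nf: "summable (\<lambda>n. norm (f n))" and ng: "summable (\<lambda>n. norm (g n))"
    unfolding f_def g_def 
    by (rule summable_norm_dirichlet[OF log_bounded_one s] summable_norm_dirichlet[OF log_bounded_vonM s])+
  have f: "(f has_sum czeta s) UNIV" 
    by (rule norm_summable_imp_has_sum[OF nf]) (use dirichlet_sums[OF log_bounded_one s] in \<open>simp add: f_def\<close>)
  have g: "(g has_sum dirichlet vonM s) UNIV"
    by (rule norm_summable_imp_has_sum[OF ng]) (use dirichlet_sums[OF log_bounded_vonM s] in \<open>simp add: g_def\<close>)
  have abs: "(\<lambda>(m,n). g m * f n) summable_on (UNIV \<times> UNIV)"
  proof -
    have ng': "(\<lambda>x. norm (g x)) summable_on UNIV" and nf': "(\<lambda>x. norm (f x)) summable_on UNIV"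
      using nf ng by (auto intro: norm_summable_imp_summable_on)
    have "(\<lambda>z. norm (case z of (m,n) \<Rightarrow> g m * f n)) summable_on (UNIV \<times> UNIV)"
      unfolding Infinite_Sum.abs_summable_on_Sigma_iff
      by (simp add: norm_mult infsum_cmult_right' abs_mult summable_on_cmult_left summable_on_cmult_right ng' nf')
    thus ?thesis by (rule Infinite_Sum.abs_summable_summable)
  qed
  have prod: "((\<lambda>(m,n). g m * f n) has_sum (dirichlet vonM s * czeta s)) (UNIV \<times> UNIV)"
    by (rule has_sum_SigmaI[where g = "\<lambda>m. g m * czeta s"])
       (use abs f g in \<open>auto intro!: has_sum_cmult_right has_sum_cmult_left\<close>)
  \<comment> \<open>Terms with an index 0 vanish; they are removed because the regrouping is a
    bijection only for positive indices, the pair \<open>(m, n)\<close> corresponding to the product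
    \<open>m * n\<close> with its divisor \<open>m\<close>.\<close>
  define N :: "nat set" where "N = {0<..}"
  have "((\<lambda>(m,n). g m * f n) has_sum (dirichlet vonM s * czeta s)) (N \<times> N)"
    using prod by (rule has_sum_cong_neutral[THEN iffD1, rotated -1]) (auto simp: N_def f_def g_def)
  also have "?this \<longleftrightarrow> ((\<lambda>(n,d). g d * f (n div d)) has_sum (dirichlet vonM s * czeta s)) (SIGMA n:N. {d. d dvd n})"
    by (rule has_sum_reindex_bij_witness[of _ "\<lambda>(n,d). (d, n div d)" "\<lambda>(m,n). (m * n, m)"])
       (auto simp: N_def)
  finally have "((\<lambda>n. of_real (ln (real n)) * of_nat n powr (-s)) has_sum (dirichlet vonM s * czeta s)) N"
  proof (rule has_sum_SigmaD)
    fix n assume n: "n \<in> N"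
    have fin: "finite {d. d dvd n}" using n by (intro finite_divisors_nat) (auto simp: N_def)
    have "(\<Sum>d | d dvd n. g d * f (n div d)) = (\<Sum>d | d dvd n. of_real (vonM d) * of_nat n powr (-s))"
    proof (intro sum.cong refl)
      fix d assume "d \<in> {d. d dvd n}"
      then obtain e where e: "n = d * e" by (auto elim: dvdE)
      hence de: "d > 0" "e > 0" using n by (auto simp: N_def)
      have "of_nat n powr (-s) = of_nat d powr (-s) * of_nat e powr (-s)"
        unfolding e of_nat_mult by (subst powr_times_real) auto
      thus "g d * f (n div d) = of_real (vonM d) * of_nat n powr (-s)"
        using de e by (simp add: f_def g_def)
    qed
    also have "\<dots> = of_real (\<Sum>d | d dvd n. vonM d) * of_nat n powr (-s)"
      by (simp only: of_real_sum sum_distrib_right)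
    also have "(\<Sum>d | d dvd n. vonM d) = ln (real n)"
      using n by (subst mangoldt_sum) (auto simp: N_def)
    finally show "((\<lambda>d. case (n, d) of (n, d) \<Rightarrow> g d * f (n div d)) has_sum of_real (ln (real n)) * of_nat n powr (-s)) {d. d dvd n}"
      using has_sum_finite[OF fin, of "\<lambda>d. g d * f (n div d)"] by simp
  qed
  hence "((\<lambda>n. of_real (ln (real n)) * of_nat n powr (-s)) has_sum (dirichlet vonM s * czeta s)) UNIV"
    by (rule has_sum_cong_neutral[THEN iffD1, rotated -1]) (auto simp: N_def)
  from has_sum_imp_sums[OF this] dirichlet_sums[OF log_bounded_ln s] show ?thesis
    using sums_unique2 by blast
qed

text \<open>The representation of \<open>czeta\<close> as an exponential, and with it the
  non-vanishing for \<open>Re s > 1\<close>, rests on this differential equation.\<close>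

lemma czeta_has_field_derivative:
  assumes "Re s > 1"
  shows "(czeta has_field_derivative - (dirichlet vonM s * czeta s)) (at s)"
  using dirichlet_has_field_derivative[OF log_bounded_one assms] czeta_mult_dirichlet_vonM[OF assms] by simp

lemma czeta_real_ge_1:
  assumes "\<sigma> > 1"
  shows "Re (czeta (of_real \<sigma>)) \<ge> 1"
proof -
  have "(\<lambda>n. Re (of_real 1 * of_nat n powr (- of_real \<sigma>))) sums Re (czeta (of_real \<sigma>))"
    by (intro sums_Re dirichlet_sums log_bounded_one) (use assms in auto)
  moreover have "Re (of_real 1 * of_nat n powr (- of_real \<sigma>)) = real n powr (- \<sigma>)" for n
    using powr_of_real[of "real n" "-\<sigma>"] by (simp del: powr_of_real)
  ultimately have s: "(\<lambda>n. real n powr (- \<sigma>)) sums Re (czeta (of_real \<sigma>))" by simp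
  have "(\<Sum>n\<in>{1}. real n powr (- \<sigma>)) \<le> Re (czeta (of_real \<sigma>))"
    using s sum_le_suminf[of "\<lambda>n. real n powr (- \<sigma>)" "{1}"] by (simp add: sums_iff)
  thus ?thesis by simp
qed

text \<open>Both sides have the same logarithmic derivative; the value of the constant is irrelevant later.\<close>

lemma czeta_eq_exp:
  obtains c where "c \<noteq> 0" "\<And>s. Re s > 1 \<Longrightarrow> czeta s = c * exp (dirichlet vonM_ln s)"
proof -
  define S where "S = {s. Re s > 1}"
  have "\<exists>c. \<forall>s\<in>S. czeta s * exp (- dirichlet vonM_ln s) = c"
  proof (rule has_field_derivative_zero_constant)
    show "convex S" unfolding S_def by (rule convex_halfspace_Re_gt)
    fix s assume "s \<in> S"
    hence s: "Re s > 1" by (simp add: S_def)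
    have d: "(dirichlet vonM_ln has_field_derivative - dirichlet vonM s) (at s)"
      using dirichlet_has_field_derivative[OF log_bounded_vonM_ln s] by (simp only: vonM_ln_mult_ln)
    have "((\<lambda>s. czeta s * exp (- dirichlet vonM_ln s)) has_field_derivative 0) (at s)"
      by (rule derivative_eq_intros czeta_has_field_derivative[OF s] d refl | simp)+
    thus "((\<lambda>s. czeta s * exp (- dirichlet vonM_ln s)) has_field_derivative 0) (at s within S)"
      by (rule has_field_derivative_at_within)
  qed
  then obtain c where c: "\<And>s. s \<in> S \<Longrightarrow> czeta s * exp (- dirichlet vonM_ln s) = c" by blast
  have "czeta s = c * exp (dirichlet vonM_ln s)" if "Re s > 1" for s
    using c[of s] that by (auto simp: S_def exp_minus field_simps)
  moreover have "c \<noteq> 0" using calculation[of "of_real 2"] czeta_real_ge_1[of 2] by auto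
  ultimately show ?thesis by (intro that)
qed

lemma czeta_nonzero: "Re s > 1 \<Longrightarrow> czeta s \<noteq> 0"
  by (rule czeta_eq_exp) auto

text \<open>By the exponential representation, the product is \<open>norm c ^ 8\<close> times the
  exponential of a series with terms \<open>vonM_ln n * real n powr (- \<sigma>)\<close> times 3 + 4
  cos u + cos 2u, where u = t ln n. That factor equals 2 (1 + cos u)^2, and the exponent 8 is 3 + 4
  + 1.\<close>

lemma czeta_341:
  obtains c where "c > 0" 
    "\<And>\<sigma> t. \<sigma> > 1 \<Longrightarrow> norm (czeta (of_real \<sigma>)) ^ 3 * norm (czeta (Complex \<sigma> t)) ^ 4 * norm (czeta (Complex \<sigma> (2 * t))) \<ge> c"
proof -
  obtain c where c: "c \<noteq> 0" "\<And>s. Re s > 1 \<Longrightarrow> czeta s = c * exp (dirichlet vonM_ln s)"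
    using czeta_eq_exp by blast
  have "norm (czeta (of_real \<sigma>)) ^ 3 * norm (czeta (Complex \<sigma> t)) ^ 4 * norm (czeta (Complex \<sigma> (2 * t))) \<ge> norm c ^ 8"
    if \<sigma>: "\<sigma> > 1" for \<sigma> t
  proof -
    let ?Q = "\<lambda>t. Re (dirichlet vonM_ln (Complex \<sigma> t))"
    have Q: "(\<lambda>n. vonM_ln n * real n powr (- \<sigma>) * cos (t * ln (real n))) sums ?Q t" for t
    proof -
      have "(\<lambda>n. Re (of_real (vonM_ln n) * of_nat n powr (- Complex \<sigma> t))) sums ?Q t"
        by (intro sums_Re dirichlet_sums log_bounded_vonM_ln) (use \<sigma> in auto)
      moreover have "Re (of_real (vonM_ln n) * of_nat n powr (- Complex \<sigma> t)) = 
              vonM_ln n * real n powr (- \<sigma>) * cos (t * ln (real n))" for n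
        by (cases "n = 0") (simp_all add: powr_def Ln_of_nat Re_exp Im_exp mult.commute)
      ultimately show ?thesis by (simp only:)
    qed
    have S: "(\<lambda>n. 3 * (vonM_ln n * real n powr (- \<sigma>) * cos (0 * ln (real n))) + 
               4 * (vonM_ln n * real n powr (- \<sigma>) * cos (t * ln (real n))) +
               vonM_ln n * real n powr (- \<sigma>) * cos (2 * t * ln (real n))) sums
               (3 * ?Q 0 + 4 * ?Q t + ?Q (2 * t))"
      by (intro sums_add sums_mult Q)
    have NN: "3 * (vonM_ln n * real n powr (- \<sigma>) * cos (0 * ln (real n))) + 
               4 * (vonM_ln n * real n powr (- \<sigma>) * cos (t * ln (real n))) +
               vonM_ln n * real n powr (- \<sigma>) * cos (2 * t * ln (real n)) \<ge> 0" for n :: nat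
    proof -
      have gen: "3 * (k * 1) + 4 * (k * c) + k * (2 * c ^ 2 - 1) = k * (2 * (1 + c) ^ 2)" for k c :: real
        by (simp add: power2_eq_square algebra_simps)
      have c2: "cos (2 * t * ln (real n)) = 2 * cos (t * ln (real n)) ^ 2 - 1"
        using cos_double_cos[of "t * ln (real n)"] by (simp add: mult.assoc)
      have "3 * (vonM_ln n * real n powr (- \<sigma>) * cos (0 * ln (real n))) + 
               4 * (vonM_ln n * real n powr (- \<sigma>) * cos (t * ln (real n))) +
               vonM_ln n * real n powr (- \<sigma>) * cos (2 * t * ln (real n)) = 
             vonM_ln n * real n powr (- \<sigma>) * (2 * (1 + cos (t * ln (real n))) ^ 2)"
        by (simp only: mult_zero_left cos_zero c2 gen)
      also have "\<dots> \<ge> 0" by (intro mult_nonneg_nonneg vonM_ln_nonneg) auto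
      finally show ?thesis .
    qed
    have nonneg: "3 * ?Q 0 + 4 * ?Q t + ?Q (2 * t) \<ge> 0"
      by (rule sums_le[OF NN sums_zero S])
    have n: "norm (czeta (Complex \<sigma> t)) = norm c * exp (?Q t)" for t
      using c(2)[of "Complex \<sigma> t"] \<sigma> by (simp add: norm_mult)
    have "norm (czeta (of_real \<sigma>)) ^ 3 * norm (czeta (Complex \<sigma> t)) ^ 4 * norm (czeta (Complex \<sigma> (2 * t)))
          = norm c ^ 8 * exp (3 * ?Q 0 + 4 * ?Q t + ?Q (2 * t))"
      unfolding complex_of_real_def n by (simp add: exp_add exp_of_nat_mult[symmetric] power_mult_distrib algebra_simps exp_double flip: power_Suc power_add exp_of_nat_mult)
    also have "\<dots> \<ge> norm c ^ 8 * 1"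
      using nonneg by (intro mult_left_mono) auto
    finally show ?thesis by simp
  qed
  thus ?thesis using c(1) by (intro that[of "norm c ^ 8"]) auto
qed

text \<open>To the right of the line of real part 1 the two parts of the zeta terms converge
  separately. The powers with exponent \<open>1 - s\<close> telescope to -1, which cancels the
  leading 1.\<close>

lemma reg_zeta_eq:
  assumes s: "Re s > 1"
  shows "reg_zeta s = (s - 1) * czeta s"
proof -
  have z: "(\<lambda>n. of_nat (Suc n) powr (-s)) sums czeta s"
    using dirichlet_sums[OF log_bounded_one s] sums_Suc_iff[of "\<lambda>n. of_nat n powr (-s)" "czeta s"] by simp
  have "(\<lambda>n. of_nat (Suc n) powr (1 - s)) \<longlonglongrightarrow> 0"
  proof (rule Lim_null_comparison)
    show "\<forall>\<^sub>F n in sequentially. norm (of_nat (Suc n) powr (1 - s)) \<le> real (Suc n) powr (1 - Re s)"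
      by (intro always_eventually allI) (subst norm_powr_real_powr, auto)
    show "(\<lambda>n. real (Suc n) powr (1 - Re s)) \<longlonglongrightarrow> 0" using s by real_asymp
  qed
  hence "(\<lambda>n. of_nat (Suc (Suc n)) powr (1 - s) - of_nat (Suc n) powr (1 - s)) sums (0 - of_nat (Suc 0) powr (1 - s))"
    by (rule telescope_sums)
  hence "(\<lambda>n. (s - 1) * of_nat (Suc n) powr (-s) + 
           (of_nat (Suc (Suc n)) powr (1 - s) - of_nat (Suc n) powr (1 - s))) sums ((s - 1) * czeta s + (0 - of_nat (Suc 0) powr (1 - s)))"
    by (intro sums_add sums_mult z)
  also have "(\<lambda>n. (s - 1) * of_nat (Suc n) powr (-s) + 
           (of_nat (Suc (Suc n)) powr (1 - s) - of_nat (Suc n) powr (1 - s))) = (\<lambda>n. zeta_term (Suc n) s)"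
    unfolding zeta_term_def by (intro ext) simp
  finally have "(\<lambda>n. zeta_term (Suc n) s) sums ((s - 1) * czeta s - 1)" by simp
  thus ?thesis unfolding reg_zeta_def by (simp add: sums_iff)
qed

text \<open>The logarithmic derivative of the product \<open>(s - 1) * czeta s\<close>: the pole of
  zeta is isolated in an explicit term.\<close>

lemma dirichlet_vonM_eq:
  assumes s: "Re s > 1"
  shows "reg_zeta s \<noteq> 0" "dirichlet vonM s = 1 / (s - 1) - deriv reg_zeta s / reg_zeta s"
proof -
  have s1: "s \<noteq> 1" using s by auto
  have aux: "(c - u * D * c) / (u * c) = 1 / u - D" if "u \<noteq> 0" "c \<noteq> 0" for u c D :: complex
    using that by (simp add: field_simps)
  show nz: "reg_zeta s \<noteq> 0" using czeta_nonzero[OF s] s1 by (simp add: reg_zeta_eq[OF s])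
  have "((\<lambda>s. (s - 1) * czeta s) has_field_derivative (czeta s + (s - 1) * (- (dirichlet vonM s * czeta s)))) (at s)"
    by (rule derivative_eq_intros czeta_has_field_derivative[OF s] refl | simp)+
  moreover have "s \<in> {s. Re s > 1}" using s by simp
  ultimately have "(reg_zeta has_field_derivative (czeta s + (s - 1) * (- (dirichlet vonM s * czeta s)))) (at s)"
    by (rule has_field_derivative_transform_within_open[OF _ open_halfspace_Re_gt]) (simp add: reg_zeta_eq)
  hence "deriv reg_zeta s = czeta s - (s - 1) * dirichlet vonM s * czeta s"
    by (simp add: DERIV_imp_deriv mult.assoc)
  thus "dirichlet vonM s = 1 / (s - 1) - deriv reg_zeta s / reg_zeta s"
    using aux[of "s - 1" "czeta s"] s1 czeta_nonzero[OF s] unfolding reg_zeta_eq[OF s] by simp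
qed

section \<open>A lower bound for the zeta function near the line of real part one\<close>

text \<open>Near the real axis the 3-4-1 inequality gives no uniform bound, because
  \<open>czeta\<close> at \<open>Complex \<sigma> (2 * t)\<close> is unbounded there. Compactness
  does instead: on the left edge the value 1 at the point 1 and continuity exclude zeros, and inside
  \<open>czeta\<close> has none.\<close>

lemma reg_zeta_nonzero_box:
  obtains r m where "0 < r" "r \<le> 1" "m > 0" 
    "\<And>s. 1 \<le> Re s \<Longrightarrow> Re s \<le> 2 \<Longrightarrow> \<bar>Im s\<bar> \<le> r \<Longrightarrow> norm (reg_zeta s) \<ge> m"
proof -
  define S where "S = {s. Re s > (63/64)}"
  have cont: "continuous_on S reg_zeta"
    unfolding S_def using holomorphic_reg_zeta by (rule holomorphic_on_imp_continuous_on)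
  have opS: "open S" unfolding S_def by (rule open_halfspace_Re_gt)
  have "isCont reg_zeta 1" using cont opS continuous_on_eq_continuous_at[of S reg_zeta] by (auto simp: S_def)
  then obtain d where d: "d > 0" "\<And>s. dist s 1 < d \<Longrightarrow> dist (reg_zeta s) 1 < 1"
    unfolding continuous_at_eps_delta reg_zeta_1 by (metis zero_less_one)
  define r where "r = min 1 (d / 2)"
  have r: "0 < r" "r \<le> 1" "r < d" using d by (auto simp: r_def)
  define B where "B = cbox (Complex 1 (-r)) (Complex 2 r)"
  have B: "s \<in> B \<longleftrightarrow> 1 \<le> Re s \<and> Re s \<le> 2 \<and> \<bar>Im s\<bar> \<le> r" for s
    by (auto simp: B_def in_cbox_complex_iff)
  have nz: "reg_zeta s \<noteq> 0" if "s \<in> B" for s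
  proof (cases "Re s > 1")
    case True thus ?thesis by (rule dirichlet_vonM_eq)
  next
    case False
    hence "Re s = 1" using that B by force
    hence "norm (s - 1) = \<bar>Im s\<bar>" by (simp add: cmod_def)
    hence "dist s 1 < d" using that B r by (simp add: dist_norm)
    from d(2)[OF this] show ?thesis by (auto simp: dist_norm)
  qed
  have "continuous_on B (\<lambda>s. norm (reg_zeta s))"
    by (intro continuous_intros continuous_on_subset[OF cont]) (auto simp: B S_def)
  moreover have "compact B" unfolding B_def by (rule compact_cbox)
  moreover have "B \<noteq> {}" using r B[of 1] by auto
  ultimately obtain s0 where s0: "s0 \<in> B" "\<And>s. s \<in> B \<Longrightarrow> norm (reg_zeta s0) \<le> norm (reg_zeta s)"
    using continuous_attains_inf[of B "\<lambda>s. norm (reg_zeta s)"] by blast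
  show ?thesis
    using r nz[OF s0(1)] s0(2) B by (intro that[of r "norm (reg_zeta s0)"]) auto
qed

text \<open>In the 3-4-1 inequality \<open>czeta\<close> is at most a multiple of 1 /
  (\<open>\<sigma>\<close> - 1) at \<open>\<sigma>\<close> and of (1 + \<bar>t\<bar>)^(1/32) at
  height \<open>2 * t\<close>. Fourth roots give the exponents 3/4 and -1/128, and the factor
  \<open>s - 1\<close> turns the latter into 127/128. The condition
  \<open>\<bar>t\<bar> \<ge> r\<close> allows division by \<open>s - 1\<close> at both
  heights.\<close>

lemma norm_reg_zeta_ge_aux:
  assumes r: "0 < r" "r \<le> 1"
  obtains a where "a > 0" 
    "\<And>\<sigma> t. 1 < \<sigma> \<Longrightarrow> \<sigma> \<le> 2 \<Longrightarrow> \<bar>t\<bar> \<ge> r \<Longrightarrow> 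
        norm (reg_zeta (Complex \<sigma> t)) \<ge> a * (\<sigma> - 1) powr (3/4) * (1 + \<bar>t\<bar>) powr (127/128)"
proof -
  obtain C where C: "C > 0" "\<And>s j. 1 \<le> Re s \<Longrightarrow> Re s \<le> 2 \<Longrightarrow> j \<le> 3 \<Longrightarrow> 
      norm ((deriv ^^ j) reg_zeta s) \<le> C * (1 + \<bar>Im s\<bar>) powr (33/32)"
    using norm_deriv_reg_zeta_le by blast
  obtain c where c: "c > 0" 
    "\<And>\<sigma> t. \<sigma> > 1 \<Longrightarrow> norm (czeta (of_real \<sigma>)) ^ 3 * norm (czeta (Complex \<sigma> t)) ^ 4 * norm (czeta (Complex \<sigma> (2 * t))) \<ge> c"
    using czeta_341 by blast
  define c2 where "c2 = c * (r / 2) ^ 4 * r / (4 * C ^ 4)"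
  have C4: "C ^ 4 = C * C ^ 3" by (simp add: power4_eq_xxxx power3_eq_cube)
  have c2: "c2 > 0" using c(1) C(1) r by (simp add: c2_def)
  have "norm (reg_zeta (Complex \<sigma> t)) \<ge> c2 powr (1/4) * (\<sigma> - 1) powr (3/4) * (1 + \<bar>t\<bar>) powr (127/128)"
    if \<sigma>: "1 < \<sigma>" "\<sigma> \<le> 2" and t: "\<bar>t\<bar> \<ge> r" for \<sigma> t
  proof -
    define \<tau> where "\<tau> = 1 + \<bar>t\<bar>"
    have \<tau>: "\<tau> \<ge> 1" by (simp add: \<tau>_def)
    define z where "z = norm (reg_zeta (Complex \<sigma> t))"
    have "norm (reg_zeta (of_real \<sigma>)) \<le> C" using C(2)[of "of_real \<sigma>" 0] \<sigma> by simp
    then have z1: "norm (czeta (of_real \<sigma>)) \<le> C / (\<sigma> - 1)"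
    proof -
      assume "norm (reg_zeta (of_real \<sigma>)) \<le> C"
      moreover have "norm (reg_zeta (of_real \<sigma>)) = norm (complex_of_real (\<sigma> - 1)) * norm (czeta (of_real \<sigma>))"
        using \<sigma> reg_zeta_eq[of "of_real \<sigma>"] by (simp add: norm_mult)
      hence "norm (reg_zeta (of_real \<sigma>)) = (\<sigma> - 1) * norm (czeta (of_real \<sigma>))"
        using \<sigma> by (simp only: norm_of_real)
      ultimately show ?thesis using \<sigma> by (simp add: field_simps)
    qed
    have z2: "norm (czeta (Complex \<sigma> (2 * t))) \<le> 4 * C / r * \<tau> powr (1/32)"
    proof -
      have 1: "norm (Complex \<sigma> (2 * t) - 1) \<ge> 2 * \<bar>t\<bar>"
        using abs_Im_le_cmod[of "Complex \<sigma> (2 * t) - 1"] by (simp add: abs_mult)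
      have "r * \<bar>t\<bar> \<le> 1 * \<bar>t\<bar>" using r by (intro mult_right_mono) auto
      hence 2: "2 * \<bar>t\<bar> \<ge> r / 2 * (1 + 2 * \<bar>t\<bar>)" using t r by (simp add: algebra_simps)
      have "r / 2 * (1 + 2 * \<bar>t\<bar>) * norm (czeta (Complex \<sigma> (2 * t))) \<le> 
              norm (Complex \<sigma> (2 * t) - 1) * norm (czeta (Complex \<sigma> (2 * t)))"
        using 1 2 by (intro mult_right_mono) auto
      also have "\<dots> = norm (reg_zeta (Complex \<sigma> (2 * t)))"
        using \<sigma> by (subst reg_zeta_eq) (auto simp: norm_mult)
      also have "\<dots> \<le> C * (1 + \<bar>2 * t\<bar>) powr (33/32)"
        using C(2)[of "Complex \<sigma> (2 * t)" 0] \<sigma> by simp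
      also have "\<dots> = C * (1 + 2 * \<bar>t\<bar>) powr (1 + 1/32)" by (simp add: abs_mult)
      also have "\<dots> = (1 + 2 * \<bar>t\<bar>) * (C * (1 + 2 * \<bar>t\<bar>) powr (1/32))" by (subst powr_add) simp
      finally have "(1 + 2 * \<bar>t\<bar>) * (r / 2 * norm (czeta (Complex \<sigma> (2 * t)))) \<le> (1 + 2 * \<bar>t\<bar>) * (C * (1 + 2 * \<bar>t\<bar>) powr (1/32))"
        by (simp only: mult_ac)
      moreover have "1 + 2 * \<bar>t\<bar> > 0" by simp
      ultimately have "r / 2 * norm (czeta (Complex \<sigma> (2 * t))) \<le> C * (1 + 2 * \<bar>t\<bar>) powr (1/32)"
        by (simp only: mult_le_cancel_left_pos)
      also have "\<dots> \<le> C * (2 * \<tau> powr (1/32))"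
      proof (intro mult_left_mono)
        have "(1 + 2 * \<bar>t\<bar>) powr (1/32) \<le> (2 * \<tau>) powr (1/32)" by (intro powr_mono2) (auto simp: \<tau>_def)
        also have "\<dots> = 2 powr (1/32) * \<tau> powr (1/32)" by (rule powr_mult)
        also have "\<dots> \<le> 2 powr 1 * \<tau> powr (1/32)" by (intro mult_right_mono powr_mono) auto
        finally show "(1 + 2 * \<bar>t\<bar>) powr (1/32) \<le> 2 * \<tau> powr (1/32)" by simp
      qed (use C in auto)
      finally show ?thesis using r by (simp add: field_simps)
    qed
    have z3: "r / 2 * \<tau> * norm (czeta (Complex \<sigma> t)) \<le> z"
    proof -
      have 1: "norm (Complex \<sigma> t - 1) \<ge> \<bar>t\<bar>"
        using abs_Im_le_cmod[of "Complex \<sigma> t - 1"] by simp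
      have "r * \<bar>t\<bar> \<le> 1 * \<bar>t\<bar>" using r by (intro mult_right_mono) auto
      hence 2: "\<bar>t\<bar> \<ge> r / 2 * \<tau>" using t r by (simp add: algebra_simps \<tau>_def)
      have "r / 2 * \<tau> * norm (czeta (Complex \<sigma> t)) \<le> 
              norm (Complex \<sigma> t - 1) * norm (czeta (Complex \<sigma> t))"
        using 1 2 by (intro mult_right_mono) auto
      also have "\<dots> = z"
        unfolding z_def using \<sigma> by (subst reg_zeta_eq) (auto simp: norm_mult)
      finally show ?thesis .
    qed
    have "c \<le> norm (czeta (of_real \<sigma>)) ^ 3 * norm (czeta (Complex \<sigma> t)) ^ 4 * norm (czeta (Complex \<sigma> (2 * t)))"
      using c(2) \<sigma> by blast
    also have "\<dots> \<le> (C / (\<sigma> - 1)) ^ 3 * norm (czeta (Complex \<sigma> t)) ^ 4 * (4 * C / r * \<tau> powr (1/32))"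
      using z1 z2 by (intro mult_mono power_mono) (use C \<sigma> in auto)
    \<comment> \<open>Multiplying by this fourth power converts \<open>czeta\<close> at height
      \<open>t\<close> into \<open>z\<close>, by \<open>z3\<close>.\<close>
    finally have "c * (r / 2 * \<tau>) ^ 4 \<le> 
        ((C / (\<sigma> - 1)) ^ 3 * norm (czeta (Complex \<sigma> t)) ^ 4 * (4 * C / r * \<tau> powr (1/32))) * (r / 2 * \<tau>) ^ 4"
      by (intro mult_right_mono) auto
    also have "\<dots> = (C / (\<sigma> - 1)) ^ 3 * (4 * C / r * \<tau> powr (1/32)) * (r / 2 * \<tau> * norm (czeta (Complex \<sigma> t))) ^ 4"
      by (simp only: power_mult_distrib mult_ac)
    also have "\<dots> \<le> (C / (\<sigma> - 1)) ^ 3 * (4 * C / r * \<tau> powr (1/32)) * z ^ 4"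
      using z3 by (intro mult_left_mono power_mono) (use r \<tau> \<sigma> C in auto)
    finally have "c2 * ((\<sigma> - 1) ^ 3 * (\<tau> ^ 4 * \<tau> powr (- (1/32)))) \<le> z ^ 4"
      using \<sigma> r C(1) \<tau> unfolding c2_def C4 by (simp add: field_simps powr_minus power_divide power_mult_distrib)
    also have "(\<sigma> - 1) ^ 3 = (\<sigma> - 1) powr 3" using \<sigma> by simp
    also have "\<tau> ^ 4 * \<tau> powr (- (1/32)) = \<tau> powr (4 + - (1/32))" using \<tau> by (subst powr_add) simp
    finally have "(c2 * ((\<sigma> - 1) powr 3 * \<tau> powr (4 + - (1/32)))) powr (1/4) \<le> (z ^ 4) powr (1/4)"
      using c2 by (intro powr_mono2) auto
    also have "(z ^ 4) powr (1/4) = z" 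
    proof (cases "z = 0")
      case False
      hence "z > 0" by (simp add: z_def)
      thus ?thesis by (simp add: powr_powr flip: powr_numeral)
    qed auto
    also have "(c2 * ((\<sigma> - 1) powr 3 * \<tau> powr (4 + - (1/32)))) powr (1/4) = c2 powr (1/4) * (\<sigma> - 1) powr (3/4) * \<tau> powr (127/128)"
      unfolding powr_mult powr_powr by simp
    finally show ?thesis by (simp add: z_def \<tau>_def)
  qed
  thus ?thesis using c2 by (intro that[of "c2 powr (1/4)"]) auto
qed

text \<open>
  The bound of the previous lemma is used at real part at least $1 + \eta$ with
  $\eta$ a multiple of $(1 + |t|)^{-5/32}$; further left the mean value theorem applies. This choice
  balances both: $-5/32 \cdot 3/4 + 127/128 = 33/32 - 5/32 = 7/8$.
\<close>

lemma norm_reg_zeta_ge: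
  obtains c where "c > 0" "\<And>s. 1 < Re s \<Longrightarrow> Re s \<le> 2 \<Longrightarrow> norm (reg_zeta s) \<ge> c * (1 + \<bar>Im s\<bar>) powr (7/8)"
proof -
  obtain r m where r: "0 < r" "r \<le> 1" and m: "m > 0" 
    "\<And>s. 1 \<le> Re s \<Longrightarrow> Re s \<le> 2 \<Longrightarrow> \<bar>Im s\<bar> \<le> r \<Longrightarrow> norm (reg_zeta s) \<ge> m"
    using reg_zeta_nonzero_box by blast
  obtain a where a: "a > 0" 
    "\<And>\<sigma> t. 1 < \<sigma> \<Longrightarrow> \<sigma> \<le> 2 \<Longrightarrow> \<bar>t\<bar> \<ge> r \<Longrightarrow> 
        norm (reg_zeta (Complex \<sigma> t)) \<ge> a * (\<sigma> - 1) powr (3/4) * (1 + \<bar>t\<bar>) powr (127/128)"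
    using norm_reg_zeta_ge_aux[OF r] by blast
  obtain C where C: "C > 0" "\<And>s j. 1 \<le> Re s \<Longrightarrow> Re s \<le> 2 \<Longrightarrow> j \<le> 3 \<Longrightarrow> 
      norm ((deriv ^^ j) reg_zeta s) \<le> C * (1 + \<bar>Im s\<bar>) powr (33/32)"
    using norm_deriv_reg_zeta_le by blast
  \<comment> \<open>Chosen so that the loss \<open>C * \<rho>\<close> in the mean value step is at
    most half of the main term \<open>a * \<rho> powr (3/4)\<close>.\<close>
  define \<rho> where "\<rho> = min 1 ((a / (2 * C)) powr 4)"
  have \<rho>: "\<rho> > 0" "\<rho> \<le> 1" using a C by (auto simp: \<rho>_def)
  have C\<rho>: "C * \<rho> \<le> a / 2 * \<rho> powr (3/4)"
  proof -
    have "\<rho> powr (1/4) \<le> ((a / (2 * C)) powr 4) powr (1/4)"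
      using \<rho> by (intro powr_mono2) (auto simp: \<rho>_def)
    also have "\<dots> = a / (2 * C)" using a C by (simp add: powr_powr del: powr_numeral)
    finally have 1: "C * \<rho> powr (1/4) \<le> a / 2" using C by (simp add: field_simps)
    have "C * \<rho> = C * (\<rho> powr (1/4 + 3/4))" using \<rho> by simp
    also have "\<dots> = (C * \<rho> powr (1/4)) * \<rho> powr (3/4)" by (subst powr_add) simp
    also have "\<dots> \<le> a / 2 * \<rho> powr (3/4)" by (intro mult_right_mono 1) auto
    finally show ?thesis .
  qed
  \<comment> \<open>In the box \<open>1 + \<bar>Im s\<bar>\<close> is at most 2, which
    \<open>m / 2\<close> compensates; in \<open>a / 2\<close> half of the main term has been given
    up to the mean value step.\<close>
  define c where "c = min (m / 2) (a / 2 * \<rho> powr (3/4))"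
  have c: "c > 0" using m a \<rho> by (auto simp: c_def)
  have "norm (reg_zeta s) \<ge> c * (1 + \<bar>Im s\<bar>) powr (7/8)" if s: "1 < Re s" "Re s \<le> 2" for s
  proof -
    define \<tau> where "\<tau> = 1 + \<bar>Im s\<bar>"
    have \<tau>: "\<tau> \<ge> 1" by (simp add: \<tau>_def)
    show ?thesis
    proof (cases "\<bar>Im s\<bar> \<le> r")
      case True
      have "c * \<tau> powr (7/8) \<le> m / 2 * 2 powr (7/8)"
        using m True r by (intro mult_mono powr_mono2) (auto simp: c_def \<tau>_def)
      also have "\<dots> \<le> m / 2 * 2 powr 1" using m by (intro mult_left_mono powr_mono) auto
      also have "\<dots> \<le> norm (reg_zeta s)" using m(2)[of s] s True by simp
      finally show ?thesis by (simp add: \<tau>_def)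
    next
      case False
      define \<eta> where "\<eta> = \<rho> * \<tau> powr (-5/32)"
      have \<eta>0: "\<eta> > 0" using \<rho> \<tau> by (simp add: \<eta>_def)
      have "\<eta> \<le> 1 * 1" unfolding \<eta>_def using \<rho> \<tau> powr_mono[of "-5/32" 0 \<tau>]
        by (intro mult_mono) auto
      hence \<eta>1: "\<eta> \<le> 1" by simp
      have big: "norm (reg_zeta (Complex \<sigma> (Im s))) \<ge> a * \<rho> powr (3/4) * \<tau> powr (7/8)"
        if \<sigma>: "1 + \<eta> \<le> \<sigma>" "\<sigma> \<le> 2" for \<sigma>
      proof -
        have "a * \<rho> powr (3/4) * \<tau> powr (7/8) = a * \<rho> powr (3/4) * \<tau> powr (-15/128 + 127/128)"
          by simp
        also have "\<dots> = a * \<eta> powr (3/4) * \<tau> powr (127/128)"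
          unfolding \<eta>_def powr_mult powr_powr powr_add by simp
        also have "\<dots> \<le> a * (\<sigma> - 1) powr (3/4) * \<tau> powr (127/128)"
          using a \<sigma> \<eta>0 by (intro mult_right_mono mult_left_mono powr_mono2) auto
        also have "\<dots> \<le> norm (reg_zeta (Complex \<sigma> (Im s)))"
          using a(2)[of \<sigma> "Im s"] False \<sigma> \<eta>0 by (simp add: \<tau>_def)
        finally show ?thesis .
      qed
      have le: "c * \<tau> powr (7/8) \<le> a / 2 * \<rho> powr (3/4) * \<tau> powr (7/8)"
        by (intro mult_right_mono) (auto simp: c_def)
      show ?thesis
      proof (cases "1 + \<eta> \<le> Re s")
        case True
        have "c * \<tau> powr (7/8) \<le> a / 2 * \<rho> powr (3/4) * \<tau> powr (7/8)" by (rule le)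
        also have "\<dots> \<le> a * \<rho> powr (3/4) * \<tau> powr (7/8)" using a by (intro mult_right_mono) auto
        also have "\<dots> \<le> norm (reg_zeta s)" using big[OF True s(2)] by simp
        finally show ?thesis by (simp add: \<tau>_def)
      next
        case False
        \<comment> \<open>\<open>s\<close> is moved to the right at constant height, up to the real
          part where \<open>big\<close> applies.\<close>
        define s' where "s' = Complex (1 + \<eta>) (Im s)"
        have "norm (reg_zeta s' - reg_zeta s) \<le> C * \<tau> powr (33/32) * norm (s' - s)"
        proof (rule field_differentiable_bound[of "closed_segment s s'"])
          fix z assume z: "z \<in> closed_segment s s'"
          hence "Im z = Im s" "Re z \<in> closed_segment (Re s) (Re s')" 
            by (auto simp: closed_segment_same_Im s'_def)
          hence z': "Im z = Im s" "1 < Re z" "Re z \<le> 2" using s False \<eta>1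
            by (auto simp: closed_segment_eq_real_ivl s'_def)
          have "(reg_zeta has_field_derivative deriv reg_zeta z) (at z)"
            by (rule holomorphic_derivI[OF holomorphic_reg_zeta open_halfspace_Re_gt]) (use z' in auto)
          thus "(reg_zeta has_field_derivative deriv reg_zeta z) (at z within closed_segment s s')"
            by (rule has_field_derivative_at_within)
          show "norm (deriv reg_zeta z) \<le> C * \<tau> powr (33/32)"
            using C(2)[of z 1] z' by (simp add: \<tau>_def)
        qed auto
        also have "norm (s' - s) \<le> \<eta>"
        proof -
          have "s' - s = of_real (1 + \<eta> - Re s)" by (simp add: s'_def complex_eq_iff)
          thus ?thesis using False s by (simp only: norm_of_real)
        qed
        hence "C * \<tau> powr (33/32) * norm (s' - s) \<le> C * \<tau> powr (33/32) * \<eta>"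
          using C by (intro mult_left_mono) auto
        also have "\<dots> = (C * \<rho>) * \<tau> powr (33/32 + (-5/32))"
          unfolding \<eta>_def by (subst powr_add) simp
        also have "\<dots> \<le> (a / 2 * \<rho> powr (3/4)) * \<tau> powr (7/8)"
          using mult_right_mono[OF C\<rho>, of "\<tau> powr (7/8)"] by simp
        finally have "norm (reg_zeta s' - reg_zeta s) \<le> (a / 2 * \<rho> powr (3/4)) * \<tau> powr (7/8)" .
        moreover have "norm (reg_zeta s') \<ge> a * \<rho> powr (3/4) * \<tau> powr (7/8)"
          unfolding s'_def by (rule big) (use \<eta>1 in auto)
        moreover have "norm (reg_zeta s') \<le> norm (reg_zeta s' - reg_zeta s) + norm (reg_zeta s)"
          by (metis diff_add_cancel norm_triangle_ineq)
        ultimately show ?thesis using le by (simp add: \<tau>_def)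
      qed
    qed
  qed
  thus ?thesis using c by (intro that)
qed

section \<open>The remainder in Perron's formula\<close>

text \<open>Two derivatives are carried along because the integration by parts is done twice. One
  common exponent for all three functions makes the notion stable under products, and the constant
  does not depend on the distance to the line of real part 1.\<close>

definition controlled_by :: 
    "real \<Rightarrow> (complex \<Rightarrow> complex) \<Rightarrow> (complex \<Rightarrow> complex) \<Rightarrow> (complex \<Rightarrow> complex) \<Rightarrow> real \<Rightarrow> bool" where
  "controlled_by e f fa fb C \<longleftrightarrow> C \<ge> 0 \<and> (\<forall>s. Re s > 1 \<longrightarrow> 
      (f has_field_derivative fa s) (at s) \<and> (fa has_field_derivative fb s) (at s) \<and>
      (Re s \<le> 2 \<longrightarrow> norm (f s) \<le> C * (1 + \<bar>Im s\<bar>) powr e \<and> norm (fa s) \<le> C * (1 + \<bar>Im s\<bar>) powr e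
           \<and> norm (fb s) \<le> C * (1 + \<bar>Im s\<bar>) powr e))"

definition controlled :: "real \<Rightarrow> (complex \<Rightarrow> complex) \<Rightarrow> bool" where
  "controlled e f \<longleftrightarrow> (\<exists>fa fb C. controlled_by e f fa fb C)"

lemma controlledI:
  assumes "C \<ge> 0" "\<And>s. Re s > 1 \<Longrightarrow> (f has_field_derivative fa s) (at s)"
    "\<And>s. Re s > 1 \<Longrightarrow> (fa has_field_derivative fb s) (at s)"
    "\<And>s. Re s > 1 \<Longrightarrow> Re s \<le> 2 \<Longrightarrow> norm (f s) \<le> C * (1 + \<bar>Im s\<bar>) powr e"
    "\<And>s. Re s > 1 \<Longrightarrow> Re s \<le> 2 \<Longrightarrow> norm (fa s) \<le> C * (1 + \<bar>Im s\<bar>) powr e"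
    "\<And>s. Re s > 1 \<Longrightarrow> Re s \<le> 2 \<Longrightarrow> norm (fb s) \<le> C * (1 + \<bar>Im s\<bar>) powr e"
  shows "controlled e f"
proof -
  have "controlled_by e f fa fb C" unfolding controlled_by_def using assms by simp
  thus ?thesis unfolding controlled_def by blast
qed

lemma controlled_byD:
  assumes "controlled_by e f fa fb C"
  shows "C \<ge> 0" "\<And>s. Re s > 1 \<Longrightarrow> (f has_field_derivative fa s) (at s)"
    "\<And>s. Re s > 1 \<Longrightarrow> (fa has_field_derivative fb s) (at s)"
    "\<And>s. Re s > 1 \<Longrightarrow> Re s \<le> 2 \<Longrightarrow> norm (f s) \<le> C * (1 + \<bar>Im s\<bar>) powr e"
    "\<And>s. Re s > 1 \<Longrightarrow> Re s \<le> 2 \<Longrightarrow> norm (fa s) \<le> C * (1 + \<bar>Im s\<bar>) powr e"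
    "\<And>s. Re s > 1 \<Longrightarrow> Re s \<le> 2 \<Longrightarrow> norm (fb s) \<le> C * (1 + \<bar>Im s\<bar>) powr e"
  using assms unfolding controlled_by_def by simp_all

lemma controlled_mono:
  assumes "controlled e f" "e \<le> e'"
  shows "controlled e' f"
proof -
  obtain f1 f2 C where wf: "controlled_by e f f1 f2 C"
    using assms(1) unfolding controlled_def by blast
  note f = controlled_byD[OF wf]
  have le: "C * (1 + \<bar>Im s\<bar>) powr e \<le> C * (1 + \<bar>Im s\<bar>) powr e'" for s
    using f(1) assms(2) by (intro mult_left_mono powr_mono) auto
  show ?thesis
    by (rule controlledI[OF f(1-3)]) (blast intro: order.trans[OF f(4) le] order.trans[OF f(5) le] order.trans[OF f(6) le])+
qed

lemma controlled_mult:
  assumes "controlled e f" "controlled e' g"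
  shows "controlled (e + e') (\<lambda>s. f s * g s)"
proof -
  obtain f1 f2 C where wf: "controlled_by e f f1 f2 C"
    using assms(1) unfolding controlled_def by blast
  note f = controlled_byD[OF wf]
  obtain g1 g2 D where wg: "controlled_by e' g g1 g2 D"
    using assms(2) unfolding controlled_def by blast
  note g = controlled_byD[OF wg]
  have p: "norm (a * b) \<le> C * D * (1 + \<bar>Im s\<bar>) powr (e + e')" 
    if "norm a \<le> C * (1 + \<bar>Im s\<bar>) powr e" "norm b \<le> D * (1 + \<bar>Im s\<bar>) powr e'" for a b s :: complex
  proof -
    have "norm (a * b) \<le> (C * (1 + \<bar>Im s\<bar>) powr e) * (D * (1 + \<bar>Im s\<bar>) powr e')"
      unfolding norm_mult by (intro mult_mono that) (use f(1) in auto)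
    also have "\<dots> = C * D * (1 + \<bar>Im s\<bar>) powr (e + e')" unfolding powr_add by (simp only: mult_ac)
    finally show ?thesis .
  qed
  have nn: "0 \<le> C * D * (1 + \<bar>Im s\<bar>) powr (e + e')" for s using f(1) g(1) by auto
  show ?thesis
  \<comment> \<open>The second derivative of a product has four summands, counted with
    multiplicity.\<close>
  proof (rule controlledI[where C = "4 * (C * D)" and fa = "\<lambda>s. f1 s * g s + f s * g1 s" 
          and fb = "\<lambda>s. (f2 s * g s + f1 s * g1 s) + (f1 s * g1 s + f s * g2 s)"])
    show "0 \<le> 4 * (C * D)" using f(1) g(1) by auto
    fix s :: complex assume s: "Re s > 1"
    show "((\<lambda>s. f s * g s) has_field_derivative f1 s * g s + f s * g1 s) (at s)"
      using DERIV_mult[OF f(2)[OF s] g(2)[OF s]] by (simp add: algebra_simps)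
    show "((\<lambda>s. f1 s * g s + f s * g1 s) has_field_derivative (f2 s * g s + f1 s * g1 s) + (f1 s * g1 s + f s * g2 s)) (at s)"
      using DERIV_add[OF DERIV_mult[OF f(3)[OF s] g(2)[OF s]] DERIV_mult[OF f(2)[OF s] g(3)[OF s]]]
      by (simp add: algebra_simps)
    assume s': "Re s \<le> 2"
    note fb = f(4-6)[OF s s'] and gb = g(4-6)[OF s s']
    show "norm (f s * g s) \<le> 4 * (C * D) * (1 + \<bar>Im s\<bar>) powr (e + e')"
      using p[OF fb(1) gb(1)] nn[of s] by linarith
    show "norm (f1 s * g s + f s * g1 s) \<le> 4 * (C * D) * (1 + \<bar>Im s\<bar>) powr (e + e')"
      using norm_triangle_mono[OF p[OF fb(2) gb(1)] p[OF fb(1) gb(2)]] nn[of s] by linarith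
    show "norm ((f2 s * g s + f1 s * g1 s) + (f1 s * g1 s + f s * g2 s)) \<le> 4 * (C * D) * (1 + \<bar>Im s\<bar>) powr (e + e')"
      using norm_triangle_mono[OF norm_triangle_mono[OF p[OF fb(3) gb(1)] p[OF fb(2) gb(2)]] 
           norm_triangle_mono[OF p[OF fb(2) gb(2)] p[OF fb(1) gb(3)]]] by linarith
  qed
qed

text \<open>The derivatives decay faster, but one factor with exponent -1 is enough; the others are
  bounded by 2. The constant 16 is that of the second derivative, with its coefficient 2 and three
  factors.\<close>

lemma controlled_inverse_linear:
  assumes b: "b \<ge> 0"
  shows "controlled (-1) (\<lambda>s. 1 / (s + of_real b))"
proof -
  have nz: "s + of_real b \<noteq> 0" if "Re s > 1" for s using that b by (auto simp: complex_eq_iff)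
  have le: "norm (1 / (s + of_real b)) \<le> 2 * (1 + \<bar>Im s\<bar>) powr (-1)" 
           "norm (1 / (s + of_real b)) \<le> 2" if "Re s > 1" for s
  proof -
    have "norm (s + of_real b) \<ge> 1 / 2 * (1 + \<bar>Im s\<bar>)"
      using norm_complex_minus_real_ge[of s "Re s" "-b"] that b by simp
    hence "1 / norm (s + of_real b) \<le> 1 / (1 / 2 * (1 + \<bar>Im s\<bar>))"
      by (intro divide_left_mono mult_pos_pos) (use nz[OF that] in auto)
    also have "\<dots> = 2 * (1 + \<bar>Im s\<bar>) powr (-1)" by (simp add: powr_minus_divide)
    finally show 1: "norm (1 / (s + of_real b)) \<le> 2 * (1 + \<bar>Im s\<bar>) powr (-1)" by (simp add: norm_divide)
    also have "\<dots> \<le> 2 * 1" by (intro mult_left_mono) (auto simp: powr_minus_divide)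
    finally show "norm (1 / (s + of_real b)) \<le> 2" by simp
  qed
  show ?thesis
  proof (rule controlledI[where C = 16 and fa = "\<lambda>s. - ((1 / (s + of_real b)) ^ 2)" and fb = "\<lambda>s. 2 * (1 / (s + of_real b)) ^ 3"])
    fix s :: complex assume s: "Re s > 1"
    show der: "((\<lambda>s. 1 / (s + of_real b)) has_field_derivative - ((1 / (s + of_real b)) ^ 2)) (at s)"
      using nz[OF s] by (auto intro!: derivative_eq_intros simp: power2_eq_square)
    show "((\<lambda>s. - ((1 / (s + of_real b)) ^ 2)) has_field_derivative 2 * (1 / (s + of_real b)) ^ 3) (at s)"
      using DERIV_minus[OF DERIV_power[OF der, of 2]] by (simp add: power2_eq_square power3_eq_cube mult_ac)
    have nn: "(1 + \<bar>Im s\<bar>) powr - 1 \<ge> 0" by simp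
    show "norm (1 / (s + of_real b)) \<le> 16 * (1 + \<bar>Im s\<bar>) powr - 1" using le(1)[OF s] nn by linarith
    have "norm (1 / (s + of_real b)) ^ 2 \<le> 2 * (2 * (1 + \<bar>Im s\<bar>) powr (-1))"
      unfolding power2_eq_square by (intro mult_mono le s) auto
    thus "norm (- ((1 / (s + of_real b)) ^ 2)) \<le> 16 * (1 + \<bar>Im s\<bar>) powr - 1" 
      unfolding norm_minus_cancel norm_power using nn by linarith
    have "norm (1 / (s + of_real b)) ^ 3 \<le> 2 * 2 * (2 * (1 + \<bar>Im s\<bar>) powr (-1))"
      unfolding power3_eq_cube by (intro mult_mono le s) auto
    thus "norm (2 * (1 / (s + of_real b)) ^ 3) \<le> 16 * (1 + \<bar>Im s\<bar>) powr - 1" 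
      unfolding norm_mult norm_power norm_numeral using nn by linarith
  qed auto
qed

lemma reg_zeta_higher_deriv:
  assumes "Re s > 1"
  shows "((deriv ^^ j) reg_zeta has_field_derivative (deriv ^^ Suc j) reg_zeta s) (at s)"
proof -
  have "(deriv ^^ j) reg_zeta holomorphic_on {s. Re s > 63/64}"
    by (rule holomorphic_higher_deriv[OF holomorphic_reg_zeta open_halfspace_Re_gt])
  from holomorphic_derivI[OF this open_halfspace_Re_gt, of s] assms show ?thesis by simp
qed

lemma controlled_deriv_reg_zeta: "controlled (33/32) (deriv reg_zeta)"
proof -
  obtain C where C: "C > 0" "\<And>s j. 1 \<le> Re s \<Longrightarrow> Re s \<le> 2 \<Longrightarrow> j \<le> 3 \<Longrightarrow> 
      norm ((deriv ^^ j) reg_zeta s) \<le> C * (1 + \<bar>Im s\<bar>) powr (33/32)"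
    using norm_deriv_reg_zeta_le by blast
  have "controlled (33/32) ((deriv ^^ 1) reg_zeta)"
  proof (rule controlledI[where C = C and fa = "(deriv ^^ 2) reg_zeta" and fb = "(deriv ^^ 3) reg_zeta"])
    fix s :: complex assume s: "Re s > 1"
    show "((deriv ^^ 1) reg_zeta has_field_derivative (deriv ^^ 2) reg_zeta s) (at s)"
         "((deriv ^^ 2) reg_zeta has_field_derivative (deriv ^^ 3) reg_zeta s) (at s)"
      using reg_zeta_higher_deriv[OF s, of 1] reg_zeta_higher_deriv[OF s, of 2] by (simp_all add: numeral_2_eq_2 numeral_3_eq_3)
    assume s': "Re s \<le> 2"
    show "norm ((deriv ^^ 1) reg_zeta s) \<le> C * (1 + \<bar>Im s\<bar>) powr (33/32)"
         "norm ((deriv ^^ 2) reg_zeta s) \<le> C * (1 + \<bar>Im s\<bar>) powr (33/32)"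
         "norm ((deriv ^^ 3) reg_zeta s) \<le> C * (1 + \<bar>Im s\<bar>) powr (33/32)"
      by (rule C(2); use s s' in simp)+
  qed (use C in auto)
  thus ?thesis by simp
qed

text \<open>The exponent is that of the worst term $Z'^2 / Z^3$ of the second derivative: $2 \cdot 33/32 - 3 \cdot 7/8$.\<close>

lemma controlled_inverse_reg_zeta: "controlled (-18/32) (\<lambda>s. inverse (reg_zeta s))"
proof -
  obtain C where C: "C > 0" "\<And>s j. 1 \<le> Re s \<Longrightarrow> Re s \<le> 2 \<Longrightarrow> j \<le> 3 \<Longrightarrow> 
      norm ((deriv ^^ j) reg_zeta s) \<le> C * (1 + \<bar>Im s\<bar>) powr (33/32)"
    using norm_deriv_reg_zeta_le by blast
  obtain c where c: "c > 0" "\<And>s. 1 < Re s \<Longrightarrow> Re s \<le> 2 \<Longrightarrow> norm (reg_zeta s) \<ge> c * (1 + \<bar>Im s\<bar>) powr (7/8)"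
    using norm_reg_zeta_ge by blast
  define Z Z1 Z2 where "Z = reg_zeta" and "Z1 = (deriv ^^ 1) reg_zeta" and "Z2 = (deriv ^^ 2) reg_zeta"
  have Z: "(Z has_field_derivative Z1 s) (at s)" "(Z1 has_field_derivative Z2 s) (at s)" if "Re s > 1" for s
    using reg_zeta_higher_deriv[OF that, of 0] reg_zeta_higher_deriv[OF that, of 1] 
    by (simp_all add: Z_def Z1_def Z2_def numeral_2_eq_2)
  have nz: "Z s \<noteq> 0" if "Re s > 1" for s using dirichlet_vonM_eq(1)[OF that] by (simp add: Z_def)
  define K where "K = 1 / c + C / c ^ 2 + (C / c ^ 2 + 2 * (C ^ 2 / c ^ 3))"
  show ?thesis unfolding Z_def[symmetric]
  proof (rule controlledI[where C = K and fa = "\<lambda>s. - (Z1 s * inverse (Z s) ^ 2)" 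
           and fb = "\<lambda>s. - (Z2 s * inverse (Z s) ^ 2) + 2 * (Z1 s ^ 2 * inverse (Z s) ^ 3)"])
    show "K \<ge> 0" using C(1) c(1) by (auto simp: K_def)
    fix s :: complex assume s: "Re s > 1"
    show der: "((\<lambda>s. inverse (Z s)) has_field_derivative - (Z1 s * inverse (Z s) ^ 2)) (at s)"
      using DERIV_inverse_fun[OF Z(1)[OF s] nz[OF s]] by (simp add: power2_eq_square mult_ac)
    have "((\<lambda>s. Z1 s * inverse (Z s) ^ 2) has_field_derivative 
            Z2 s * inverse (Z s) ^ 2 + 2 * (- (Z1 s * inverse (Z s) ^ 2)) * inverse (Z s) * Z1 s) (at s)"
      using DERIV_mult[OF Z(2)[OF s] DERIV_power[OF der, of 2]] by (simp add: algebra_simps)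
    from DERIV_minus[OF this]
    show "((\<lambda>s. - (Z1 s * inverse (Z s) ^ 2)) has_field_derivative 
             - (Z2 s * inverse (Z s) ^ 2) + 2 * (Z1 s ^ 2 * inverse (Z s) ^ 3)) (at s)"
      by (simp add: power2_eq_square power3_eq_cube algebra_simps)
    assume s': "Re s \<le> 2"
    define \<tau> where "\<tau> = 1 + \<bar>Im s\<bar>"
    have \<tau>: "\<tau> \<ge> 1" by (simp add: \<tau>_def)
    have "inverse (norm (Z s)) \<le> inverse (c * \<tau> powr (7/8))"
      using c s s' \<tau> by (intro le_imp_inverse_le) (auto simp: Z_def \<tau>_def)
    hence inv: "norm (inverse (Z s)) \<le> 1 / c * \<tau> powr (-7/8)"
      using powr_minus[of \<tau> "7/8"] by (simp add: norm_inverse norm_divide inverse_eq_divide)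
    have d1: "norm (Z1 s) \<le> C * \<tau> powr (33/32)" and d2: "norm (Z2 s) \<le> C * \<tau> powr (33/32)"
      using s s' unfolding Z1_def Z2_def \<tau>_def by - (rule C(2); simp)+
    \<comment> \<open>The exponents that occur are -28/32, -23/32 and -18/32; all are weakened to
      the largest.\<close>
    have pw: "A * \<tau> powr e \<le> A * \<tau> powr (-18/32)" if "e \<le> -18/32" "A \<ge> 0" for A e
      using that \<tau> by (intro mult_left_mono powr_mono) auto
    have B0: "norm (inverse (Z s)) \<le> (1 / c) * \<tau> powr (-18/32)"
      by (rule order.trans[OF inv pw]) (use c(1) in auto)
    have i2: "norm (inverse (Z s)) ^ 2 \<le> (1 / c) ^ 2 * \<tau> powr (-14/8)"
      using \<tau> power_mono[OF inv, of 2] unfolding power_mult_distrib by (simp add: powr_power)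
    have i3: "norm (inverse (Z s)) ^ 3 \<le> (1 / c) ^ 3 * \<tau> powr (-21/8)"
      using \<tau> power_mono[OF inv, of 3] unfolding power_mult_distrib by (simp add: powr_power)
    have B1: "norm (W * inverse (Z s) ^ 2) \<le> C / c ^ 2 * \<tau> powr (-18/32)" if "norm W \<le> C * \<tau> powr (33/32)" for W
    proof -
      have "norm (W * inverse (Z s) ^ 2) \<le> (C * \<tau> powr (33/32)) * ((1 / c) ^ 2 * \<tau> powr (-14/8))"
        unfolding norm_mult norm_power by (intro mult_mono that i2) (use C in auto)
      also have "\<dots> = C / c ^ 2 * \<tau> powr (33/32 + (-14/8))" by (subst powr_add) (simp add: power_divide)
      also have "\<dots> \<le> C / c ^ 2 * \<tau> powr (-18/32)" by (rule pw) (use C in auto)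
      finally show ?thesis .
    qed
    have B2: "norm (Z1 s ^ 2 * inverse (Z s) ^ 3) \<le> C ^ 2 / c ^ 3 * \<tau> powr (-18/32)"
    proof -
      have "norm (Z1 s) ^ 2 \<le> C ^ 2 * \<tau> powr (66/32)"
        using \<tau> power_mono[OF d1, of 2] unfolding power_mult_distrib by (simp add: powr_power)
      hence "norm (Z1 s ^ 2 * inverse (Z s) ^ 3) \<le> (C ^ 2 * \<tau> powr (66/32)) * ((1 / c) ^ 3 * \<tau> powr (-21/8))"
        unfolding norm_mult norm_power by (intro mult_mono i3) auto
      also have "\<dots> = C ^ 2 / c ^ 3 * \<tau> powr (66/32 + (-21/8))" by (subst powr_add) (simp add: power_divide)
      also have "\<dots> \<le> C ^ 2 / c ^ 3 * \<tau> powr (-18/32)" by (rule pw) (use c in auto)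
      finally show ?thesis .
    qed
    have nn: "0 \<le> 1 / c * \<tau> powr (-18/32)" "0 \<le> C / c ^ 2 * \<tau> powr (-18/32)" "0 \<le> C ^ 2 / c ^ 3 * \<tau> powr (-18/32)"
      using c(1) C(1) by auto
    have K: "K * \<tau> powr (-18/32) = 1 / c * \<tau> powr (-18/32) + C / c ^ 2 * \<tau> powr (-18/32) + 
        (C / c ^ 2 * \<tau> powr (-18/32) + 2 * (C ^ 2 / c ^ 3 * \<tau> powr (-18/32)))"
      unfolding K_def by (simp only: distrib_right mult.assoc)
    show "norm (inverse (Z s)) \<le> K * (1 + \<bar>Im s\<bar>) powr (-18/32)"
      unfolding \<tau>_def[symmetric] K using B0 nn by linarith
    show "norm (- (Z1 s * inverse (Z s) ^ 2)) \<le> K * (1 + \<bar>Im s\<bar>) powr (-18/32)"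
      unfolding \<tau>_def[symmetric] K norm_minus_cancel using B1[OF d1] nn by linarith
    have "norm (- (Z2 s * inverse (Z s) ^ 2) + 2 * (Z1 s ^ 2 * inverse (Z s) ^ 3)) \<le> 
            norm (- (Z2 s * inverse (Z s) ^ 2)) + norm (2 * (Z1 s ^ 2 * inverse (Z s) ^ 3))"
      by (rule norm_triangle_ineq)
    also have "norm (2 * (Z1 s ^ 2 * inverse (Z s) ^ 3)) = 2 * norm (Z1 s ^ 2 * inverse (Z s) ^ 3)"
      unfolding norm_mult[of 2] by simp
    finally show "norm (- (Z2 s * inverse (Z s) ^ 2) + 2 * (Z1 s ^ 2 * inverse (Z s) ^ 3)) \<le> K * (1 + \<bar>Im s\<bar>) powr (-18/32)"
      unfolding \<tau>_def[symmetric] K norm_minus_cancel using B1[OF d2] B2 nn by linarith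
  qed
qed

text \<open>The regular part of the Perron integrand without its exponential. The sums with
  \<open>of_real 0\<close> and \<open>of_real 1\<close> give both denominators the form required by
  \<open>controlled_inverse_linear\<close>.\<close>

definition Perron_rem :: "complex \<Rightarrow> complex" where
  "Perron_rem s = deriv reg_zeta s * inverse (reg_zeta s) * (1 / (s + of_real 0) * (1 / (s + of_real 1)))"

text \<open>The budget closes: 33/32 - 18/32 - 2 = -49/32, just below -48/32.\<close>

lemma controlled_Perron_rem: "controlled (-3/2) Perron_rem"
proof -
  have "controlled (33/32 + -18/32 + (-1 + -1)) Perron_rem"
    unfolding Perron_rem_def
    by (intro controlled_mult controlled_deriv_reg_zeta controlled_inverse_reg_zeta controlled_inverse_linear) auto
  thus ?thesis by (rule controlled_mono) simp
qed

text \<open>Each integration by parts moves a derivative onto \<open>f\<close> and gains a factor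
  1/y from the exponential. Since \<open>C\<close> precedes the quantifier over
  \<open>\<sigma>\<close>, the line may later be chosen depending on \<open>y\<close>.\<close>

lemma controlled_integral_bound:
  assumes "controlled (-3/2) f"
  shows "\<exists>C. \<forall>\<sigma> y. 1 < \<sigma> \<longrightarrow> \<sigma> \<le> 2 \<longrightarrow> y > 0 \<longrightarrow> 
       integrable lborel (\<lambda>t. f (Complex \<sigma> t) * exp (Complex \<sigma> t * of_real y)) \<and>
       norm (\<integral>t. f (Complex \<sigma> t) * exp (Complex \<sigma> t * of_real y) \<partial>lborel) \<le> C * exp (\<sigma> * y) / y ^ 2"
proof -
  obtain f1 f2 C where wf: "controlled_by (-3/2) f f1 f2 C"
    using assms(1) unfolding controlled_def by blast
  note f = controlled_byD[OF wf]
  define B where "B = (\<lambda>g. \<forall>s. Re s > 1 \<longrightarrow> Re s \<le> 2 \<longrightarrow> norm (g s :: complex) \<le> C * (1 + \<bar>Im s\<bar>) powr (-3/2))"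
  have B: "B f" "B f1" "B f2" unfolding B_def using f(4-6) by blast+
  have d: "\<forall>s. Re s > 1 \<longrightarrow> (f has_field_derivative f1 s) (at s)" "\<forall>s. Re s > 1 \<longrightarrow> (f1 has_field_derivative f2 s) (at s)"
    using f(2,3) by blast+
  define H where "H = {s. Re s > (1::real)}"
  have opH: "open H" unfolding H_def by (rule open_halfspace_Re_gt)
  \<comment> \<open>Only as a derivative is \<open>f2\<close> given; its continuity along the line
    follows because derivatives of holomorphic functions are holomorphic.\<close>
  have "f1 holomorphic_on H" using f(3) opH by (auto simp: holomorphic_on_open H_def)
  hence "deriv f1 holomorphic_on H" using opH by (rule holomorphic_deriv)
  moreover have "deriv f1 s = f2 s" if "s \<in> H" for s using f(3) that by (intro DERIV_imp_deriv) (auto simp: H_def)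
  ultimately have hol2: "f2 holomorphic_on H" by (rule holomorphic_transform)
  have hols: "f holomorphic_on H" "f1 holomorphic_on H" "f2 holomorphic_on H"
    using f(2,3) opH hol2 by (auto simp: holomorphic_on_open H_def)
  define I :: real where "I = (\<integral>t. (1 + \<bar>t\<bar>) powr (-3/2) \<partial>lborel)"
  have basic: "continuous_on UNIV (\<lambda>t. g (Complex \<sigma> t) * exp (Complex \<sigma> t * of_real y))"
     "norm (g (Complex \<sigma> t) * exp (Complex \<sigma> t * of_real y)) \<le> C * exp (\<sigma> * y) * (1 + \<bar>t\<bar>) powr (-3/2)"
     "integrable lborel (\<lambda>t. g (Complex \<sigma> t) * exp (Complex \<sigma> t * of_real y))"
     "norm (\<integral>t. g (Complex \<sigma> t) * exp (Complex \<sigma> t * of_real y) \<partial>lborel) \<le> C * exp (\<sigma> * y) * I"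
     if g: "g holomorphic_on H" "B g"
     and \<sigma>: "1 < \<sigma>" "\<sigma> \<le> 2" for g \<sigma> y t
  proof -
    have [continuous_intros]: "continuous_on UNIV (Complex \<sigma>)" unfolding Complex_eq by (intro continuous_intros)
    have "continuous_on UNIV (g \<circ> Complex \<sigma>)"
      by (rule continuous_on_compose, intro continuous_intros, rule continuous_on_subset[OF holomorphic_on_imp_continuous_on[OF g(1)]])
         (use \<sigma> in \<open>auto simp: H_def\<close>)
    hence [continuous_intros]: "continuous_on UNIV (\<lambda>t. g (Complex \<sigma> t))" by (simp add: o_def)
    show cont: "continuous_on UNIV (\<lambda>t. g (Complex \<sigma> t) * exp (Complex \<sigma> t * of_real y))"
      by (intro continuous_intros)
    have bd: "norm (g (Complex \<sigma> t) * exp (Complex \<sigma> t * of_real y)) \<le> C * exp (\<sigma> * y) * (1 + \<bar>t\<bar>) powr (-3/2)" for t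
    proof -
      have "norm (g (Complex \<sigma> t) * exp (Complex \<sigma> t * of_real y)) = norm (g (Complex \<sigma> t)) * exp (\<sigma> * y)"
        by (simp add: norm_mult)
      also have "\<dots> \<le> C * (1 + \<bar>t\<bar>) powr (-3/2) * exp (\<sigma> * y)"
        using g(2)[unfolded B_def, rule_format, of "Complex \<sigma> t"] \<sigma> by (intro mult_right_mono) auto
      finally show ?thesis by (simp only: mult_ac)
    qed
    thus "norm (g (Complex \<sigma> t) * exp (Complex \<sigma> t * of_real y)) \<le> C * exp (\<sigma> * y) * (1 + \<bar>t\<bar>) powr (-3/2)" .
    show "integrable lborel (\<lambda>t. g (Complex \<sigma> t) * exp (Complex \<sigma> t * of_real y))"
      by (rule integrable_dominated_powr(1)[OF cont bd])
    show "norm (\<integral>t. g (Complex \<sigma> t) * exp (Complex \<sigma> t * of_real y) \<partial>lborel) \<le> C * exp (\<sigma> * y) * I"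
      unfolding I_def by (rule integrable_dominated_powr(2)[OF cont bd])
  qed
  have parts: "(\<integral>t. g (Complex \<sigma> t) * exp (Complex \<sigma> t * of_real y) \<partial>lborel) = 
      - (\<integral>t. g1 (Complex \<sigma> t) * exp (Complex \<sigma> t * of_real y) \<partial>lborel) / of_real y"
     if g: "g holomorphic_on H" "B g"
     and g1: "g1 holomorphic_on H" "B g1"
     and d: "\<forall>s. Re s > 1 \<longrightarrow> (g has_field_derivative g1 s) (at s)"
     and \<sigma>: "1 < \<sigma>" "\<sigma> \<le> 2" and y: "y > 0" for g g1 \<sigma> y
  proof -
    note b = basic[OF g \<sigma>, where y = y] and b1 = basic[OF g1 \<sigma>, where y = y]
    let ?G = "\<lambda>t. g (Complex \<sigma> t) * exp (Complex \<sigma> t * of_real y)"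
    let ?G1 = "\<lambda>t. g1 (Complex \<sigma> t) * exp (Complex \<sigma> t * of_real y)"
    have lims: "(?G \<longlongrightarrow> 0) at_top" "(?G \<longlongrightarrow> 0) at_bot"
    proof -
      show "(?G \<longlongrightarrow> 0) at_top"
        by (rule Lim_null_comparison[OF always_eventually[OF allI[OF b(2)]]]) real_asymp
      show "(?G \<longlongrightarrow> 0) at_bot"
        by (rule Lim_null_comparison[OF always_eventually[OF allI[OF b(2)]]]) real_asymp
    qed
    \<comment> \<open>The integrand is the derivative in \<open>t\<close> of \<open>?G\<close>,
      which tends to 0 in both directions.\<close>
    have "(\<integral>t. \<i> * (?G1 t + of_real y * ?G t) \<partial>lborel) = 0"
    proof (rule integral_derivative_eq_0[OF _ _ _ lims])
      fix t :: real
      have 1: "(Complex \<sigma> has_vector_derivative \<i>) (at t)"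
        unfolding Complex_eq by (auto intro!: derivative_eq_intros)
      have 2: "((\<lambda>s. g s * exp (s * of_real y)) has_field_derivative 
               (g1 (Complex \<sigma> t) * exp (Complex \<sigma> t * of_real y) + g (Complex \<sigma> t) * (exp (Complex \<sigma> t * of_real y) * of_real y))) (at (Complex \<sigma> t))"
        by (rule derivative_eq_intros d[rule_format] refl | use \<sigma> in simp)+
      from field_vector_diff_chain_at[OF 1 2]
      show "(?G has_vector_derivative \<i> * (?G1 t + of_real y * ?G t)) (at t)"
        by (simp add: o_def algebra_simps)
    next
      show "continuous_on UNIV (\<lambda>t. \<i> * (?G1 t + of_real y * ?G t))"
        by (intro continuous_on_mult continuous_on_add continuous_on_const b(1) b1(1))
      show "integrable lborel (\<lambda>t. \<i> * (?G1 t + of_real y * ?G t))"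
        by (intro integrable_mult_right Bochner_Integration.integrable_add b(3) b1(3)) 
    qed
    also have "(\<integral>t. \<i> * (?G1 t + of_real y * ?G t) \<partial>lborel) = \<i> * (integral\<^sup>L lborel ?G1 + of_real y * integral\<^sup>L lborel ?G)"
      using b(3) b1(3) by simp
    finally have "integral\<^sup>L lborel ?G1 + of_real y * integral\<^sup>L lborel ?G = 0" by simp
    thus ?thesis using y by (simp add: field_simps add_eq_0_iff)
  qed
  show ?thesis
  proof (intro exI[of _ "C * I"] allI impI conjI)
    fix \<sigma> y :: real assume \<sigma>: "1 < \<sigma>" "\<sigma> \<le> 2" and y: "y > 0"
    show "integrable lborel (\<lambda>t. f (Complex \<sigma> t) * exp (Complex \<sigma> t * of_real y))"
      by (rule basic(3)[OF hols(1) B(1) \<sigma>])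
    let ?J = "\<lambda>g. \<integral>t. g (Complex \<sigma> t) * exp (Complex \<sigma> t * of_real y) \<partial>lborel"
    have "?J f = ?J f2 / of_real y ^ 2"
      using parts[OF hols(1) B(1) hols(2) B(2) d(1) \<sigma> y] parts[OF hols(2) B(2) hols(3) B(3) d(2) \<sigma> y]
      by (simp add: power2_eq_square)
    hence "norm (?J f) = norm (?J f2) / y ^ 2" using y by (simp add: norm_divide norm_power)
    also have "\<dots> \<le> C * exp (\<sigma> * y) * I / y ^ 2"
      by (intro divide_right_mono basic(4)[OF hols(3) B(3) \<sigma>]) auto
    finally show "norm (?J f) \<le> C * I * exp (\<sigma> * y) / y ^ 2" by (simp only: mult_ac)
  qed
qed

section \<open>The smoothed Chebyshev function\<close>

text \<open>Contains 0 for nonnegative \<open>x\<close>, which does not affect the sums below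
  because \<open>vonM 0 = 0\<close>.\<close>

definition nats_upto :: "real \<Rightarrow> nat set" where "nats_upto x = {n. real n \<le> x}"

lemma finite_nats_upto [simp, intro]: "finite (nats_upto x)"
  by (rule finite_subset[of _ "{..nat \<lfloor>x\<rfloor>}"]) (auto simp: nats_upto_def le_nat_floor)

lemma mem_nats_upto: "n \<in> nats_upto x \<longleftrightarrow> real n \<le> x"
  by (simp add: nats_upto_def)

lemma mem_nats_upto_less_1: "x < 1 \<Longrightarrow> n \<in> nats_upto x \<Longrightarrow> n = 0"
  using of_nat_less_1_iff[of n, where ?'a = real] by (simp add: mem_nats_upto)

definition psi :: "real \<Rightarrow> real" where "psi x = (\<Sum>n\<in>nats_upto x. vonM n)"
text \<open>The integral of \<open>psi\<close> from 0 to \<open>x\<close>, in closed form.\<close>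

definition psi1 :: "real \<Rightarrow> real" where "psi1 x = (\<Sum>n\<in>nats_upto x. vonM n * (x - real n))"

text \<open>Termwise, the Perron integral with poles 0 and -1 at \<open>y = ln x - ln n\<close> is
  \<open>2 * pi * (1 - n / x)\<close> for \<open>n \<le> x\<close> and 0 otherwise. Sum and integral
  may be exchanged because the quadratic kernel makes the integrals of the norms summable.\<close>

lemma Perron_formula:
  assumes x: "x \<ge> 1" and \<sigma>: "1 < \<sigma>" "\<sigma> \<le> 2"
  shows "complex_of_real (2 * pi * psi1 x / x) = 
     (\<integral>t. dirichlet vonM (Complex \<sigma> t) * (exp (Complex \<sigma> t * of_real (ln x)) / (Complex \<sigma> t * (Complex \<sigma> t + 1))) \<partial>lborel)"
proof -
  define f where "f = (\<lambda>n t. complex_of_real (vonM n) * (exp (Complex \<sigma> t * of_real (ln x - ln (real n))) / 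
        ((Complex \<sigma> t - of_real 0) * (Complex \<sigma> t - of_real (-1)))))"
  have val: "(\<integral>t. f n t \<partial>lborel) = of_real (if n \<in> nats_upto x then 2 * pi * vonM n * (1 - real n / x) else 0)" for n
  proof (cases "n = 0")
    case True thus ?thesis by (simp add: f_def)
  next
    case False
    have iff: "ln x - ln (real n) \<ge> 0 \<longleftrightarrow> n \<in> nats_upto x" using x False by (simp add: nats_upto_def)
    have e: "exp (-1 * (ln x - ln (real n))) = real n / x" using x False by (simp add: exp_minus exp_diff field_simps)
    have "(\<integral>t. f n t \<partial>lborel) = complex_of_real (vonM n) * of_real (if ln x - ln (real n) \<ge> 0 then 
            2 * pi * (exp (0 * (ln x - ln (real n))) - exp (-1 * (ln x - ln (real n)))) / (0 - (-1)) else 0)"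
      unfolding f_def by (subst integral_mult_right_zero, subst Perron_integral) (use \<sigma> in auto)
    also have "\<dots> = complex_of_real (vonM n) * of_real (if n \<in> nats_upto x then 2 * pi * (1 - real n / x) else 0)"
      by (simp only: iff e) simp
    finally show ?thesis by simp
  qed
  have nb: "norm (f n t) \<le> (4 * exp (\<sigma> * ln x)) * (\<bar>vonM n\<bar> * real n powr (-\<sigma>)) * (1 + \<bar>t\<bar>) powr (-3/2)" for n t
  proof (cases "n = 0")
    case True thus ?thesis by (simp add: f_def)
  next
    case False
    have m: "min (\<sigma> - 0) 1 * min (\<sigma> - (-1)) 1 = (1::real)" using \<sigma> by simp
    have e: "exp (\<sigma> * (ln x - ln (real n))) = exp (\<sigma> * ln x) * real n powr (-\<sigma>)"
      using False by (simp add: powr_def right_diff_distrib exp_diff exp_minus field_simps)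
    have "norm (f n t) \<le> \<bar>vonM n\<bar> * ((4 * exp (\<sigma> * (ln x - ln (real n))) / (min (\<sigma> - 0) 1 * min (\<sigma> - (-1)) 1)) * (1 + \<bar>t\<bar>) powr (-3/2))"
      unfolding f_def norm_mult norm_of_real by (intro mult_left_mono norm_Perron_integrand_le[unfolded norm_mult]) (use \<sigma> mangoldt_nonneg in auto)
    also have "\<dots> = (4 * exp (\<sigma> * ln x)) * (\<bar>vonM n\<bar> * real n powr (-\<sigma>)) * (1 + \<bar>t\<bar>) powr (-3/2)"
      unfolding m e by simp
    finally show ?thesis .
  qed
  have cont: "continuous_on UNIV (f n)" for n
    unfolding f_def by (intro continuous_on_mult continuous_on_const continuous_on_Perron_integrand) (use \<sigma> in auto)
  have int: "integrable lborel (f n)" for n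
    by (rule integrable_dominated_powr(1)[OF cont nb])
  have sm: "summable (\<lambda>n. \<bar>vonM n\<bar> * real n powr (-\<sigma>))"
    using log_bounded_vonM \<sigma>(1) by (rule summable_log_bounded)
  have summ: "summable (\<lambda>n. norm (f n t))" for t
    by (rule summable_comparison_test'[where N = 0, OF summable_mult2[OF summable_mult[OF sm]]])
       (use nb in auto)
  have "(\<lambda>n. \<integral>t. f n t \<partial>lborel) sums (\<integral>t. (\<Sum>n. f n t) \<partial>lborel)"
  proof (rule sums_integral[OF int])
    show "AE t in lborel. summable (\<lambda>n. norm (f n t))" using summ by simp
    have le: "(\<integral>t. norm (f n t) \<partial>lborel) \<le> (4 * exp (\<sigma> * ln x)) * (\<bar>vonM n\<bar> * real n powr (-\<sigma>)) * (\<integral>t. (1 + \<bar>t\<bar>) powr (-3/2) \<partial>lborel)" for n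
    proof -
      have "(\<integral>t. norm (f n t) \<partial>lborel) \<le> (\<integral>t. (4 * exp (\<sigma> * ln x)) * (\<bar>vonM n\<bar> * real n powr (-\<sigma>)) * (1 + \<bar>t\<bar>) powr (-3/2) \<partial>lborel)"
        by (intro integral_mono integrable_norm int integrable_mult_right integrable_powr_three_halves nb)
      thus ?thesis by simp
    qed
    show "summable (\<lambda>n. \<integral>t. norm (f n t) \<partial>lborel)"
      by (rule summable_comparison_test'[where N = 0, OF summable_mult2[OF summable_mult[OF sm]]])
         (use le in \<open>simp add: integral_nonneg_AE\<close>)
  qed
  moreover have "(\<Sum>n. f n t) = dirichlet vonM (Complex \<sigma> t) * (exp (Complex \<sigma> t * of_real (ln x)) / (Complex \<sigma> t * (Complex \<sigma> t + 1)))" for t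
  proof -
    have "(\<lambda>n. (of_real (vonM n) * of_nat n powr (- Complex \<sigma> t)) * (exp (Complex \<sigma> t * of_real (ln x)) / (Complex \<sigma> t * (Complex \<sigma> t + 1)))) sums
            (dirichlet vonM (Complex \<sigma> t) * (exp (Complex \<sigma> t * of_real (ln x)) / (Complex \<sigma> t * (Complex \<sigma> t + 1))))"
      by (intro sums_mult2 dirichlet_sums log_bounded_vonM) (use \<sigma> in auto)
    moreover have "(of_real (vonM n) * of_nat n powr (- Complex \<sigma> t)) * (exp (Complex \<sigma> t * of_real (ln x)) / (Complex \<sigma> t * (Complex \<sigma> t + 1))) = f n t" for n
    proof (cases "n = 0")
      case False
      have "exp (Complex \<sigma> t * of_real (ln x - ln (real n))) = of_nat n powr (- Complex \<sigma> t) * exp (Complex \<sigma> t * of_real (ln x))"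
      proof -
        have "of_nat n powr (- Complex \<sigma> t) = exp (- Complex \<sigma> t * of_real (ln (real n)))"
          using False by (simp add: powr_def Ln_of_nat)
        thus ?thesis
          by (simp only: exp_add [symmetric]) (rule arg_cong[of _ _ exp], simp add: algebra_simps)
      qed
      thus ?thesis by (simp add: f_def)
    qed (simp add: f_def)
    ultimately show ?thesis by (simp only: sums_iff)
  qed
  ultimately have S1: "(\<lambda>n. of_real (if n \<in> nats_upto x then 2 * pi * vonM n * (1 - real n / x) else 0)) sums
      (\<integral>t. dirichlet vonM (Complex \<sigma> t) * (exp (Complex \<sigma> t * of_real (ln x)) / (Complex \<sigma> t * (Complex \<sigma> t + 1))) \<partial>lborel)"
    by (simp only: val)
  have S2: "(\<lambda>n. complex_of_real (if n \<in> nats_upto x then 2 * pi * vonM n * (1 - real n / x) else 0)) sums 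
        of_real (\<Sum>n\<in>nats_upto x. 2 * pi * vonM n * (1 - real n / x))"
    by (intro sums_of_real sums_If_finite_set) auto
  have S3: "(\<Sum>n\<in>nats_upto x. 2 * pi * vonM n * (1 - real n / x)) = 2 * pi * psi1 x / x"
    unfolding psi1_def sum_distrib_left sum_divide_distrib using x by (intro sum.cong) (auto simp: field_simps)
  show ?thesis using sums_unique2[OF S2 S1] unfolding S3 .
qed

text \<open>The pole term 1 / ((s - 1) s (s + 1)) is half the difference of 1 / ((s - 1) s) and 1 /
  (s (s + 1)), whose Perron integrals are \<open>2 * pi * (x - 1)\<close> and
  \<open>2 * pi * (1 - 1 / x)\<close>.\<close>

lemma psi1_explicit:
  assumes x: "x > 1" and \<sigma>: "1 < \<sigma>" "\<sigma> \<le> 2"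
  shows "complex_of_real (2 * pi * psi1 x / x) = of_real (pi * (x - 2 + 1 / x)) -
     (\<integral>t. Perron_rem (Complex \<sigma> t) * exp (Complex \<sigma> t * of_real (ln x)) \<partial>lborel)"
proof -
  define y where "y = ln x"
  have y: "y > 0" using x by (simp add: y_def)
  let ?g = "\<lambda>a b t. exp (Complex \<sigma> t * of_real y) / ((Complex \<sigma> t - of_real a) * (Complex \<sigma> t - of_real b))"
  let ?R = "\<lambda>t. Perron_rem (Complex \<sigma> t) * exp (Complex \<sigma> t * of_real y)"
  have ig: "integrable lborel (?g a b)" if "a < \<sigma>" "b < \<sigma>" for a b
    using integrable_dominated_powr(1)[OF continuous_on_Perron_integrand norm_Perron_integrand_le] that by blast
  have iR: "integrable lborel ?R" using controlled_integral_bound[OF controlled_Perron_rem] \<sigma> y by blast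
  have "dirichlet vonM (Complex \<sigma> t) * (exp (Complex \<sigma> t * of_real y) / (Complex \<sigma> t * (Complex \<sigma> t + 1)))
      = (?g 1 0 t - ?g 0 (-1) t) / 2 - ?R t" for t
  proof -
    have alg: "(1 / (s - 1) - u * v) * (e / (s * (s + 1))) = (e / ((s - 1) * (s - 0)) - e / ((s - 0) * (s + 1))) / 2 - u * v * (1 / s * (1 / (s + 1))) * e"
      if "s \<noteq> 0" "s \<noteq> 1" "s + 1 \<noteq> 0" for s e u v :: complex
    proof -
      have "s - 1 \<noteq> 0" using that by simp
      have "(1 / (s - 1)) * (e / (s * (s + 1))) = (e / ((s - 1) * (s - 0)) - e / ((s - 0) * (s + 1))) / 2"
        using that \<open>s - 1 \<noteq> 0\<close> by (simp add: divide_simps) (simp add: algebra_simps)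
      moreover have "u * v * (e / (s * (s + 1))) = u * v * (1 / s * (1 / (s + 1))) * e" by simp
      ultimately show ?thesis by (simp only: left_diff_distrib)
    qed
    have "Complex \<sigma> t \<noteq> 0" "Complex \<sigma> t \<noteq> 1" "Complex \<sigma> t + 1 \<noteq> 0"
      using \<sigma> by (auto simp: complex_eq_iff)
    note alg = alg[OF this]
    have "Re (Complex \<sigma> t) > 1" using \<sigma> by simp
    from dirichlet_vonM_eq(2)[OF this]
    show ?thesis
      unfolding Perron_rem_def by (simp only: divide_inverse[of "deriv reg_zeta _"] alg of_real_0 of_real_1 of_real_minus 
        diff_minus_eq_add add_0_right)
  qed
  hence "complex_of_real (2 * pi * psi1 x / x) = (\<integral>t. (?g 1 0 t - ?g 0 (-1) t) / 2 - ?R t \<partial>lborel)"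
    using Perron_formula[OF less_imp_le[OF x] \<sigma>] by (simp only: y_def)
  also have "\<dots> = (integral\<^sup>L lborel (?g 1 0) - integral\<^sup>L lborel (?g 0 (-1))) / 2 - integral\<^sup>L lborel ?R"
  proof -
    have i1: "integrable lborel (?g 1 0)" and i2: "integrable lborel (?g 0 (-1))" using ig[of 1 0] ig[of 0 "-1"] \<sigma> by simp_all
    show ?thesis
      unfolding Bochner_Integration.integral_diff[OF integrable_divide[OF Bochner_Integration.integrable_diff[OF i1 i2]] iR]
        integral_divide_zero Bochner_Integration.integral_diff[OF i1 i2] by (rule refl)
  qed
  also have "integral\<^sup>L lborel (?g 1 0) = of_real (2 * pi * (x - 1))"
    using \<sigma> y x by (subst Perron_integral) (auto simp: y_def)
  also have "integral\<^sup>L lborel (?g 0 (-1)) = of_real (2 * pi * (1 - 1 / x))"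
    using \<sigma> y x by (subst Perron_integral) (auto simp: y_def exp_minus field_simps)
  also have "(of_real (2 * pi * (x - 1)) - of_real (2 * pi * (1 - 1 / x))) / 2 = 
               complex_of_real ((2 * pi * (x - 1) - 2 * pi * (1 - 1 / x)) / 2)"
    by (simp only: of_real_diff of_real_divide of_real_numeral)
  also have "(2 * pi * (x - 1) - 2 * pi * (1 - 1 / x)) / 2 = pi * (x - 2 + 1 / x)"
    using x by (simp add: field_simps)
  finally show ?thesis by (simp add: y_def)
qed

text \<open>Applies \<open>ln u \<le> u\<close> to the fourth root of \<open>x\<close>. This and the
  next two bounds serve to absorb lower-order terms into the error.\<close>

lemma ln_sq_le: "(x::real) \<ge> 1 \<Longrightarrow> (ln x) ^ 2 \<le> 16 * x powr (1/2)"
proof -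
  assume x: "x \<ge> 1"
  have "ln x = 4 * ln (x powr (1/4))" using x by (simp add: ln_powr)
  also have "ln (x powr (1/4)) \<le> x powr (1/4)" using ln_le_minus_one[of "x powr (1/4)"] x by simp
  finally have "ln x ^ 2 \<le> (4 * x powr (1/4)) ^ 2" using x by (intro power_mono) auto
  also have "\<dots> = 16 * x powr (1/2)" unfolding power_mult_distrib using x by (simp add: powr_power)
  finally show ?thesis .
qed

lemma sqrt_le_div_ln_sq: "(x::real) > 1 \<Longrightarrow> x powr (1/2) \<le> 16 * x / (ln x) ^ 2"
proof -
  assume x: "x > 1"
  have "x powr (1/2) * (ln x) ^ 2 \<le> x powr (1/2) * (16 * x powr (1/2))"
    using x by (intro mult_left_mono ln_sq_le) auto
  also have "\<dots> = 16 * (x powr (1/2 + 1/2))" by (subst powr_add) simp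
  also have "\<dots> = 16 * x" using x by simp
  finally show ?thesis using x by (simp add: field_simps)
qed

lemma one_le_div_ln_sq: "(x::real) > 1 \<Longrightarrow> 1 \<le> 16 * x / (ln x) ^ 2"
  by (rule order.trans[OF ge_one_powr_ge_zero[of x "1/2"] sqrt_le_div_ln_sq]) auto

lemma psi1_asymp:
  obtains C where "C \<ge> 0" "\<And>x. x \<ge> exp 1 \<Longrightarrow> \<bar>psi1 x - x ^ 2 / 2\<bar> \<le> C * x ^ 2 / (ln x) ^ 2"
proof -
  obtain C where C: "\<And>\<sigma> y. 1 < \<sigma> \<Longrightarrow> \<sigma> \<le> 2 \<Longrightarrow> y > 0 \<Longrightarrow> 
       norm (\<integral>t. Perron_rem (Complex \<sigma> t) * exp (Complex \<sigma> t * of_real y) \<partial>lborel) \<le> C * exp (\<sigma> * y) / y ^ 2"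
    using controlled_integral_bound[OF controlled_Perron_rem] by meson
  have main: "\<bar>psi1 x - x ^ 2 / 2\<bar> \<le> (\<bar>C\<bar> * exp 1 + 16) * x ^ 2 / (ln x) ^ 2" if x: "x \<ge> exp 1" for x
  proof -
    have x1: "x > 1" using x one_less_exp_iff[of "1::real"] by linarith
    define y where "y = ln x"
    have y: "y \<ge> 1" using x x1 by (simp add: y_def ln_ge_iff)
    \<comment> \<open>The assumption \<open>x \<ge> exp 1\<close> gives \<open>y \<ge> 1\<close>,
      which keeps the line in the strip up to real part 2.\<close>
    define \<sigma> where "\<sigma> = 1 + 1 / y"
    have \<sigma>: "1 < \<sigma>" "\<sigma> \<le> 2" using y by (auto simp: \<sigma>_def)
    have "\<sigma> * y = y + 1" using y by (simp add: \<sigma>_def field_simps)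
    hence e: "exp (\<sigma> * y) = exp 1 * x" using x1 by (simp add: exp_add y_def)
    have "norm (complex_of_real (2 * pi * psi1 x / x - pi * (x - 2 + 1 / x))) \<le> C * exp (\<sigma> * y) / y ^ 2"
      unfolding of_real_diff psi1_explicit[OF x1 \<sigma>] y_def[symmetric] using C[OF \<sigma>, of y] y by (simp add: norm_minus_commute)
    hence "\<bar>2 * pi * psi1 x / x - pi * (x - 2 + 1 / x)\<bar> \<le> C * (exp 1 * x) / y ^ 2"
      unfolding norm_of_real e .
    also have "\<dots> \<le> \<bar>C\<bar> * (exp 1 * x) / y ^ 2" using x1 by (intro divide_right_mono mult_right_mono) auto
    also have "2 * pi * psi1 x / x - pi * (x - 2 + 1 / x) = (2 * pi / x) * (psi1 x - x ^ 2 / 2 + (x - 1 / 2))"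
      using x1 by (simp add: field_simps power2_eq_square)
    also have "\<bar>\<dots>\<bar> = (2 * pi / x) * \<bar>psi1 x - x ^ 2 / 2 + (x - 1 / 2)\<bar>"
      using x1 by (simp add: abs_mult)
    finally have "\<bar>psi1 x - x ^ 2 / 2 + (x - 1 / 2)\<bar> \<le> \<bar>C\<bar> * (exp 1 * x) / y ^ 2 / (2 * pi / x)"
      using x1 by (subst pos_le_divide_eq) (auto simp: mult.commute)
    also have "\<dots> = \<bar>C\<bar> * exp 1 * x ^ 2 / y ^ 2 / (2 * pi)" using x1 by (simp add: power2_eq_square)
    also have "\<dots> \<le> \<bar>C\<bar> * exp 1 * x ^ 2 / y ^ 2 / 1"
      using pi_gt3 by (intro divide_left_mono) auto
    finally have 1: "\<bar>psi1 x - x ^ 2 / 2 + (x - 1 / 2)\<bar> \<le> \<bar>C\<bar> * exp 1 * x ^ 2 / y ^ 2" by simp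
    \<comment> \<open>Absorbs the lower-order term \<open>x - 1 / 2\<close> left by the
      pole.\<close>
    have "x * 1 \<le> x * (16 * x / y ^ 2)" using one_le_div_ln_sq[OF x1] x1 unfolding y_def by (intro mult_left_mono) auto
    hence 2: "x \<le> 16 * x ^ 2 / y ^ 2" by (simp add: power2_eq_square mult_ac)
    have "(\<bar>C\<bar> * exp 1 + 16) * x ^ 2 / y ^ 2 = \<bar>C\<bar> * exp 1 * x ^ 2 / y ^ 2 + 16 * x ^ 2 / y ^ 2"
      by (simp add: distrib_right add_divide_distrib)
    with 1 2 x1 show ?thesis unfolding y_def[symmetric] by linarith
  qed
  show ?thesis by (rule that[OF _ main]) auto
qed

section \<open>From the Chebyshev function to the prime counting function\<close>

lemma psi_mono: "x \<le> y \<Longrightarrow> psi x \<le> psi y"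
  unfolding psi_def by (intro sum_mono2) (auto simp: mem_nats_upto mangoldt_nonneg)

text \<open>Enlarging \<open>x\<close> by \<open>h\<close> adds \<open>h\<close> to each old weight,
  and the new indices contribute nonnegatively. The counterpart below drops the terms with
  \<open>x - h < n\<close>, whose weights are nonpositive after the shift.\<close>

lemma psi1_diff_ge:
  assumes "h \<ge> 0"
  shows "psi1 (x + h) - psi1 x \<ge> h * psi x"
proof -
  have "psi1 x + h * psi x = (\<Sum>n\<in>nats_upto x. vonM n * (x + h - real n))"
    unfolding psi1_def psi_def sum_distrib_left sum.distrib[symmetric] by (intro sum.cong) (auto simp: algebra_simps)
  also have "\<dots> \<le> psi1 (x + h)"
    unfolding psi1_def using assms by (intro sum_mono2) (auto simp: mem_nats_upto mangoldt_nonneg)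
  finally show ?thesis by simp
qed

lemma psi1_diff_le:
  assumes "h \<ge> 0"
  shows "psi1 x - psi1 (x - h) \<le> h * psi x"
proof -
  have sub: "nats_upto (x - h) \<subseteq> nats_upto x" using assms by (auto simp: mem_nats_upto)
  have "psi1 x - h * psi x = (\<Sum>n\<in>nats_upto x. vonM n * (x - h - real n))"
    unfolding psi1_def psi_def sum_distrib_left sum_subtractf[symmetric] by (intro sum.cong) (auto simp: algebra_simps)
  also have "\<dots> = psi1 (x - h) + (\<Sum>n\<in>nats_upto x - nats_upto (x - h). vonM n * (x - h - real n))"
    unfolding psi1_def by (subst sum.subset_diff[OF sub]) (auto simp: add.commute)
  also have "(\<Sum>n\<in>nats_upto x - nats_upto (x - h). vonM n * (x - h - real n)) \<le> 0"
    by (intro sum_nonpos mult_nonneg_nonpos mangoldt_nonneg) (auto simp: mem_nats_upto)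
  finally show ?thesis by simp
qed

text \<open>Monotonicity confines \<open>h * psi x\<close> between differences of
  \<open>psi1\<close>. The main terms cost \<open>h / 2\<close> after division by \<open>h\<close>,
  the errors \<open>5 * E / h\<close>, where 5 = 1 + 4 counts the two evaluations;
  \<open>h = x / ln x\<close> makes both of order x / ln x. From \<open>exp 2\<close> on,
  \<open>h \<le> x / 2\<close> and \<open>x - h \<ge> exp 1\<close>.\<close>

lemma psi_asymp:
  obtains C where "C \<ge> 0" "\<And>x. x \<ge> exp 2 \<Longrightarrow> \<bar>psi x - x\<bar> \<le> C * x / ln x"
proof -
  obtain C where C: "C \<ge> 0" "\<And>x. x \<ge> exp 1 \<Longrightarrow> \<bar>psi1 x - x ^ 2 / 2\<bar> \<le> C * x ^ 2 / (ln x) ^ 2"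
    using psi1_asymp by blast
  have e1: "exp 1 \<ge> (2::real)" using exp_ge_add_one_self[of "1::real"] by simp
  have e2: "exp 2 = exp 1 * exp (1::real)" by (simp flip: exp_add)
  have ln2: "ln 2 \<le> (1::real)" using ln_le_minus_one[of "2::real"] by simp
  have "\<bar>psi x - x\<bar> \<le> (1 / 2 + 5 * C) * x / ln x" if x: "x \<ge> exp 2" for x
  proof -
    have "exp 1 * exp 1 \<ge> 2 * exp (1::real)" using e1 by (intro mult_right_mono) auto
    hence x2: "x \<ge> 2 * exp 1" using x e2 by linarith
    hence x4: "x \<ge> 4" using e1 by linarith
    define L where "L = ln x"
    have L: "L \<ge> 2" using x x4 by (simp add: L_def ln_ge_iff)
    define h where "h = x / L"
    have h: "h > 0" "h \<le> x / 2" using x4 L by (auto simp: h_def field_simps)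
    define E where "E = C * x ^ 2 / L ^ 2"
    have E: "E \<ge> 0" using C L by (auto simp: E_def)
    have b0: "\<bar>psi1 x - x ^ 2 / 2\<bar> \<le> E" using C(2)[of x] x2 e1 by (auto simp: E_def L_def)
    have b1: "\<bar>psi1 (x + h) - (x + h) ^ 2 / 2\<bar> \<le> 4 * E"
    proof -
      have "\<bar>psi1 (x + h) - (x + h) ^ 2 / 2\<bar> \<le> C * (x + h) ^ 2 / (ln (x + h)) ^ 2"
        using x2 h e1 by (intro C(2)) auto
      also have "\<dots> \<le> C * (2 * x) ^ 2 / L ^ 2"
        using C(1) x4 h L unfolding L_def by (intro frac_le mult_left_mono power_mono) auto
      also have "\<dots> = 4 * E" by (simp add: E_def power2_eq_square)
      finally show ?thesis .
    qed
    have b2: "\<bar>psi1 (x - h) - (x - h) ^ 2 / 2\<bar> \<le> 4 * E"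
    proof -
      have "\<bar>psi1 (x - h) - (x - h) ^ 2 / 2\<bar> \<le> C * (x - h) ^ 2 / (ln (x - h)) ^ 2"
        using x2 h by (intro C(2)) auto
      also have "\<dots> \<le> C * x ^ 2 / (L / 2) ^ 2"
      proof -
        have "L / 2 \<le> L - ln 2" using L ln2 by simp
        also have "\<dots> = ln (x / 2)" using x4 by (simp add: L_def ln_div)
        also have "\<dots> \<le> ln (x - h)" using x4 h by (subst ln_le_cancel_iff) auto
        finally have "L / 2 \<le> ln (x - h)" .
        thus ?thesis using C(1) x4 h L by (intro frac_le mult_left_mono power_mono) auto
      qed
      also have "\<dots> = 4 * E" by (simp add: E_def power2_eq_square)
      finally show ?thesis .
    qed
    have sq1: "(x + h) ^ 2 / 2 - x ^ 2 / 2 = h * (x + h / 2)" and sq2: "x ^ 2 / 2 - (x - h) ^ 2 / 2 = h * (x - h / 2)"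
      by (simp_all add: power2_eq_square field_simps)
    have E5: "5 * E = h * (5 * C * x / L)" using L by (simp add: E_def h_def power2_eq_square)
    have "h * psi x \<le> h * (x + h / 2) + 5 * E"
      using psi1_diff_ge[of h x] b0 b1 sq1 h by (simp only: abs_le_iff) linarith
    hence "h * psi x \<le> h * (x + h / 2 + 5 * C * x / L)" unfolding E5 by (simp only: distrib_left)
    hence up: "psi x \<le> x + h / 2 + 5 * C * x / L" using h by simp
    have "h * psi x \<ge> h * (x - h / 2) - 5 * E"
      using psi1_diff_le[of h x] b0 b2 sq2 h by (simp only: abs_le_iff) linarith
    hence "h * psi x \<ge> h * (x - h / 2 - 5 * C * x / L)" unfolding E5 by (simp only: right_diff_distrib)
    hence lo: "psi x \<ge> x - h / 2 - 5 * C * x / L" using h by simp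
    have "(1 / 2 + 5 * C) * x / L = h / 2 + 5 * C * x / L"
      by (simp add: h_def distrib_right add_divide_distrib)
    thus ?thesis using up lo unfolding L_def[symmetric] by (simp only: abs_le_iff) linarith
  qed
  thus ?thesis using C(1) by (intro that[of "1 / 2 + 5 * C"]) auto
qed

lemma psi_eq_0: "x < 1 \<Longrightarrow> psi x = 0"
  unfolding psi_def by (intro sum.neutral) (auto dest: mem_nats_upto_less_1)

lemma psi_nonneg: "psi x \<ge> 0"
  unfolding psi_def by (intro sum_nonneg mangoldt_nonneg)

text \<open>Extends the upper bound implied by the asymptotics to all \<open>x \<ge> 0\<close>, as
  the halving argument below runs down to small arguments; \<open>psi\<close> vanishes below
  1.\<close>

lemma psi_linear_bound:
  obtains D where "D \<ge> 0" "\<And>x. x \<ge> 0 \<Longrightarrow> psi x \<le> D * x"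
proof -
  obtain C where C: "C \<ge> 0" "\<And>x. x \<ge> exp 2 \<Longrightarrow> \<bar>psi x - x\<bar> \<le> C * x / ln x"
    using psi_asymp by blast
  have "psi x \<le> (1 + C + psi (exp 2)) * x" if "x \<ge> 0" for x
  proof (cases "x \<ge> exp 2")
    case True
    hence "ln x \<ge> 2" by (subst ln_ge_iff) (use less_le_trans[OF exp_gt_zero True] in auto)
    hence "C * x / ln x \<le> C * x / 1" using C(1) that by (intro divide_left_mono) auto
    hence "psi x \<le> (1 + C) * x" using C(2)[OF True] by (simp add: algebra_simps abs_le_iff)
    also have "\<dots> \<le> (1 + C + psi (exp 2)) * x" using that psi_nonneg by (intro mult_right_mono) auto
    finally show ?thesis .
  next
    case False
    show ?thesis
    proof (cases "x < 1")
      case True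
      thus ?thesis using that C(1) psi_nonneg[of "exp 2"] by (simp add: psi_eq_0)
    next
      case x1: False
      have "psi x \<le> psi (exp 2) * 1" using False psi_mono[of x "exp 2"] by simp
      also have "\<dots> \<le> (1 + C + psi (exp 2)) * x"
        using x1 C(1) psi_nonneg[of "exp 2"] by (intro mult_mono) auto
      finally show ?thesis .
    qed
  qed
  thus ?thesis using C(1) psi_nonneg[of "exp 2"] by (intro that[of "1 + C + psi (exp 2)"]) auto
qed

text \<open>Halving \<open>x\<close> lowers each weight by \<open>ln 2 \<le> 1\<close>, so the sum
  at \<open>x\<close> exceeds that at \<open>x / 2\<close> by at most
  \<open>psi x \<le> D * x\<close>. The resulting geometric series has the sum
  \<open>2 * D * x\<close>.\<close>

lemma sum_vonM_ln_bound:
  obtains D where "D \<ge> 0" "\<And>x. x \<ge> 1 \<Longrightarrow> (\<Sum>n\<in>nats_upto x. vonM n * (ln x - ln (real n))) \<le> D * x"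
proof -
  obtain D where D: "D \<ge> 0" "\<And>x. x \<ge> 0 \<Longrightarrow> psi x \<le> D * x" using psi_linear_bound by blast
  define T where "T = (\<lambda>x. \<Sum>n\<in>nats_upto x. vonM n * (ln x - ln (real n)))"
  have T0: "T x = 0" if "x < 1" for x
    unfolding T_def by (intro sum.neutral) (auto dest!: mem_nats_upto_less_1[OF that])
  have step: "T x \<le> T (x / 2) + psi x" if x: "x > 0" for x
  proof -
    have sub: "nats_upto (x / 2) \<subseteq> nats_upto x" using x by (auto simp: mem_nats_upto)
    have le: "vonM n * (ln x - ln (real n)) \<le> (if n \<in> nats_upto (x / 2) then vonM n * (ln (x / 2) - ln (real n)) else 0) + vonM n"
      if "n \<in> nats_upto x" for n
    proof (cases "n = 0")
      case False
      have ln2: "ln 2 \<le> (1::real)" using ln_le_minus_one[of "2::real"] by simp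
      show ?thesis
      proof (cases "n \<in> nats_upto (x / 2)")
        case True
        have "vonM n * (ln x - ln (real n)) = vonM n * (ln (x / 2) - ln (real n)) + vonM n * ln 2"
          using x by (simp add: ln_div algebra_simps)
        also have "vonM n * ln 2 \<le> vonM n * 1" by (intro mult_left_mono ln2 mangoldt_nonneg)
        finally show ?thesis using True by simp
      next
        case n: False
        have "ln x - ln 2 = ln (x / 2)" using x by (simp add: ln_div)
        also have "\<dots> \<le> ln (real n)" using n x False by (subst ln_le_cancel_iff) (auto simp: mem_nats_upto)
        finally have "ln x - ln (real n) \<le> 1" using ln2 by linarith
        hence "vonM n * (ln x - ln (real n)) \<le> vonM n * 1" by (intro mult_left_mono mangoldt_nonneg)
        thus ?thesis using n by simp
      qed
    qed auto
    have "T x \<le> (\<Sum>n\<in>nats_upto x. (if n \<in> nats_upto (x / 2) then vonM n * (ln (x / 2) - ln (real n)) else 0) + vonM n)"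
      unfolding T_def by (intro sum_mono le)
    also have "\<dots> = T (x / 2) + psi x"
      unfolding sum.distrib T_def psi_def using sub by (subst sum.inter_restrict[symmetric]) (auto simp: Int_absorb1)
    finally show ?thesis .
  qed
  have "T x \<le> 2 * D * x" if "0 < x" "x < 2 ^ k" for x k
    using that
  proof (induction k arbitrary: x)
    case 0
    thus ?case using D(1) by (simp add: T0)
  next
    case (Suc k)
    have "T (x / 2) \<le> 2 * D * (x / 2)" by (rule Suc.IH) (use Suc.prems in auto)
    thus ?case using step[OF Suc.prems(1)] D(2)[of x] Suc.prems by simp
  qed
  moreover have "\<exists>k. x < 2 ^ k" for x :: real by (rule real_arch_pow) auto
  ultimately have "T x \<le> 2 * D * x" if "x \<ge> 1" for x using that by (metis less_le_trans zero_less_one)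
  thus ?thesis using D(1) by (intro that[of "2 * D"]) (auto simp: T_def)
qed

section \<open>Counting primes by means of \<open>psi\<close>\<close>

definition primes_upto :: "real \<Rightarrow> nat set" where "primes_upto x = {p. prime p \<and> real p \<le> x}"

lemma finite_primes_upto [simp, intro]: "finite (primes_upto x)"
  by (rule finite_subset[OF _ finite_nats_upto[of x]]) (auto simp: primes_upto_def mem_nats_upto)

text \<open>A prime \<open>p \<le> x\<close> has at most \<open>ln x / ln p\<close> powers up to
  \<open>x\<close>, each of weight \<open>ln p\<close>, so it contributes at most
  \<open>ln x\<close>.\<close>

lemma psi_le_card_primes:
  assumes x: "x \<ge> 1"
  shows "psi x \<le> real (card (primes_upto x)) * ln x"
proof -
  define A where "A = {n\<in>nats_upto x. primepow n}"
  have finA: "finite A" by (simp add: A_def)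
  have im: "aprimedivisor ` A \<subseteq> primes_upto x"
  proof
    fix p assume "p \<in> aprimedivisor ` A"
    then obtain n where n: "n \<in> A" "p = aprimedivisor n" by blast
    hence "n > 1" "primepow n" using primepow_gt_Suc_0[of n] by (auto simp: A_def)
    hence "prime p" "p dvd n" using n by (auto intro!: prime_aprimedivisor' aprimedivisor_dvd')
    moreover from this have "p \<le> n" using \<open>n > 1\<close> by (intro dvd_imp_le) auto
    ultimately show "p \<in> primes_upto x" using n by (auto simp: A_def mem_nats_upto primes_upto_def)
  qed
  have "psi x = (\<Sum>n\<in>A. ln (real (aprimedivisor n)))"
    unfolding psi_def A_def by (intro sum.mono_neutral_cong_right) (auto simp: mangoldt_def)
  also have "\<dots> = (\<Sum>p\<in>primes_upto x. \<Sum>n | n \<in> A \<and> aprimedivisor n = p. ln (real (aprimedivisor n)))"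
    by (rule sum.group[symmetric, OF finA finite_primes_upto im])
  also have "\<dots> \<le> (\<Sum>p\<in>primes_upto x. ln x)"
  proof (rule sum_mono)
    fix p assume p: "p \<in> primes_upto x"
    hence pp: "prime p" "real p \<le> x" by (auto simp: primes_upto_def)
    have p1: "p > 1" using pp prime_gt_1_nat by blast
    have lnp: "ln (real p) > 0" using p1 by simp
    define m where "m = nat \<lfloor>ln x / ln (real p)\<rfloor>"
    define F where "F = {n. n \<in> A \<and> aprimedivisor n = p}"
    have "F \<subseteq> (\<lambda>k. p ^ k) ` {1..m}"
    proof
      fix n assume n: "n \<in> F"
      hence "primepow n" by (simp add: F_def A_def)
      then obtain q k where qk: "prime q" "k > 0" "n = q ^ k" by (auto simp: primepow_def)
      hence "q = p" using n by (auto simp: F_def aprimedivisor_prime_power)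
      hence nk: "n = p ^ k" using qk by simp
      have "real k * ln (real p) = ln (real n)" using p1 by (simp add: nk ln_realpow)
      also have "\<dots> \<le> ln x" using n x p1 by (subst ln_le_cancel_iff) (auto simp: F_def A_def mem_nats_upto nk)
      finally have "real k \<le> ln x / ln (real p)" using lnp by (simp add: field_simps)
      hence "k \<le> m" unfolding m_def by (rule le_nat_floor)
      thus "n \<in> (\<lambda>k. p ^ k) ` {1..m}" using nk qk by auto
    qed
    hence "card F \<le> card ((\<lambda>k. p ^ k) ` {1..m})" by (intro card_mono) auto
    also have "\<dots> \<le> m" using card_image_le[of "{1..m}"] by simp
    finally have "real (card F) \<le> real m" by simp
    also have "\<dots> \<le> ln x / ln (real p)" unfolding m_def using x lnp by (intro of_nat_floor) auto
    finally have "real (card F) * ln (real p) \<le> ln x" using lnp by (simp add: field_simps)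
    moreover have "(\<Sum>n | n \<in> A \<and> aprimedivisor n = p. ln (real (aprimedivisor n))) = (\<Sum>n\<in>F. ln (real p))"
      unfolding F_def by (intro sum.cong) auto
    ultimately show "(\<Sum>n | n \<in> A \<and> aprimedivisor n = p. ln (real (aprimedivisor n))) \<le> ln x" by (simp only: sum_constant)
  qed
  finally show ?thesis by simp
qed

text \<open>The lower bound divides the previous lemma by \<open>ln x\<close>. For the upper bound
  the excess of \<open>N * L\<close> over the sum of \<open>vonM\<close> on primes is the sum of
  \<open>L - ln p\<close>. Primes up to the square root of \<open>x\<close> contribute little by
  their number; the others are charged to the weighted sum of the lemma
  \<open>sum_vonM_ln_bound\<close>, which gains the factor \<open>2 / L\<close>.\<close>

lemma card_primes_upto_asymp:
  obtains C where "C \<ge> 0" "\<And>x. x \<ge> exp 2 \<Longrightarrow> \<bar>real (card (primes_upto x)) - x / ln x\<bar> \<le> C * x / (ln x) ^ 2"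
proof -
  obtain C where C: "C \<ge> 0" "\<And>x. x \<ge> exp 2 \<Longrightarrow> \<bar>psi x - x\<bar> \<le> C * x / ln x"
    using psi_asymp by blast
  obtain D where D: "D \<ge> 0" "\<And>x. x \<ge> 1 \<Longrightarrow> (\<Sum>n\<in>nats_upto x. vonM n * (ln x - ln (real n))) \<le> D * x" 
    using sum_vonM_ln_bound by blast
  have "\<bar>real (card (primes_upto x)) - x / ln x\<bar> \<le> (C + (16 + 2 * D)) * x / (ln x) ^ 2" if x: "x \<ge> exp 2" for x
  proof -
    have x1: "x > 1" using x one_less_exp_iff[of "2::real"] by linarith
    define L where "L = ln x"
    have L: "L \<ge> 2" using x x1 by (simp add: L_def ln_ge_iff)
    define N where "N = real (card (primes_upto x))"
    have sq: "x powr (1/2) \<le> x" using powr_mono[of "1/2" 1 x] x1 by simp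
    have psi: "x - C * x / L \<le> psi x" "psi x \<le> x + C * x / L" using C(2)[OF x] by (auto simp: L_def abs_le_iff)
    have "(x - C * x / L) / L \<le> psi x / L" using psi L by (intro divide_right_mono) auto
    also have "psi x \<le> N * L" using psi_le_card_primes[of x] x1 by (simp add: N_def L_def)
    hence "psi x / L \<le> N" using L by (simp add: field_simps)
    finally have lo: "x / L - C * x / L ^ 2 \<le> N" by (simp add: diff_divide_distrib power2_eq_square)
    have nn: "0 \<le> vonM n * (L - ln (real n))" if "n \<in> nats_upto x" for n
    proof (cases "n = 0")
      case False
      thus ?thesis using that x1 by (intro mult_nonneg_nonneg mangoldt_nonneg) (auto simp: L_def mem_nats_upto)
    qed auto
    have "N * L - (\<Sum>p\<in>primes_upto x. vonM p) = (\<Sum>p\<in>primes_upto x. L - ln (real p))"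
    proof -
      have "(\<Sum>p\<in>primes_upto x. vonM p) = (\<Sum>p\<in>primes_upto x. ln (real p))"
        by (intro sum.cong) (auto simp: primes_upto_def)
      thus ?thesis by (simp add: sum_subtractf N_def)
    qed
    also have "\<dots> \<le> (\<Sum>p\<in>primes_upto x. (if p \<in> nats_upto (x powr (1/2)) then L else 0) + 2 / L * (vonM p * (L - ln (real p))))"
    proof (rule sum_mono)
      fix p assume p: "p \<in> primes_upto x"
      hence pp: "prime p" "real p \<le> x" by (auto simp: primes_upto_def)
      have p1: "p > 1" using pp prime_gt_1_nat by blast
      have pu: "p \<in> nats_upto x" using pp by (simp add: mem_nats_upto)
      show "L - ln (real p) \<le> (if p \<in> nats_upto (x powr (1/2)) then L else 0) + 2 / L * (vonM p * (L - ln (real p)))"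
      proof (cases "p \<in> nats_upto (x powr (1/2))")
        case True
        have "0 \<le> 2 / L * (vonM p * (L - ln (real p)))" using L by (intro mult_nonneg_nonneg[OF _ nn[OF pu]]) auto
        moreover have "ln (real p) \<ge> 0" by (rule ln_of_nat_ge_0)
        ultimately show ?thesis using True by simp
      next
        case False
        hence "ln (x powr (1/2)) \<le> ln (real p)" using x1 p1 by (subst ln_le_cancel_iff) (auto simp: mem_nats_upto)
        hence "L / 2 \<le> ln (real p)" using x1 by (simp add: ln_powr L_def)
        \<comment> \<open>Above the square root a prime has weight at least \<open>L / 2\<close>, so
          it may be counted with the factor \<open>2 / L * vonM p\<close> inserted.\<close>
        hence 1: "1 \<le> 2 / L * vonM p" using L pp by (simp add: field_simps)
        have "L - ln (real p) \<ge> 0" using pp p1 x1 by (simp add: L_def)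
        hence "1 * (L - ln (real p)) \<le> (2 / L * vonM p) * (L - ln (real p))" by (intro mult_right_mono 1)
        thus ?thesis using False by simp
      qed
    qed
    also have "\<dots> = (\<Sum>p\<in>primes_upto x. if p \<in> nats_upto (x powr (1/2)) then L else 0) + 
                 2 / L * (\<Sum>p\<in>primes_upto x. vonM p * (L - ln (real p)))"
      unfolding sum.distrib sum_distrib_left by simp
    also have "(\<Sum>p\<in>primes_upto x. if p \<in> nats_upto (x powr (1/2)) then L else 0) \<le> 16 * x / L"
    proof -
      have "(\<Sum>p\<in>primes_upto x. if p \<in> nats_upto (x powr (1/2)) then L else 0) = (\<Sum>p\<in>primes_upto x \<inter> nats_upto (x powr (1/2)). L)"
        by (subst sum.inter_restrict) auto
      also have "\<dots> = real (card (primes_upto x \<inter> nats_upto (x powr (1/2)))) * L" by simp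
      also have "card (primes_upto x \<inter> nats_upto (x powr (1/2))) \<le> card {1..nat \<lfloor>x powr (1/2)\<rfloor>}"
        by (intro card_mono) (auto simp: primes_upto_def mem_nats_upto le_nat_floor Suc_le_eq prime_gt_0_nat)
      hence "real (card (primes_upto x \<inter> nats_upto (x powr (1/2)))) * L \<le> real (nat \<lfloor>x powr (1/2)\<rfloor>) * L"
        using L by (intro mult_right_mono of_nat_mono) auto
      also have "\<dots> \<le> x powr (1/2) * L" using L by (intro mult_right_mono of_nat_floor) auto
      also have "\<dots> \<le> 16 * x / L ^ 2 * L" using sqrt_le_div_ln_sq[OF x1] L by (intro mult_right_mono) (auto simp: L_def)
      also have "\<dots> = 16 * x / L" using L by (simp add: power2_eq_square)
      finally show ?thesis .
    qed
    also have "(\<Sum>p\<in>primes_upto x. vonM p * (L - ln (real p))) \<le> (\<Sum>n\<in>nats_upto x. vonM n * (L - ln (real n)))"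
      by (rule sum_mono2) (use nn in \<open>auto simp: primes_upto_def mem_nats_upto\<close>)
    also have "\<dots> \<le> D * x" using D(2)[of x] x1 by (simp add: L_def)
    finally have "N * L - (\<Sum>p\<in>primes_upto x. vonM p) \<le> 16 * x / L + 2 / L * (D * x)"
      using L by (simp add: mult_left_mono divide_right_mono)
    moreover have "(\<Sum>p\<in>primes_upto x. vonM p) \<le> psi x"
      unfolding psi_def by (rule sum_mono2) (auto simp: primes_upto_def mem_nats_upto mangoldt_nonneg)
    ultimately have "N * L \<le> (x + C * x / L) + (16 * x / L + 2 / L * (D * x))" using psi by linarith
    hence "N \<le> ((x + C * x / L) + (16 * x / L + 2 / L * (D * x))) / L" using L by (simp add: pos_le_divide_eq)
    also have "\<dots> = x / L + (C + (16 + 2 * D)) * x / L ^ 2"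
      using L by (simp add: field_simps power2_eq_square)
    finally have up: "N \<le> x / L + (C + (16 + 2 * D)) * x / L ^ 2" .
    have "C * x / L ^ 2 \<le> (C + (16 + 2 * D)) * x / L ^ 2"
      using D(1) x1 by (intro divide_right_mono mult_right_mono) auto
    thus ?thesis using lo up unfolding L_def[symmetric] N_def[symmetric] by (simp only: abs_le_iff) linarith
  qed
  thus ?thesis using C(1) D(1) by (intro that[of "C + (16 + 2 * D)"]) auto
qed

section \<open>Counting KP numbers\<close>

text \<open>The inequality is strict to match the strict bound in \<open>KP\<close>; the only prime
  lost against \<open>primes_upto x\<close> is \<open>x\<close> itself.\<close>

definition primes_below :: "real \<Rightarrow> nat set" where "primes_below x = {p. prime p \<and> real p < x}"

lemma finite_primes_below [simp, intro]: "finite (primes_below x)"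
  by (rule finite_subset[OF _ finite_primes_upto[of x]]) (auto simp: primes_upto_def primes_below_def)

lemma primes_below_eq_empty:
  assumes "x \<le> 1"
  shows "primes_below x = {}"
proof -
  have False if "prime p" "real p < x" for p
  proof -
    have "real p > 1" using prime_gt_1_nat[OF that(1)] by simp
    thus False using that(2) assms by linarith
  qed
  thus ?thesis unfolding primes_below_def by blast
qed

lemma card_primes_below_le: 
  assumes "x \<ge> 0"
  shows "real (card (primes_below x)) \<le> x"
proof -
  have "card (primes_below x) \<le> card {1..nat \<lfloor>x\<rfloor>}"
    by (intro card_mono) (auto simp: primes_below_def le_nat_floor Suc_le_eq prime_gt_0_nat)
  hence "real (card (primes_below x)) \<le> real (nat \<lfloor>x\<rfloor>)" by simp
  also have "\<dots> \<le> x" using assms by (intro of_nat_floor) auto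
  finally show ?thesis .
qed

lemma card_primes_below_asymp:
  obtains C where "C \<ge> 0" "\<And>x. x \<ge> exp 2 \<Longrightarrow> \<bar>real (card (primes_below x)) - x / ln x\<bar> \<le> C * x / (ln x) ^ 2"
proof -
  obtain C where C: "C \<ge> 0" "\<And>x. x \<ge> exp 2 \<Longrightarrow> \<bar>real (card (primes_upto x)) - x / ln x\<bar> \<le> C * x / (ln x) ^ 2"
    using card_primes_upto_asymp by blast
  have "\<bar>real (card (primes_below x)) - x / ln x\<bar> \<le> (C + 16) * x / (ln x) ^ 2" if x: "x \<ge> exp 2" for x
  proof -
    have x1: "x > 1" using x one_less_exp_iff[of "2::real"] by linarith
    have "card (primes_below x) \<le> card (primes_upto x)"
      by (intro card_mono finite_primes_upto) (auto simp: primes_below_def primes_upto_def)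
    moreover have "card (primes_upto x) \<le> card (primes_below x) + 1"
    proof -
      have "primes_upto x \<subseteq> insert (nat \<lfloor>x\<rfloor>) (primes_below x)"
      proof
        fix p assume "p \<in> primes_upto x"
        thus "p \<in> insert (nat \<lfloor>x\<rfloor>) (primes_below x)"
          by (cases "real p = x") (auto simp: primes_below_def primes_upto_def)
      qed
      hence "card (primes_upto x) \<le> card (insert (nat \<lfloor>x\<rfloor>) (primes_below x))" by (intro card_mono) auto
      also have "\<dots> \<le> card (primes_below x) + 1" by (simp add: card_insert_if)
      finally show ?thesis .
    qed
    ultimately have "\<bar>real (card (primes_below x)) - real (card (primes_upto x))\<bar> \<le> 1" by linarith
    moreover have "(C + 16) * x / (ln x) ^ 2 = C * x / (ln x) ^ 2 + 16 * x / (ln x) ^ 2"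
      by (simp add: distrib_right add_divide_distrib)
    ultimately show ?thesis using C(2)[OF x] one_le_div_ln_sq[OF x1] by linarith
  qed
  thus ?thesis using C(1) by (intro that[of "C + 16"]) auto
qed

text \<open>If the primes differed, the multiplicity of \<open>p\<close> would be 1 modulo
  \<open>k\<close> on one side and 0 modulo \<open>k\<close> on the other.\<close>

lemma KP_representation_unique:
  fixes p q a b k :: nat
  assumes "prime p" "prime q" "a > 0" "b > 0" "k > 1" "p * a ^ k = q * b ^ k"
  shows "p = q \<and> a = b"
proof -
  have "p = q"
  proof (rule ccontr)
    assume ne: "p \<noteq> q"
    have "multiplicity p (p * a ^ k) = 1 + k * multiplicity p a"
      using assms by (subst prime_elem_multiplicity_mult_distrib) (auto simp: prime_elem_multiplicity_power_distrib multiplicity_self)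
    moreover have "multiplicity p (q * b ^ k) = k * multiplicity p b"
      using assms ne by (subst prime_elem_multiplicity_mult_distrib) 
        (auto simp: prime_elem_multiplicity_power_distrib prime_multiplicity_other)
    ultimately have "1 + k * multiplicity p a = k * multiplicity p b" using assms(6) by simp
    hence "k dvd 1" by (metis dvd_add_left_iff dvd_triv_left)
    thus False using assms(5) by simp
  qed
  moreover from this have "a ^ k = b ^ k" using assms by (auto simp: prime_gt_0_nat)
  hence "a = b" using assms(5) power_eq_iff_eq_base[of k a b] by simp
  ultimately show ?thesis by blast
qed

text \<open>Uniqueness of the representation makes the parametrisation by pairs injective. The range
  of \<open>a\<close> is finite because \<open>a \<le> a ^ k \<le> m < n\<close>.\<close>

lemma KP_eq_sum:
  assumes k: "k > 1"
  shows "KP k n = (\<Sum>a\<in>{2..<n}. card (primes_below (real n / real a ^ k)))"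
proof -
  define S where "S = (SIGMA a:{2..<n}. primes_below (real n / real a ^ k))"
  have iff: "real p < real n / real a ^ k \<longleftrightarrow> p * a ^ k < n" if "a \<ge> 2" for p a :: nat
  proof -
    have "real a ^ k > 0" using that by simp
    hence "real p < real n / real a ^ k \<longleftrightarrow> real (p * a ^ k) < real n" by (simp add: pos_less_divide_eq)
    thus ?thesis by (simp only: of_nat_less_iff)
  qed
  have "{m. m < n \<and> KP_number k m} = (\<lambda>(a,p). p * a ^ k) ` S"
  proof (intro equalityI subsetI)
    fix m assume "m \<in> {m. m < n \<and> KP_number k m}"
    then obtain p a where pa: "prime p" "a \<ge> 2" "m = p * a ^ k" "m < n" by (auto simp: KP_number_def)
    have "a ^ 1 \<le> a ^ k" using pa k by (intro power_increasing) auto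
    also have "\<dots> \<le> m" using pa by (simp add: Suc_le_eq prime_gt_0_nat)
    finally have "a < n" using pa by simp
    hence "(a, p) \<in> S" using pa iff by (auto simp: S_def primes_below_def)
    thus "m \<in> (\<lambda>(a,p). p * a ^ k) ` S" using pa by force
  next
    fix m assume "m \<in> (\<lambda>(a,p). p * a ^ k) ` S"
    then obtain a p where "a \<ge> 2" "prime p" "m = p * a ^ k" "real p < real n / real a ^ k"
      by (auto simp: S_def primes_below_def)
    thus "m \<in> {m. m < n \<and> KP_number k m}" using iff unfolding KP_number_def by blast
  qed
  moreover have "inj_on (\<lambda>(a,p). p * a ^ k) S"
  proof (rule inj_onI)
    fix u v assume uv: "u \<in> S" "v \<in> S" "(\<lambda>(a,p). p * a ^ k) u = (\<lambda>(a,p). p * a ^ k) v"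
    obtain a p b q where "u = (a, p)" "v = (b, q)" by fastforce
    thus "u = v" using uv KP_representation_unique[of p q a b k] k by (auto simp: S_def primes_below_def)
  qed
  ultimately have "KP k n = card S" by (simp add: KP_def card_image)
  also have "\<dots> = (\<Sum>a\<in>{2..<n}. card (primes_below (real n / real a ^ k)))"
    unfolding S_def by (rule card_SigmaI) auto
  finally show ?thesis .
qed

text \<open>The bound has to be summable over \<open>a\<close>. The quotient supplies the exponent
  -2; half a power is given up to absorb the factor \<open>ln a\<close> that arises when
  \<open>ln (n / a ^ k)\<close> is replaced by \<open>ln n\<close>.\<close>

lemma KP_term_bound:
  assumes k: "k > 1"
  obtains C where "C \<ge> 0" "\<And>n a :: nat. real n \<ge> exp 4 \<Longrightarrow> a \<ge> 2 \<Longrightarrow> 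
     \<bar>real (card (primes_below (real n / real a ^ k))) - real n / real a ^ k / ln (real n)\<bar> 
       \<le> C * real a powr (-3/2) * (real n / (ln (real n)) ^ 2)"
proof -
  obtain C where C: "C \<ge> 0" "\<And>x. x \<ge> exp 2 \<Longrightarrow> \<bar>real (card (primes_below x)) - x / ln x\<bar> \<le> C * x / (ln x) ^ 2"
    using card_primes_below_asymp by blast
  \<comment> \<open>The term \<open>4 * C\<close> comes from \<open>ln y \<ge> L / 2\<close>
    squared, \<open>4 * real k\<close> from \<open>ln a\<close> being at most twice the root of
    \<open>a\<close>, and 512 from the range of large \<open>a\<close>.\<close>
  define C' where "C' = (4 * C + 4 * real k) + 512"
  have "\<bar>real (card (primes_below (real n / real a ^ k))) - real n / real a ^ k / ln (real n)\<bar> 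
       \<le> C' * real a powr (-3/2) * (real n / (ln (real n)) ^ 2)"
    if n: "real n \<ge> exp 4" and a: "a \<ge> 2" for n a :: nat
  proof -
    define x where "x = real n"
    define L where "L = ln x"
    have x0: "x > 0" using n less_le_trans[OF exp_gt_zero n] by (simp add: x_def)
    have L: "L \<ge> 4" using n x0 by (simp add: x_def L_def ln_ge_iff)
    have x1: "x > 1" using n one_less_exp_iff[of "4::real"] unfolding x_def by linarith
    define A where "A = real a ^ k"
    have A: "A > 0" using a by (simp add: A_def)
    have A2: "A \<ge> real a powr 2"
      using a k power_increasing[of 2 k "real a"] by (simp add: A_def)
    define y where "y = x / A"
    have y: "y > 0" using x0 A by (simp add: y_def)
    have y_le: "y \<le> real a powr (-2) * x"
    proof -
      have "y \<le> x / real a powr 2" unfolding y_def using A2 A x0 a by (intro divide_left_mono) auto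
      thus ?thesis by (simp add: powr_minus field_simps)
    qed
    define E where "E = real a powr (-3/2) * (x / L ^ 2)"
    have E: "E \<ge> 0" using x0 by (simp add: E_def)
    have "\<bar>real (card (primes_below y)) - y / L\<bar> \<le> C' * E"
    \<comment> \<open>For \<open>A\<close> up to the root of \<open>x\<close> the quotient
      \<open>y\<close> is at least that root, hence at least \<open>exp 2\<close> by
      \<open>n \<ge> exp 4\<close>, and the prime number theorem applies to it. Beyond, both
      quantities compared are at most \<open>y\<close>.\<close>
    proof (cases "A \<le> x powr (1/2)")
      case True
      have "x powr (1/2) = x / x powr (1/2)" using x0 powr_add[of x "1/2" "1/2"] by (simp add: field_simps)
      also have "\<dots> \<le> y" unfolding y_def using True A x0 by (intro divide_left_mono) auto
      finally have "ln (x powr (1/2)) \<le> ln y" using x0 y by (subst ln_le_cancel_iff) auto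
      hence ly: "L / 2 \<le> ln y" using x0 by (simp add: ln_powr L_def)
      hence "y \<ge> exp 2" using L y by (subst ln_ge_iff[symmetric]) auto
      hence "\<bar>real (card (primes_below y)) - y / ln y\<bar> \<le> C * y / (ln y) ^ 2" by (rule C(2))
      also have "\<dots> \<le> C * y / (L / 2) ^ 2"
        using ly L C(1) y by (intro divide_left_mono power_mono mult_pos_pos) auto
      also have "\<dots> = 4 * C * y / L ^ 2" by (simp add: power_divide)
      finally have 1: "\<bar>real (card (primes_below y)) - y / ln y\<bar> \<le> 4 * C * y / L ^ 2" .
      have lny: "ln y = L - real k * ln (real a)"
        using x0 a by (simp add: y_def A_def L_def ln_div ln_realpow)
      have lna: "ln (real a) \<ge> 0" by (rule ln_of_nat_ge_0)
      have "y / ln y - y / L = y * (real k * ln (real a)) / (L * ln y)"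
      proof -
        have "y / ln y - y / L = y * (L - ln y) / (L * ln y)" using L ly by (simp add: field_simps)
        thus ?thesis by (simp add: lny)
      qed
      also have "\<dots> \<le> y * (real k * ln (real a)) / (L * (L / 2))"
        by (intro divide_left_mono mult_left_mono mult_nonneg_nonneg mult_pos_pos)
           (use ly L y lna in \<open>linarith | simp\<close>)+
      also have "\<dots> = 2 * real k * ln (real a) * y / L ^ 2" by (simp add: power2_eq_square)
      finally have 2: "y / ln y - y / L \<le> 2 * real k * ln (real a) * y / L ^ 2" .
      have 3: "y / ln y - y / L \<ge> 0"
      proof -
        have "ln y \<le> L" using lny lna by simp
        moreover have "0 < L * ln y" using ly L by (intro mult_pos_pos) linarith+
        ultimately have "y / L \<le> y / ln y" using y by (intro divide_left_mono) auto
        thus ?thesis by simp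
      qed
      have "\<bar>real (card (primes_below y)) - y / L\<bar> \<le> 4 * C * y / L ^ 2 + 2 * real k * ln (real a) * y / L ^ 2"
        using 1 2 3 by linarith
      also have "\<dots> = (4 * C + 2 * real k * ln (real a)) * (y / L ^ 2)"
        by (simp add: distrib_right add_divide_distrib)
      also have "\<dots> \<le> ((4 * C + 4 * real k) * real a powr (1/2)) * (real a powr (-2) * x / L ^ 2)"
      proof (intro mult_mono divide_right_mono y_le)
        have "ln (real a) = 2 * ln (real a powr (1/2))" using a by (simp add: ln_powr)
        also have "ln (real a powr (1/2)) \<le> real a powr (1/2)" using ln_le_minus_one[of "real a powr (1/2)"] a by simp
        finally have "2 * real k * ln (real a) \<le> 2 * real k * (2 * real a powr (1/2))" by (intro mult_left_mono) auto
        moreover have "4 * C * 1 \<le> 4 * C * real a powr (1/2)" 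
          using a C(1) by (intro mult_left_mono ge_one_powr_ge_zero) auto
        ultimately show "4 * C + 2 * real k * ln (real a) \<le> (4 * C + 4 * real k) * real a powr (1/2)"
          by (simp add: algebra_simps)
      qed (use C(1) y in auto)
      also have "\<dots> = (4 * C + 4 * real k) * (real a powr (1/2 + (-2)) * (x / L ^ 2))"
        by (subst powr_add) simp
      also have "\<dots> = (4 * C + 4 * real k) * E" by (simp add: E_def)
      also have "\<dots> \<le> C' * E" using E by (intro mult_right_mono) (auto simp: C'_def)
      finally show ?thesis .
    next
      case False
      have "real (card (primes_below y)) \<le> y" using y by (intro card_primes_below_le) auto
      moreover have "y / L \<le> y / 1" using y L by (intro divide_left_mono) auto
      moreover have "y / L \<ge> 0" using y L by simp
      ultimately have le2: "\<bar>real (card (primes_below y)) - y / L\<bar> \<le> 2 * y" by linarith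
      \<comment> \<open>The power \<open>A powr (-1)\<close> is split: three quarters provide the
        decay \<open>a powr (-3/2)\<close>, and the last quarter is at most
        \<open>x powr (-1/8)\<close>, which beats the square of the logarithm.\<close>
      have "2 * y = 2 * (x * (A powr (-3/4) * A powr (-1/4)))" 
        using A by (simp add: y_def powr_minus_divide flip: powr_add)
      also have "\<dots> \<le> 2 * (x * (real a powr (-3/2) * (256 / L ^ 2)))"
      proof (intro mult_left_mono mult_mono)
        have "A powr (-3/4) \<le> (real a powr 2) powr (-3/4)" using A2 a by (intro powr_mono2') auto
        also have "\<dots> = real a powr (-3/2)" unfolding powr_powr by simp
        finally show "A powr (-3/4) \<le> real a powr (-3/2)" .
        have "A powr (-1/4) \<le> (x powr (1/2)) powr (-1/4)" using False x0 by (intro powr_mono2') auto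
        also have "\<dots> = x powr (-1/8)" unfolding powr_powr by simp
        also have "\<dots> \<le> 256 / L ^ 2"
        proof -
          have "L = 16 * ln (x powr (1/16))" using x0 by (simp add: L_def ln_powr)
          also have "ln (x powr (1/16)) \<le> x powr (1/16)" using ln_le_minus_one[of "x powr (1/16)"] x0 by simp
          finally have "L ^ 2 \<le> (16 * x powr (1/16)) ^ 2" using L by (intro power_mono) auto
          also have "\<dots> = 256 * x powr (1/8)" unfolding power_mult_distrib using x0 by (simp add: powr_power)
          finally have "L ^ 2 * x powr (-1/8) \<le> 256 * x powr (1/8) * x powr (-1/8)" by (intro mult_right_mono) auto
          also have "\<dots> = 256" using x0 by (simp add: mult.assoc flip: powr_add)
          finally show ?thesis using L by (simp add: field_simps)
        qed
        finally show "A powr (-1/4) \<le> 256 / L ^ 2" .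
      qed (use x0 in auto)
      also have "\<dots> = 512 * E" by (simp add: E_def)
      also have "\<dots> \<le> C' * E" using E C(1) by (intro mult_right_mono) (auto simp: C'_def)
      finally have "2 * y \<le> C' * E" .
      with le2 show ?thesis by (rule order.trans)
    qed
    thus ?thesis by (simp add: E_def y_def x_def A_def L_def mult.assoc)
  qed
  thus ?thesis using C(1) by (intro that[of C']) (auto simp: C'_def)
qed

lemma summable_inverse_powr: "k > 1 \<Longrightarrow> summable (\<lambda>n. 1 / real (Suc n) powr real k)"
proof -
  assume k: "k > 1"
  have "summable (\<lambda>n. real (Suc n) powr (- real k))"
    by (subst summable_Suc_iff, subst summable_real_powr_iff) (use k in auto)
  thus ?thesis by (simp add: powr_minus_divide)
qed

lemma zeta_minus_1_sums:
  assumes k: "k > 1"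
  shows "(\<lambda>n. 1 / real (n + 2) ^ k) sums (zeta (real k) - 1)"
proof -
  have "(\<lambda>n. 1 / real (Suc n) powr real k) sums zeta (real k)"
    unfolding zeta_def by (rule summable_sums[OF summable_inverse_powr[OF k]])
  moreover have "1 / real (Suc n) powr real k = 1 / real (Suc n) ^ k" for n
    by (subst powr_realpow) auto
  ultimately have "(\<lambda>n. 1 / real (Suc n) ^ k) sums zeta (real k)" by (simp only:)
  hence "(\<lambda>n. 1 / real (Suc (Suc n)) ^ k) sums (zeta (real k) - 1 / real (Suc 0) ^ k)"
    by (subst sums_Suc_iff) simp
  thus ?thesis by simp
qed

theorem theorem4p1:
  fixes k :: nat
  assumes "k > 1"
  shows "(\<lambda>n::nat. real (KP k n) - (zeta (real k) - 1) * (real n / ln (real n)))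
           \<in> O(\<lambda>n. real n / (ln (real n))\<^sup>2)"
proof -
  obtain C where C: "C \<ge> 0" "\<And>n a :: nat. real n \<ge> exp 4 \<Longrightarrow> a \<ge> 2 \<Longrightarrow> 
     \<bar>real (card (primes_below (real n / real a ^ k))) - real n / real a ^ k / ln (real n)\<bar> 
       \<le> C * real a powr (-3/2) * (real n / (ln (real n)) ^ 2)"
    using KP_term_bound[OF assms] by blast
  define S where "S = (\<Sum>a. real (a + 2) powr (-3/2))"
  have summ: "summable (\<lambda>a. real (a + 2) powr (-3/2))"
    by (subst summable_iff_shift, subst summable_real_powr_iff) auto
  have bound: "\<bar>real (KP k n) - (zeta (real k) - 1) * (real n / ln (real n))\<bar> \<le> C * S * (real n / (ln (real n)) ^ 2)"
    if n: "real n \<ge> exp 4" for n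
  proof -
    define g where "g = (\<lambda>a. real (card (primes_below (real n / real (a + 2) ^ k))))"
    \<comment> \<open>The count becomes a full series: for \<open>a + 2 \<ge> n\<close> the quotient
      is at most 1 and no prime lies below it. The termwise bound holds for these \<open>a\<close>
      as well, so the tail of the zeta series is covered by it.\<close>
    have "g sums (\<Sum>a\<in>{..<n - 2}. g a)"
    proof (rule sums_finite)
      fix a assume a: "a \<notin> {..<n - 2}"
      have "n \<le> (a + 2) ^ 1" using a by auto
      also have "\<dots> \<le> (a + 2) ^ k" using assms by (intro power_increasing) auto
      finally have "real n \<le> real (a + 2) ^ k" by (simp only: of_nat_power [symmetric] of_nat_le_iff)
      hence "real n / real (a + 2) ^ k \<le> 1" by (simp add: divide_le_eq)
      hence "primes_below (real n / real (a + 2) ^ k) = {}" by (rule primes_below_eq_empty)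
      thus "g a = 0" by (simp only: g_def) simp
    qed auto
    also have "(\<Sum>a\<in>{..<n - 2}. g a) = (\<Sum>a\<in>{2..<n}. real (card (primes_below (real n / real a ^ k))))"
      by (rule sum.reindex_bij_witness[of _ "\<lambda>a. a - 2" "\<lambda>a. a + 2"]) (auto simp: g_def)
    also have "\<dots> = real (KP k n)" by (simp add: KP_eq_sum[OF assms])
    finally have sm: "(\<lambda>a. g a - 1 / real (a + 2) ^ k * (real n / ln (real n))) sums 
        (real (KP k n) - (zeta (real k) - 1) * (real n / ln (real n)))"
      by (rule sums_diff[OF _ sums_mult2[OF zeta_minus_1_sums[OF assms]]])
    have le: "norm (g a - 1 / real (a + 2) ^ k * (real n / ln (real n))) \<le> 
                         (C * (real n / (ln (real n)) ^ 2)) * real (a + 2) powr (-3/2)" for a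
      using C(2)[OF n, of "a + 2"] by (simp add: g_def mult_ac)
    have "norm (real (KP k n) - (zeta (real k) - 1) * (real n / ln (real n))) \<le> 
        (\<Sum>a. (C * (real n / (ln (real n)) ^ 2)) * real (a + 2) powr (-3/2))"
      using norm_suminf_le[OF le summable_mult[OF summ]] unfolding sums_unique[OF sm, symmetric] .
    also have "\<dots> = (C * (real n / (ln (real n)) ^ 2)) * S"
      unfolding S_def by (rule suminf_mult[OF summ])
    finally show ?thesis by (simp add: mult_ac)
  qed
  show ?thesis
  proof (rule bigoI)
    have "eventually (\<lambda>n::nat. real n \<ge> exp 4) sequentially"
      using filterlim_real_sequentially unfolding filterlim_at_top by (rule spec)
    thus "eventually (\<lambda>n. norm (real (KP k n) - (zeta (real k) - 1) * (real n / ln (real n)))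
           \<le> C * S * norm (real n / (ln (real n))\<^sup>2)) sequentially"
    proof eventually_elim
      case (elim n)
      show ?case using bound[OF elim] by simp
    qed
  qed
qed

end
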